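(* Let $G$ be a locally finite connected graph with at least three vertices such that $|G|$ contains a spanning topological caterpillar. Then the square $G^2$ is Hamiltonian, i.e. $|G^2|$ contains a Hamilton circle.
   Context: All graphs are simple. For a locally finite connected graph $H$, an end of $H$ is an equivalence class of rays (one-way infinite paths) of $H$, two rays being equivalent if no finite set of vertices separates them. $|H|$ denotes the Freudenthal compactification of $H$: the graph $H$ viewed as a 1-complex together with its ends, with the standard topology in which, for every finite $S\subseteq V(H)$ and end $\omega$, the set consisting of the component $C$ of $H-S$ containing tails of all rays of $\omega$, all ends whose rays have tails in $C$, and the inner points of the edges between $S$ and $C$, is an open neighbourhood of $\omega$. A circle in $|H|$ is a homeomorphic image of the unit circle $S^1$ in $|H|$; an arc is a homeomorphic image of $[0,1]$. A Hamilton circle of $H$ is a circle in $|H|$ containing all vertices of $H$; $H$ is Hamiltonian if one exists. For a subgraph $F$ of $H$, $\overline{F}$ denotes its closure in $|H|$; such closures are called standard subspaces. A topological tree is an arc-connected standard subspace of $|H|$ containing no circle. A topological caterpillar is a topological tree $\overline{T}$, where $T$ is a forest in $H$, such that $\overline{T-L}$ is an arc, where $L$ is the set of vertices of degree $1$ in $T$. It is spanning if it contains all vertices of $H$. The square $G^2$ is obtained from $G$ by adding an edge between any two vertices at distance $2$ in $G$. *)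

theory Defs
  imports "HOL-Analysis.Analysis"
begin

type_synonym 'v graph = "'v set \<times> 'v set set"

definition simple_graph :: "'v graph \<Rightarrow> bool" where
  "simple_graph G \<longleftrightarrow>
     (\<forall>e\<in>snd G. \<exists>u v. e = {u, v} \<and> u \<noteq> v \<and> u \<in> fst G \<and> v \<in> fst G)"

definition locally_finite :: "'v graph \<Rightarrow> bool" where
  "locally_finite G \<longleftrightarrow> (\<forall>v\<in>fst G. finite {e\<in>snd G. v \<in> e})"

definition reach :: "'v graph \<Rightarrow> 'v set \<Rightarrow> 'v \<Rightarrow> 'v \<Rightarrow> bool" where
  "reach G W = (\<lambda>x y. {x, y} \<in> snd G \<and> x \<in> W \<and> y \<in> W)\<^sup>*\<^sup>*"

definition connected_graph :: "'v graph \<Rightarrow> bool" where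
  "connected_graph G \<longleftrightarrow> fst G \<noteq> {} \<and> (\<forall>u\<in>fst G. \<forall>v\<in>fst G. reach G (fst G) u v)"

definition comps :: "'v graph \<Rightarrow> 'v set \<Rightarrow> 'v set set" where
  "comps G S = {{u. reach G (fst G - S) v u} | v. v \<in> fst G - S}"

definition is_ray :: "'v graph \<Rightarrow> (nat \<Rightarrow> 'v) \<Rightarrow> bool" where
  "is_ray G r \<longleftrightarrow> inj r \<and> (\<forall>n. {r n, r (Suc n)} \<in> snd G)"

definition tail_in :: "(nat \<Rightarrow> 'v) \<Rightarrow> 'v set \<Rightarrow> bool" where
  "tail_in r C \<longleftrightarrow> (\<exists>n. \<forall>m\<ge>n. r m \<in> C)"

definition ray_equiv :: "'v graph \<Rightarrow> (nat \<Rightarrow> 'v) \<Rightarrow> (nat \<Rightarrow> 'v) \<Rightarrow> bool" where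
  "ray_equiv G r s \<longleftrightarrow>
     (\<forall>S. finite S \<and> S \<subseteq> fst G \<longrightarrow> (\<exists>C\<in>comps G S. tail_in r C \<and> tail_in s C))"

definition ends :: "'v graph \<Rightarrow> (nat \<Rightarrow> 'v) set set" where
  "ends G = {{s. is_ray G s \<and> ray_equiv G r s} | r. is_ray G r}"

text \<open>Points of the 1-complex G, in barycentric coordinates: a vertex v is the
indicator of v; an inner point of the edge uv is a function supported exactly on {u,v}
with positive values summing to 1.\<close>
definition vertex_pt :: "'v \<Rightarrow> 'v \<Rightarrow> real" where
  "vertex_pt v = (\<lambda>w. if w = v then 1 else 0)"

definition is_gpt :: "'v graph \<Rightarrow> ('v \<Rightarrow> real) \<Rightarrow> bool" where
  "is_gpt G p \<longleftrightarrow>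
     (\<exists>v\<in>fst G. p = vertex_pt v) \<or>
     (\<exists>u v. {u, v} \<in> snd G \<and> u \<noteq> v \<and> p u > 0 \<and> p v > 0 \<and> p u + p v = 1 \<and>
            (\<forall>w. w \<noteq> u \<and> w \<noteq> v \<longrightarrow> p w = 0))"

datatype 'v fpoint = Gp "'v \<Rightarrow> real" | Ep "(nat \<Rightarrow> 'v) set"

definition fpoints :: "'v graph \<Rightarrow> 'v fpoint set" where
  "fpoints G = Gp ` {p. is_gpt G p} \<union> Ep ` ends G"

text \<open>Basic neighbourhoods of points of the 1-complex (for locally finite graphs this
is the usual 1-complex topology: edges are unit intervals).\<close>
definition vball :: "'v graph \<Rightarrow> ('v \<Rightarrow> real) \<Rightarrow> real \<Rightarrow> 'v fpoint set" where
  "vball G p \<epsilon> = Gp ` {q. is_gpt G q \<and> (\<forall>w. \<bar>q w - p w\<bar> < \<epsilon>)}"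

text \<open>The set \<hat>C(S,\<omega>): the component C of G - S (with its inner edge points),
all ends living in C, and the inner points of the S--C edges.\<close>
definition end_nbhd :: "'v graph \<Rightarrow> 'v set \<Rightarrow> 'v set \<Rightarrow> 'v fpoint set" where
  "end_nbhd G S C =
     Gp ` {q. is_gpt G q \<and> {w. q w \<noteq> 0} \<subseteq> C \<union> S \<and> {w. q w \<noteq> 0} \<inter> C \<noteq> {}} \<union>
     Ep ` {\<omega>\<in>ends G. \<forall>r\<in>\<omega>. tail_in r C}"

definition basic_nbhd :: "'v graph \<Rightarrow> 'v fpoint \<Rightarrow> 'v fpoint set \<Rightarrow> bool" where
  "basic_nbhd G x N \<longleftrightarrow>
     (\<exists>p \<epsilon>. x = Gp p \<and> is_gpt G p \<and> \<epsilon> > 0 \<and> N = vball G p \<epsilon>) \<or>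
     (\<exists>\<omega> S C. x = Ep \<omega> \<and> \<omega> \<in> ends G \<and> finite S \<and> S \<subseteq> fst G \<and> C \<in> comps G S \<and>
              (\<forall>r\<in>\<omega>. tail_in r C) \<and> N = end_nbhd G S C)"

definition freudenthal :: "'v graph \<Rightarrow> 'v fpoint topology" where
  "freudenthal G = topology (\<lambda>U. U \<subseteq> fpoints G \<and> (\<forall>x\<in>U. \<exists>N. basic_nbhd G x N \<and> N \<subseteq> U))"

definition subgraph :: "'v graph \<Rightarrow> 'v graph \<Rightarrow> bool" where
  "subgraph F G \<longleftrightarrow> fst F \<subseteq> fst G \<and> snd F \<subseteq> snd G \<and> (\<forall>e\<in>snd F. e \<subseteq> fst F)"

definition graph_pts :: "'v graph \<Rightarrow> 'v graph \<Rightarrow> 'v fpoint set" where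
  "graph_pts G F = Gp ` {p. is_gpt G p \<and>
      ({w. p w \<noteq> 0} \<in> snd F \<or> (\<exists>v\<in>fst F. {w. p w \<noteq> 0} = {v}))}"

definition std_closure :: "'v graph \<Rightarrow> 'v graph \<Rightarrow> 'v fpoint set" where
  "std_closure G F = freudenthal G closure_of graph_pts G F"

definition is_circle :: "'a topology \<Rightarrow> 'a set \<Rightarrow> bool" where
  "is_circle X C \<longleftrightarrow> C \<subseteq> topspace X \<and>
     (\<exists>f. homeomorphic_map (top_of_set (sphere (0::complex) 1)) (subtopology X C) f)"

definition is_arc :: "'a topology \<Rightarrow> 'a set \<Rightarrow> bool" where
  "is_arc X A \<longleftrightarrow> A \<subseteq> topspace X \<and>
     (\<exists>f. homeomorphic_map (top_of_set {0..1::real}) (subtopology X A) f)"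

definition arc_connected_in :: "'a topology \<Rightarrow> 'a set \<Rightarrow> bool" where
  "arc_connected_in X S \<longleftrightarrow> S \<subseteq> topspace X \<and>
     (\<forall>x\<in>S. \<forall>y\<in>S. x \<noteq> y \<longrightarrow>
        (\<exists>A f. A \<subseteq> S \<and> homeomorphic_map (top_of_set {0..1::real}) (subtopology X A) f
               \<and> f 0 = x \<and> f 1 = y))"

definition topological_tree :: "'v graph \<Rightarrow> 'v fpoint set \<Rightarrow> bool" where
  "topological_tree G S \<longleftrightarrow>
     (\<exists>F. subgraph F G \<and> S = std_closure G F) \<and>
     arc_connected_in (freudenthal G) S \<and>
     \<not> (\<exists>C\<subseteq>S. is_circle (freudenthal G) C)"

definition forest :: "'v graph \<Rightarrow> bool" where
  "forest F \<longleftrightarrow> \<not> (\<exists>vs. length vs \<ge> 3 \<and> distinct vs \<and>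
      (\<forall>i<length vs. {vs ! i, vs ! ((i + 1) mod length vs)} \<in> snd F))"

definition degree :: "'v graph \<Rightarrow> 'v \<Rightarrow> nat" where
  "degree F v = card {e\<in>snd F. v \<in> e}"

definition leaves :: "'v graph \<Rightarrow> 'v set" where
  "leaves F = {v\<in>fst F. degree F v = 1}"

definition del_vertices :: "'v graph \<Rightarrow> 'v set \<Rightarrow> 'v graph" where
  "del_vertices F L = (fst F - L, {e\<in>snd F. e \<inter> L = {}})"

definition topological_caterpillar :: "'v graph \<Rightarrow> 'v graph \<Rightarrow> bool" where
  "topological_caterpillar G T \<longleftrightarrow>
     subgraph T G \<and> forest T \<and> topological_tree G (std_closure G T) \<and>
     is_arc (freudenthal G) (std_closure G (del_vertices T (leaves T)))"

definition spanning :: "'v graph \<Rightarrow> 'v graph \<Rightarrow> bool" where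
  "spanning G T \<longleftrightarrow> (\<forall>v\<in>fst G. Gp (vertex_pt v) \<in> std_closure G T)"

definition hamiltonian :: "'v graph \<Rightarrow> bool" where
  "hamiltonian G \<longleftrightarrow>
     (\<exists>C. is_circle (freudenthal G) C \<and> (\<forall>v\<in>fst G. Gp (vertex_pt v) \<in> C))"

definition graph_square :: "'v graph \<Rightarrow> 'v graph" where
  "graph_square G = (fst G, snd G \<union>
     {{u, w} | u v w. u \<noteq> w \<and> {u, v} \<in> snd G \<and> {v, w} \<in> snd G})"

end

theory Submission
  imports Defs "HOL-Complex_Analysis.Contour_Integration"
begin

text \<open>
  The closure of the spine of a spanning topological caterpillar is an arc, parametrised by the unit
  interval; the set of parameters of ends is closed, and the components of its complement
  (\<open>gaps\<close>) carry finite or infinite paths of spine vertices. In the square, the arc can be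
  turned into a single strand through all vertices by inserting the leaves of every spine vertex next
  to it, and this strand passes every end exactly once. It is closed up by a second strand that runs
  from one end point of the arc to the other: as the graph is connected, some walk (possibly one that
  converges to an end at either side) joins the two end points, and after loop erasure it enters every
  gap at most once. Between the entry and the exit the two strands run in parallel through the gap,
  alternately taking a spine vertex and the leaves of its neighbour, and between two gaps the second
  strand uses an edge of the graph.
\<close>

subsection \<open>Components and ends\<close>

abbreviation lives_in :: "(nat \<Rightarrow> 'v) set \<Rightarrow> 'v set \<Rightarrow> bool" where
  "lives_in \<omega> C \<equiv> \<forall>r\<in>\<omega>. tail_in r C"

lemma tail_in_common: "tail_in r C \<Longrightarrow> tail_in r D \<Longrightarrow> \<exists>x. x \<in> C \<and> x \<in> D"
  unfolding tail_in_def by (metis linear)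

lemma tail_in_mono: "tail_in r C \<Longrightarrow> C \<subseteq> D \<Longrightarrow> tail_in r D"
  unfolding tail_in_def by blast

lemma reach_trans: "reach G W x y \<Longrightarrow> reach G W y z \<Longrightarrow> reach G W x z"
  unfolding reach_def by auto

lemma reach_mono: "reach G W x y \<Longrightarrow> snd G \<subseteq> snd H \<Longrightarrow> W \<subseteq> W' \<Longrightarrow> reach H W' x y"
  unfolding reach_def by (erule rtranclp_mono[THEN predicate2D, rotated]) auto

lemma reach_edge: "{x, y} \<in> snd G \<Longrightarrow> x \<in> W \<Longrightarrow> y \<in> W \<Longrightarrow> reach G W x y"
  unfolding reach_def by auto

lemma reach_in: "reach G W x y \<Longrightarrow> x \<in> W \<Longrightarrow> y \<in> W"
  unfolding reach_def by (induction rule: rtranclp_induct) auto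

lemma reach_sym:
  assumes "reach G W x y"
  shows "reach G W y x"
proof -
  have "symp (\<lambda>x y. {x, y} \<in> snd G \<and> x \<in> W \<and> y \<in> W)"
    by (rule sympI) (metis insert_commute)
  then show ?thesis using assms unfolding reach_def by (rule sympD[OF symp_rtranclp])
qed

lemma comp_subset: "C \<in> comps G S \<Longrightarrow> C \<subseteq> fst G - S"
  unfolding comps_def by (auto dest: reach_in)

lemma comp_reach: "C \<in> comps G S \<Longrightarrow> x \<in> C \<Longrightarrow> y \<in> C \<Longrightarrow> reach G (fst G - S) x y"
  unfolding comps_def by (auto intro: reach_trans[OF reach_sym])

lemma comp_closed: "C \<in> comps G S \<Longrightarrow> x \<in> C \<Longrightarrow> reach G (fst G - S) x y \<Longrightarrow> y \<in> C"
  unfolding comps_def by (auto intro: reach_trans)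

lemma comp_eq: "C \<in> comps G S \<Longrightarrow> D \<in> comps G S \<Longrightarrow> x \<in> C \<Longrightarrow> x \<in> D \<Longrightarrow> C = D"
  using comp_reach comp_closed by (metis subset_antisym subsetI)

lemma comp_mono:
  assumes "C \<in> comps G S" "D \<in> comps H S'" "snd G \<subseteq> snd H" "fst G - S \<subseteq> fst H - S'"
    and "x \<in> C" "x \<in> D"
  shows "C \<subseteq> D"
proof
  fix y assume "y \<in> C"
  then have "reach G (fst G - S) x y" by (rule comp_reach[OF assms(1,5)])
  then have "reach H (fst H - S') x y" by (rule reach_mono[OF _ assms(3,4)])
  then show "y \<in> D" by (rule comp_closed[OF assms(2,6)])
qed

lemma ray_equiv_tail_in:
  assumes "ray_equiv G r s" "finite S" "S \<subseteq> fst G" "C \<in> comps G S" "tail_in r C"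
  shows "tail_in s C"
proof -
  obtain D where D: "D \<in> comps G S" "tail_in r D" "tail_in s D"
    using assms unfolding ray_equiv_def by blast
  then show ?thesis using comp_eq tail_in_common assms by metis
qed

lemma ray_equiv_sym: "ray_equiv G r s \<Longrightarrow> ray_equiv G s r"
  unfolding ray_equiv_def by blast

lemma ray_equiv_trans:
  assumes "ray_equiv G r s" "ray_equiv G s t"
  shows "ray_equiv G r t"
  unfolding ray_equiv_def
proof (intro allI impI)
  fix S assume S: "finite S \<and> S \<subseteq> fst G"
  then obtain C where "C \<in> comps G S" "tail_in r C" "tail_in s C"
    using assms(1) unfolding ray_equiv_def by blast
  then show "\<exists>C\<in>comps G S. tail_in r C \<and> tail_in t C" using ray_equiv_tail_in[OF assms(2)] S by blast
qed

lemma end_eq: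
  assumes "\<omega> \<in> ends G" "r \<in> \<omega>"
  shows "\<omega> = {s. is_ray G s \<and> ray_equiv G r s}"
  using assms ray_equiv_trans ray_equiv_sym unfolding ends_def by blast

lemma end_ray: "\<omega> \<in> ends G \<Longrightarrow> r \<in> \<omega> \<Longrightarrow> is_ray G r"
  unfolding ends_def by blast

lemma ends_disjoint:
  assumes "\<omega> \<in> ends G" "\<omega>' \<in> ends G" "r \<in> \<omega>" "r' \<in> \<omega>'" "ray_equiv G r r'"
  shows "\<omega> = \<omega>'"
proof -
  have "r' \<in> \<omega>" using end_eq[OF assms(1,3)] end_ray[OF assms(2,4)] assms(5) by blast
  then show ?thesis using end_eq[OF assms(1)] end_eq[OF assms(2,4)] by blast
qed

lemma end_lives_inI:
  assumes "\<omega> \<in> ends G" "r \<in> \<omega>" "finite S" "S \<subseteq> fst G" "C \<in> comps G S" "tail_in r C"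
  shows "lives_in \<omega> C"
  using end_eq[OF assms(1,2)] ray_equiv_tail_in[OF _ assms(3-6)] by blast

lemma ray_avoids_finite:
  assumes "is_ray G r" "finite S"
  shows "\<exists>n. \<forall>m\<ge>n. r m \<notin> S"
proof -
  have "finite (r -` S)" using assms unfolding is_ray_def by (intro finite_vimageI) auto
  then obtain n where "\<forall>m\<in>r -` S. m < n" using finite_nat_set_iff_bounded by blast
  then show ?thesis by (meson linorder_not_le vimageI)
qed

locale lf_graph =
  fixes G :: "'v graph"
  assumes simple: "simple_graph G" and lf: "locally_finite G"
begin

lemma edge_vertices: "{u, v} \<in> snd G \<Longrightarrow> u \<in> fst G \<and> v \<in> fst G \<and> u \<noteq> v"
  using simple unfolding simple_graph_def by (metis doubleton_eq_iff)

lemma finite_neighbours: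
  assumes "v \<in> fst G"
  shows "finite {u. {v, u} \<in> snd G}"
proof -
  have "finite {e \<in> snd G. v \<in> e}" using lf assms unfolding locally_finite_def by blast
  then have "finite (\<Union>{e \<in> snd G. v \<in> e})"
    using simple unfolding simple_graph_def by (intro finite_Union) auto
  then show ?thesis by (rule rev_finite_subset) auto
qed

definition closed_nbhd :: "'v set \<Rightarrow> 'v set" where
  "closed_nbhd S = S \<union> {u. \<exists>s\<in>S. {s, u} \<in> snd G}"

lemma subset_closed_nbhd: "S \<subseteq> closed_nbhd S"
  unfolding closed_nbhd_def by blast

lemma closed_nbhd_edge: "s \<in> S \<Longrightarrow> {s, u} \<in> snd G \<Longrightarrow> u \<in> closed_nbhd S"
  unfolding closed_nbhd_def by blast

lemma closed_nbhd_subset: "S \<subseteq> fst G \<Longrightarrow> closed_nbhd S \<subseteq> fst G"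
  unfolding closed_nbhd_def using edge_vertices by blast

lemma finite_closed_nbhd:
  assumes "finite S" "S \<subseteq> fst G"
  shows "finite (closed_nbhd S)"
proof -
  have "{u. \<exists>s\<in>S. {s, u} \<in> snd G} = (\<Union>s\<in>S. {u. {s, u} \<in> snd G})" by auto
  then show ?thesis unfolding closed_nbhd_def using assms finite_neighbours by auto
qed

lemma comp_edge: "C \<in> comps G S \<Longrightarrow> x \<in> C \<Longrightarrow> {x, y} \<in> snd G \<Longrightarrow> y \<notin> S \<Longrightarrow> y \<in> C"
  using comp_closed[of C G S x y] reach_edge[of x y G "fst G - S"] comp_subset edge_vertices by blast

lemma ray_vertex: "is_ray G r \<Longrightarrow> r n \<in> fst G"
  unfolding is_ray_def using edge_vertices by blast

lemma ray_comp:
  assumes r: "is_ray G r" and S: "finite S"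
  shows "\<exists>C\<in>comps G S. tail_in r C"
proof -
  obtain n where n: "\<forall>m\<ge>n. r m \<notin> S" using ray_avoids_finite[OF r S] by blast
  let ?C = "{u. reach G (fst G - S) (r n) u}"
  have C: "?C \<in> comps G S" unfolding comps_def using n ray_vertex[OF r] by blast
  have "r m \<in> ?C" if "m \<ge> n" for m using that
  proof (induction m rule: dec_induct)
    case base show ?case by (simp add: reach_def)
  next
    case (step m)
    then show ?case using comp_edge[OF C, of "r m" "r (Suc m)"] r n unfolding is_ray_def by auto
  qed
  then show ?thesis using C unfolding tail_in_def by blast
qed

lemma ray_equiv_refl: "is_ray G r \<Longrightarrow> ray_equiv G r r"
  unfolding ray_equiv_def using ray_comp by blast

lemma end_nonempty: "\<omega> \<in> ends G \<Longrightarrow> \<exists>r. r \<in> \<omega>"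
  unfolding ends_def using ray_equiv_refl by blast

lemma end_comp:
  assumes "\<omega> \<in> ends G" "finite S" "S \<subseteq> fst G"
  shows "\<exists>C\<in>comps G S. lives_in \<omega> C"
proof -
  obtain r where r: "r \<in> \<omega>" using end_nonempty assms by blast
  then obtain C where "C \<in> comps G S" "tail_in r C" using ray_comp[OF end_ray] assms by blast
  then show ?thesis using end_lives_inI assms r by blast
qed

lemma ends_separated:
  assumes "\<omega> \<in> ends G" "\<omega>' \<in> ends G" "\<omega> \<noteq> \<omega>'"
  shows "\<exists>S C D. finite S \<and> S \<subseteq> fst G \<and> C \<in> comps G S \<and> D \<in> comps G S \<and> C \<inter> D = {} \<and>
    lives_in \<omega> C \<and> lives_in \<omega>' D"
proof -
  obtain r r' where r: "r \<in> \<omega>" "r' \<in> \<omega>'" using end_nonempty assms by blast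
  then have "\<not> ray_equiv G r r'" using ends_disjoint assms by blast
  then obtain S where S: "finite S" "S \<subseteq> fst G"
    and sep: "\<not> (\<exists>C\<in>comps G S. tail_in r C \<and> tail_in r' C)" unfolding ray_equiv_def by blast
  obtain C where C: "C \<in> comps G S" "lives_in \<omega> C" using end_comp assms S by blast
  obtain D where D: "D \<in> comps G S" "lives_in \<omega>' D" using end_comp assms S by blast
  have "C \<inter> D = {}" using comp_eq[OF C(1) D(1)] sep C D r by blast
  then show ?thesis using S C D
    by (intro exI[of _ S] exI[of _ C] exI[of _ D]) simp
qed

end

subsection \<open>The Freudenthal topology\<close>

lemma vertex_pt_inject [simp]: "vertex_pt u = vertex_pt v \<longleftrightarrow> u = v"
  by (metis vertex_pt_def zero_neq_one)

lemma vertex_pt_support [simp]: "{w. vertex_pt v w \<noteq> 0} = {v}"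
  by (auto simp: vertex_pt_def)

definition coord :: "'v \<Rightarrow> 'v fpoint \<Rightarrow> real" where
  "coord w x = (case x of Gp p \<Rightarrow> p w | Ep _ \<Rightarrow> 0)"

lemma coord_simps [simp]: "coord w (Gp p) = p w" "coord w (Ep \<omega>) = 0"
  by (simp_all add: coord_def)

lemma continuous_map_real_separates:
  assumes f: "continuous_map X euclideanreal f" and x: "x \<in> topspace X" "y \<in> topspace X" "f x \<noteq> f y"
  shows "\<exists>U V. openin X U \<and> openin X V \<and> x \<in> U \<and> y \<in> V \<and> disjnt U V"
proof -
  obtain U V :: "real set" where "open U" "open V" "f x \<in> U" "f y \<in> V" "U \<inter> V = {}"
    using hausdorff[OF x(3)] by blast
  then show ?thesis using x openin_continuous_map_preimage[OF f]
    by (intro exI[of _ "{z \<in> topspace X. f z \<in> U}"] exI[of _ "{z \<in> topspace X. f z \<in> V}"])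
      (auto simp: disjnt_def)
qed

lemma continuous_map_top_of_set_iff:
  "continuous_map (top_of_set D) X f \<longleftrightarrow> (\<forall>t\<in>D. limitin X f (f t) (at t within D))"
proof -
  have "atin (top_of_set D) t = at t within D" if "t \<in> D" for t
    using that by (simp add: atin_subtopology_within filter_eq_iff eventually_atin_within
        eventually_at_topological) blast
  then show ?thesis by (simp add: continuous_map_atin)
qed

context lf_graph
begin

abbreviation "FT \<equiv> freudenthal G"

lemma vertex_gpt: "v \<in> fst G \<Longrightarrow> is_gpt G (vertex_pt v)"
  unfolding is_gpt_def by blast

lemma gpt_cases [consumes 1, case_names vertex edge]:
  assumes "is_gpt G p"
  obtains v where "v \<in> fst G" "p = vertex_pt v"
    | u v where "{u, v} \<in> snd G" "u \<noteq> v" "{w. p w \<noteq> 0} = {u, v}" "p u + p v = 1" "0 < p u" "0 < p v"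
  using assms unfolding is_gpt_def
proof (elim disjE exE conjE bexE)
  fix u v assume "{u, v} \<in> snd G" "u \<noteq> v" "0 < p u" "0 < p v" "p u + p v = 1"
    "\<forall>w. w \<noteq> u \<and> w \<noteq> v \<longrightarrow> p w = 0"
  then show thesis by (intro that(2)[of u v]) force+
qed (rule that(1))

lemma gpt_adjacent:
  assumes "is_gpt G p" "p u \<noteq> 0" "p v \<noteq> 0"
  shows "u = v \<or> {u, v} \<in> snd G"
  using assms(1)
proof (cases rule: gpt_cases)
  case (vertex x)
  then show ?thesis using assms(2,3) by (auto simp: vertex_pt_def split: if_splits)
next
  case (edge x y)
  then have "u \<in> {x, y}" "v \<in> {x, y}" using assms(2,3) by blast+
  then show ?thesis using edge(1) by (auto simp: insert_commute)
qed

lemma gpt_nonneg: "is_gpt G p \<Longrightarrow> 0 \<le> p w"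
proof (induction rule: gpt_cases)
  case (edge u v)
  then have "w \<in> {u, v}" if "p w \<noteq> 0" using that by blast
  then show ?case using edge(5,6) by fastforce
qed (simp add: vertex_pt_def)

lemma gpt_support_sum:
  assumes "is_gpt G p"
  shows "\<exists>S. finite S \<and> S \<subseteq> fst G \<and> S = {w. p w \<noteq> 0} \<and> sum p S = 1"
  using assms
proof (cases rule: gpt_cases)
  case (vertex v)
  then show ?thesis by (intro exI[of _ "{v}"]) (auto simp: vertex_pt_def)
next
  case (edge u v)
  then show ?thesis using edge_vertices[of u v] by (intro exI[of _ "{u, v}"]) auto
qed

lemma gpt_vertex: "is_gpt G p \<Longrightarrow> p w \<noteq> 0 \<Longrightarrow> w \<in> fst G"
  using gpt_support_sum by blast

lemma gpt_near_comp:
  assumes "C \<in> comps G S" "is_gpt G p" "c \<in> C" "p c \<noteq> 0" "p w \<noteq> 0"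
  shows "w \<in> C \<union> S"
  using gpt_adjacent[OF assms(2,4,5)] comp_edge[OF assms(1,3), of w] assms(3) by blast

lemma end_nbhd_eq:
  assumes "C \<in> comps G S"
  shows "end_nbhd G S C = Gp ` {p. is_gpt G p \<and> (\<exists>c\<in>C. p c \<noteq> 0)} \<union> Ep ` {\<omega> \<in> ends G. lives_in \<omega> C}"
proof -
  have "{w. p w \<noteq> 0} \<subseteq> C \<union> S \<and> {w. p w \<noteq> 0} \<inter> C \<noteq> {} \<longleftrightarrow> (\<exists>c\<in>C. p c \<noteq> 0)" if "is_gpt G p" for p
    using gpt_near_comp[OF assms that] by blast
  then show ?thesis unfolding end_nbhd_def by blast
qed

lemma vertex_in_end_nbhd:
  "C \<in> comps G S \<Longrightarrow> Gp (vertex_pt v) \<in> end_nbhd G S C \<longleftrightarrow> v \<in> C"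
  using vertex_gpt comp_subset[of C G S]
  by (auto simp: end_nbhd_eq vertex_pt_def split: if_splits)

lemma end_in_end_nbhd: "Ep \<omega> \<in> end_nbhd G S C \<longleftrightarrow> \<omega> \<in> ends G \<and> lives_in \<omega> C"
  unfolding end_nbhd_def by auto

lemma end_nbhd_mono:
  assumes "C \<in> comps G S" "D \<in> comps G S'" "S \<subseteq> S'" "x \<in> C" "x \<in> D"
  shows "end_nbhd G S' D \<subseteq> end_nbhd G S C"
proof -
  have "D \<subseteq> C" using comp_mono[OF assms(2,1)] assms(3-5) by blast
  then show ?thesis unfolding end_nbhd_eq[OF assms(1)] end_nbhd_eq[OF assms(2)]
    using tail_in_mono by blast
qed

lemma basic_nbhd_Gp: "is_gpt G p \<Longrightarrow> \<epsilon> > 0 \<Longrightarrow> basic_nbhd G (Gp p) (vball G p \<epsilon>)"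
  unfolding basic_nbhd_def by blast

lemma basic_nbhd_Ep:
  "\<omega> \<in> ends G \<Longrightarrow> finite S \<Longrightarrow> S \<subseteq> fst G \<Longrightarrow> C \<in> comps G S \<Longrightarrow> lives_in \<omega> C \<Longrightarrow>
    basic_nbhd G (Ep \<omega>) (end_nbhd G S C)"
  unfolding basic_nbhd_def by blast

lemma basic_nbhd_Int:
  assumes "basic_nbhd G x N" "basic_nbhd G x N'"
  shows "\<exists>N''. basic_nbhd G x N'' \<and> N'' \<subseteq> N \<inter> N'"
proof (cases x)
  case (Gp p)
  then obtain a b where "is_gpt G p" "a > 0" "b > 0" "N = vball G p a" "N' = vball G p b"
    using assms unfolding basic_nbhd_def by auto
  then show ?thesis using Gp basic_nbhd_Gp[of p "min a b"]
    by (intro exI[of _ "vball G p (min a b)"]) (auto simp: vball_def)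
next
  case (Ep \<omega>)
  then obtain S C S' C' where \<omega>: "\<omega> \<in> ends G"
    and S: "finite S" "S \<subseteq> fst G" "C \<in> comps G S" "lives_in \<omega> C" "N = end_nbhd G S C"
    and S': "finite S'" "S' \<subseteq> fst G" "C' \<in> comps G S'" "lives_in \<omega> C'" "N' = end_nbhd G S' C'"
    using assms unfolding basic_nbhd_def by auto
  obtain D where D: "D \<in> comps G (S \<union> S')" "lives_in \<omega> D"
    using end_comp[OF \<omega>, of "S \<union> S'"] S S' by auto
  obtain r where r: "r \<in> \<omega>" using end_nonempty \<omega> by blast
  have "\<exists>x. x \<in> C \<and> x \<in> D" "\<exists>x. x \<in> C' \<and> x \<in> D"
    using tail_in_common r D S S' by blast+
  then have "end_nbhd G (S \<union> S') D \<subseteq> N \<inter> N'"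
    using end_nbhd_mono[OF S(3) D(1)] end_nbhd_mono[OF S'(3) D(1)] S S' by auto
  moreover have "basic_nbhd G x (end_nbhd G (S \<union> S') D)"
    unfolding Ep using basic_nbhd_Ep \<omega> S S' D by auto
  ultimately show ?thesis by blast
qed

lemma basic_nbhd_exists:
  assumes "x \<in> fpoints G"
  shows "\<exists>N. basic_nbhd G x N \<and> N \<subseteq> fpoints G"
proof (cases x)
  case (Gp p)
  then have "is_gpt G p" using assms unfolding fpoints_def by auto
  then show ?thesis using Gp basic_nbhd_Gp[of p 1]
    by (intro exI[of _ "vball G p 1"]) (auto simp: vball_def fpoints_def)
next
  case (Ep \<omega>)
  then have \<omega>: "\<omega> \<in> ends G" using assms unfolding fpoints_def by auto
  obtain C where C: "C \<in> comps G {}" "lives_in \<omega> C" using end_comp[OF \<omega>, of "{}"] by auto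
  then show ?thesis using Ep basic_nbhd_Ep[OF \<omega>, of "{}"]
    by (intro exI[of _ "end_nbhd G {} C"]) (auto simp: end_nbhd_def fpoints_def)
qed

lemma openin_FT: "openin FT U \<longleftrightarrow> U \<subseteq> fpoints G \<and> (\<forall>x\<in>U. \<exists>N. basic_nbhd G x N \<and> N \<subseteq> U)"
proof -
  let ?open = "\<lambda>U. U \<subseteq> fpoints G \<and> (\<forall>x\<in>U. \<exists>N. basic_nbhd G x N \<and> N \<subseteq> U)"
  have "istopology ?open"
    unfolding istopology_def
  proof (intro conjI[of "\<forall>S T. ?open S \<longrightarrow> ?open T \<longrightarrow> ?open (S \<inter> T)"] allI impI)
    fix S T assume S: "?open S" and T: "?open T"
    have "\<exists>N. basic_nbhd G x N \<and> N \<subseteq> S \<inter> T" if x: "x \<in> S \<inter> T" for x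
    proof -
      obtain N N' where "basic_nbhd G x N" "N \<subseteq> S" "basic_nbhd G x N'" "N' \<subseteq> T"
        using S T x by blast
      then show ?thesis using basic_nbhd_Int[of x N N'] by blast
    qed
    then show "?open (S \<inter> T)" using S by blast
  next
    fix K assume "\<forall>S\<in>K. ?open S"
    then show "?open (\<Union>K)" by (meson Sup_least UnionE Union_upper subset_trans)
  qed
  then show ?thesis unfolding freudenthal_def by (simp add: topology_inverse')
qed

lemma topspace_FT [simp]: "topspace FT = fpoints G"
  unfolding topspace_def openin_FT using basic_nbhd_exists by (auto simp: openin_FT)

lemma openin_end_nbhd:
  assumes S: "finite S" "S \<subseteq> fst G" and C: "C \<in> comps G S"
  shows "openin FT (end_nbhd G S C)"
  unfolding openin_FT
proof (intro conjI ballI)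
  show "end_nbhd G S C \<subseteq> fpoints G" unfolding end_nbhd_def fpoints_def by auto
  fix x assume "x \<in> end_nbhd G S C"
  then consider p c where "x = Gp p" "is_gpt G p" "c \<in> C" "p c \<noteq> 0"
    | \<omega> where "x = Ep \<omega>" "\<omega> \<in> ends G" "lives_in \<omega> C"
    unfolding end_nbhd_eq[OF C] by blast
  then show "\<exists>N. basic_nbhd G x N \<and> N \<subseteq> end_nbhd G S C"
  proof cases
    case (1 p c)
    then have pc: "0 < p c" using gpt_nonneg[of p c] by simp
    have "q c \<noteq> 0" if "\<bar>q c - p c\<bar> < p c" for q using that by auto
    then have "vball G p (p c) \<subseteq> end_nbhd G S C"
      unfolding vball_def end_nbhd_eq[OF C] using 1(3) by blast
    then show ?thesis using basic_nbhd_Gp 1(1,2) pc by blast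
  next
    case (2 \<omega>)
    then show ?thesis using basic_nbhd_Ep S C by blast
  qed
qed

lemma end_avoids_vertex:
  assumes "\<omega> \<in> ends G" "w \<in> fst G"
  shows "\<exists>N. basic_nbhd G (Ep \<omega>) N \<and> N \<subseteq> {x \<in> fpoints G. coord w x = 0}"
proof -
  let ?S = "closed_nbhd {w}"
  have S: "finite ?S" "?S \<subseteq> fst G" using finite_closed_nbhd closed_nbhd_subset assms(2) by simp_all
  obtain C where C: "C \<in> comps G ?S" "lives_in \<omega> C" using end_comp[OF assms(1) S] by blast
  have "p w = 0" if "is_gpt G p" "c \<in> C" "p c \<noteq> 0" for p c
  proof (rule ccontr)
    assume "p w \<noteq> 0"
    then have "c \<in> ?S" using gpt_adjacent that unfolding closed_nbhd_def by blast
    then show False using comp_subset[OF C(1)] that(2) by blast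
  qed
  then have "end_nbhd G ?S C \<subseteq> {x \<in> fpoints G. coord w x = 0}"
    unfolding end_nbhd_eq[OF C(1)] fpoints_def by auto
  then show ?thesis using basic_nbhd_Ep[OF assms(1) S C] by blast
qed

lemma continuous_coord:
  assumes w: "w \<in> fst G"
  shows "continuous_map FT euclideanreal (coord w)"
  unfolding continuous_map_def
proof (intro conjI allI impI)
  fix U :: "real set" assume U: "openin euclideanreal U"
  show "openin FT {x \<in> topspace FT. coord w x \<in> U}"
    unfolding openin_FT topspace_FT
  proof (intro conjI ballI)
    fix x assume x: "x \<in> {x \<in> fpoints G. coord w x \<in> U}"
    then obtain \<epsilon> where \<epsilon>: "\<epsilon> > 0" "\<And>y. \<bar>y - coord w x\<bar> < \<epsilon> \<Longrightarrow> y \<in> U"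
      using U unfolding open_openin[symmetric] open_dist dist_real_def by fast
    show "\<exists>N. basic_nbhd G x N \<and> N \<subseteq> {x \<in> fpoints G. coord w x \<in> U}"
    proof (cases x)
      case (Gp p)
      then have "is_gpt G p" using x unfolding fpoints_def by auto
      then show ?thesis using Gp \<epsilon> basic_nbhd_Gp[of p \<epsilon>]
        by (intro exI[of _ "vball G p \<epsilon>"]) (auto simp: vball_def fpoints_def)
    next
      case (Ep \<omega>)
      then have "\<omega> \<in> ends G" using x unfolding fpoints_def by auto
      then obtain N where N: "basic_nbhd G x N" "N \<subseteq> {x \<in> fpoints G. coord w x = 0}"
        using end_avoids_vertex w Ep by blast
      then show ?thesis using x Ep by (intro exI[of _ N]) auto
    qed
  qed auto
qed auto

lemma gpt_end_separated:
  assumes "is_gpt G p" "\<omega> \<in> ends G"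
  shows "\<exists>U V. openin FT U \<and> openin FT V \<and> Gp p \<in> U \<and> Ep \<omega> \<in> V \<and> disjnt U V"
proof -
  obtain S where S: "finite S" "S \<subseteq> fst G" "sum p S = 1" using gpt_support_sum assms(1) by blast
  then have "continuous_map FT euclideanreal (\<lambda>x. \<Sum>w\<in>S. coord w x)"
    using continuous_coord by (intro continuous_map_sum) auto
  then show ?thesis
    by (rule continuous_map_real_separates) (use assms S in \<open>auto simp: fpoints_def\<close>)
qed

lemma end_end_separated:
  assumes "\<omega> \<in> ends G" "\<omega>' \<in> ends G" "\<omega> \<noteq> \<omega>'"
  shows "\<exists>U V. openin FT U \<and> openin FT V \<and> Ep \<omega> \<in> U \<and> Ep \<omega>' \<in> V \<and> disjnt U V"
proof -
  obtain S C D where S: "finite S" "S \<subseteq> fst G" and CD: "C \<in> comps G S" "D \<in> comps G S" "C \<inter> D = {}"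
    "lives_in \<omega> C" "lives_in \<omega>' D" using ends_separated[OF assms] by blast
  have "\<not> (c \<in> C \<and> d \<in> D \<and> p c \<noteq> 0 \<and> p d \<noteq> 0)" if "is_gpt G p" for p c d
    using gpt_near_comp[OF CD(1) that, of c d] comp_subset[OF CD(2)] CD(3) by blast
  moreover have "\<not> (lives_in \<omega> C \<and> lives_in \<omega> D)" if "\<omega> \<in> ends G" for \<omega>
    using end_nonempty[OF that] tail_in_common CD(3) by (metis disjoint_iff)
  ultimately have "disjnt (end_nbhd G S C) (end_nbhd G S D)"
    unfolding disjnt_def end_nbhd_eq[OF CD(1)] end_nbhd_eq[OF CD(2)] by blast
  then show ?thesis using assms(1,2) CD(4,5) openin_end_nbhd[OF S CD(1)] openin_end_nbhd[OF S CD(2)]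
    by (intro exI[of _ "end_nbhd G S C"] exI[of _ "end_nbhd G S D"]) (simp add: end_in_end_nbhd)
qed

lemma Hausdorff_FT: "Hausdorff_space FT"
  unfolding Hausdorff_space_def topspace_FT
proof (intro allI impI)
  fix x y assume xy: "x \<in> fpoints G \<and> y \<in> fpoints G \<and> x \<noteq> y"
  show "\<exists>U V. openin FT U \<and> openin FT V \<and> x \<in> U \<and> y \<in> V \<and> disjnt U V"
  proof (cases x; cases y)
    fix p q assume pq: "x = Gp p" "y = Gp q"
    then obtain w where w: "p w \<noteq> q w" using xy by auto
    have "is_gpt G p" "is_gpt G q" using pq xy unfolding fpoints_def by auto
    then have "w \<in> fst G" using w gpt_vertex by metis
    then show ?thesis using continuous_map_real_separates[OF continuous_coord] xy pq w by simp
  next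
    fix p \<omega> assume "x = Gp p" "y = Ep \<omega>"
    then show ?thesis using gpt_end_separated[of p \<omega>] xy by (auto simp: fpoints_def)
  next
    fix p \<omega> assume "x = Ep \<omega>" "y = Gp p"
    then show ?thesis using gpt_end_separated[of p \<omega>] xy disjnt_sym by (fastforce simp: fpoints_def)
  next
    fix \<omega> \<omega>' assume "x = Ep \<omega>" "y = Ep \<omega>'"
    then show ?thesis using end_end_separated[of \<omega> \<omega>'] xy by (auto simp: fpoints_def)
  qed
qed

end

subsection \<open>Closed curves\<close>

lemma interval_circle_quotient:
  fixes a b :: real
  assumes ab: "a < b"
  obtains e where "quotient_map (top_of_set {a..b}) (top_of_set (sphere (0::complex) 1)) e"
    and "\<And>t t'. t \<in> {a..b} \<Longrightarrow> t' \<in> {a..b} \<Longrightarrow> e t = e t' \<longleftrightarrow> t = t' \<or> {t, t'} = {a, b}"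
proof -
  define e where "e t = circlepath 0 1 ((t - a) / (b - a))" for t :: real
  have "b / (b - a) - a / (b - a) = 1" using ab by (simp flip: diff_divide_distrib)
  then have unit: "(\<lambda>t. (t - a) / (b - a)) ` {a..b} = {0..1}"
    using ab by (simp add: diff_divide_distrib image_affinity_atLeastAtMost_div_diff)
  have "e ` {a..b} = circlepath 0 1 ` (\<lambda>t. (t - a) / (b - a)) ` {a..b}"
    unfolding e_def by (simp add: image_image)
  also have "\<dots> = sphere 0 1"
    unfolding unit using path_image_circlepath[of 0 1] by (simp add: path_image_def)
  finally have image: "e ` {a..b} = sphere 0 1" .
  have "continuous_on {0..1} (circlepath 0 1)"
    using path_circlepath[of 0 1] by (simp add: path_def)
  then have "continuous_on {a..b} e"
    unfolding e_def by (rule continuous_on_compose2) (use ab unit in \<open>auto intro!: continuous_intros\<close>)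
  then have "continuous_map (top_of_set {a..b}) (top_of_set (sphere 0 1)) e"
    using image by (auto simp: continuous_map_in_subtopology)
  then have "quotient_map (top_of_set {a..b}) (top_of_set (sphere 0 1)) e"
    by (rule T1_Spaces.continuous_imp_quotient_map)
      (auto simp: compact_space_subtopology Hausdorff_space_subtopology image)
  moreover have "e t = e t' \<longleftrightarrow> t = t' \<or> {t, t'} = {a, b}" if t: "t \<in> {a..b}" "t' \<in> {a..b}" for t t'
  proof -
    let ?u = "(t - a) / (b - a)" and ?u' = "(t' - a) / (b - a)"
    have "?u \<in> {0..1}" "?u' \<in> {0..1}" using t unit by blast+
    moreover have "loop_free (circlepath 0 1)"
      using simple_path_circlepath[of 0 1] by (simp add: simple_path_def)
    moreover have "circlepath 0 1 0 = circlepath 0 1 1" by (simp add: circlepath)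
    ultimately have "e t = e t' \<longleftrightarrow> ?u = ?u' \<or> ?u = 0 \<and> ?u' = 1 \<or> ?u = 1 \<and> ?u' = 0"
      unfolding loop_free_def e_def by metis
    then show ?thesis using ab by (auto simp: doubleton_eq_iff)
  qed
  ultimately show thesis by (rule that)
qed

lemma is_circle_closed_curve:
  fixes f :: "real \<Rightarrow> 'a" and a b :: real
  assumes ab: "a < b" and X: "Hausdorff_space X" and f: "continuous_map (top_of_set {a..b}) X f"
    and inj: "inj_on f {a..<b}" and closed: "f a = f b"
  shows "is_circle X (f ` {a..b})"
proof -
  let ?S = "sphere (0::complex) 1"
  obtain e where e: "quotient_map (top_of_set {a..b}) (top_of_set ?S) e"
    "\<And>t t'. t \<in> {a..b} \<Longrightarrow> t' \<in> {a..b} \<Longrightarrow> e t = e t' \<longleftrightarrow> t = t' \<or> {t, t'} = {a, b}"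
    by (rule interval_circle_quotient[OF ab]) (rule that)
  have "f t = f t'" if "t \<in> {a..b}" "t' \<in> {a..b}" "e t = e t'" for t t'
    using e(2)[OF that(1,2)] that(3) closed by (auto simp: doubleton_eq_iff)
  then obtain F where F: "continuous_map (top_of_set ?S) X F" "F ` ?S = f ` {a..b}"
    "\<And>t. t \<in> {a..b} \<Longrightarrow> F (e t) = f t"
    using quotient_map_lift_exists[OF e(1) f] by (metis topspace_euclidean_subtopology)
  have "t = t' \<or> {t, t'} = {a, b}" if "t \<in> {a..b}" "t' \<in> {a..b}" "f t = f t'" for t t'
    using that closed ab inj_onD[OF inj, of t t'] inj_onD[OF inj, of a t'] inj_onD[OF inj, of t a]
    by (cases "t = b"; cases "t' = b") auto
  then have "e t = e t'" if "t \<in> {a..b}" "t' \<in> {a..b}" "F (e t) = F (e t')" for t t'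
    using that e(2) F(3) by auto
  moreover have "?S = e ` {a..b}" using e(1) by (simp add: quotient_map_def)
  ultimately have "inj_on F ?S" by (auto simp: inj_on_def)
  moreover have "continuous_map (top_of_set ?S) (subtopology X (f ` {a..b})) F"
    using F(1,2) by (auto simp: continuous_map_in_subtopology)
  moreover have sub: "f ` {a..b} \<subseteq> topspace X" using continuous_map_image_subset_topspace[OF f] by auto
  ultimately have "homeomorphic_map (top_of_set ?S) (subtopology X (f ` {a..b})) F"
    using X F(2) by (intro continuous_imp_homeomorphic_map)
      (auto simp: compact_space_subtopology Hausdorff_space_subtopology)
  then show ?thesis unfolding is_circle_def using sub by blast
qed

subsection \<open>Traces of curves through vertices and ends\<close>

context lf_graph
begin

definition edge_pt :: "'v \<Rightarrow> 'v \<Rightarrow> real \<Rightarrow> 'v \<Rightarrow> real" where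
  "edge_pt u v c w = (1 - c) * vertex_pt u w + c * vertex_pt v w"

lemma edge_pt_0 [simp]: "edge_pt u v 0 = vertex_pt u" and edge_pt_1 [simp]: "edge_pt u v 1 = vertex_pt v"
  by (auto simp: edge_pt_def)

lemma edge_pt_swap: "edge_pt v u (1 - c) = edge_pt u v c"
  by (auto simp: edge_pt_def)

lemma edge_pt_target: "u \<noteq> v \<Longrightarrow> edge_pt u v c v = c"
  by (simp add: edge_pt_def vertex_pt_def)

lemma edge_pt_support: "u \<noteq> v \<Longrightarrow> 0 < c \<Longrightarrow> c < 1 \<Longrightarrow> {w. edge_pt u v c w \<noteq> 0} = {u, v}"
  by (auto simp: edge_pt_def vertex_pt_def)

lemma edge_pt_gpt:
  assumes "{u, v} \<in> snd G" "0 \<le> c" "c \<le> 1"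
  shows "is_gpt G (edge_pt u v c)"
proof -
  consider "c = 0" | "c = 1" | "0 < c" "c < 1" using assms by linarith
  then show ?thesis
  proof cases
    case 3
    then show ?thesis using assms edge_vertices[OF assms(1)] unfolding is_gpt_def
      by (intro disjI2 exI[of _ u] exI[of _ v]) (auto simp: edge_pt_def vertex_pt_def)
  qed (use assms edge_vertices vertex_gpt in auto)
qed

lemma edge_pt_diff: "\<bar>edge_pt u v c w - edge_pt u v d w\<bar> \<le> \<bar>c - d\<bar>"
proof -
  have "edge_pt u v c w - edge_pt u v d w = (c - d) * (vertex_pt v w - vertex_pt u w)"
    by (simp add: edge_pt_def algebra_simps)
  moreover have "\<bar>vertex_pt v w - vertex_pt u w\<bar> \<le> 1" by (auto simp: vertex_pt_def)
  ultimately show ?thesis by (simp add: abs_mult mult_left_le)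
qed

lemma gpt_eq_edge_pt:
  assumes "is_gpt G p" "{w. p w \<noteq> 0} = {u, v}" "u \<noteq> v"
  shows "p = edge_pt u v (p v) \<and> 0 < p v \<and> p v < 1"
  using assms(1)
proof (cases rule: gpt_cases)
  case (edge x y)
  then have "p u + p v = 1 \<and> p u > 0 \<and> p v > 0" using assms(2) by (auto simp: doubleton_eq_iff)
  moreover have "p w = 0" if "w \<noteq> u" "w \<noteq> v" for w using assms(2) that by auto
  ultimately show ?thesis using assms(3) by (auto simp: edge_pt_def vertex_pt_def fun_eq_iff)
qed (use assms in \<open>auto simp: doubleton_eq_iff\<close>)

lemma continuous_edge_pt:
  assumes e: "{u, v} \<in> snd G"
  shows "continuous_map (top_of_set {0..1}) FT (\<lambda>c. Gp (edge_pt u v c))"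
  unfolding continuous_map_top_of_set_iff limitin_def
proof (intro ballI conjI allI impI)
  fix c :: real assume c: "c \<in> {0..1}"
  then show "Gp (edge_pt u v c) \<in> topspace FT" using edge_pt_gpt[OF e] by (auto simp: fpoints_def)
  fix U assume U: "openin FT U \<and> Gp (edge_pt u v c) \<in> U"
  then obtain N where N: "basic_nbhd G (Gp (edge_pt u v c)) N" "N \<subseteq> U" unfolding openin_FT by blast
  then obtain \<epsilon> where \<epsilon>: "\<epsilon> > 0" "N = vball G (edge_pt u v c) \<epsilon>" unfolding basic_nbhd_def by auto
  have "Gp (edge_pt u v d) \<in> U" if "d \<in> {0..1}" "dist d c < \<epsilon>" for d
  proof -
    have "\<bar>edge_pt u v d w - edge_pt u v c w\<bar> < \<epsilon>" for w
      using edge_pt_diff[of u v d w c] that(2) by (simp add: dist_real_def)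
    then show ?thesis using N(2) edge_pt_gpt[OF e, of d] that(1) unfolding \<epsilon>(2) vball_def by auto
  qed
  then show "\<forall>\<^sub>F d in at c within {0..1}. Gp (edge_pt u v d) \<in> U"
    unfolding eventually_at using \<epsilon>(1) by blast
qed

end

text \<open>A trace records where a curve meets the vertices and the ends; between two consecutive such
  parameters the curve runs along an edge.\<close>

locale curve_trace = lf_graph +
  fixes Z :: "real set" and lab :: "real \<Rightarrow> 'a fpoint"
  assumes compact: "compact Z"
    and label: "z \<in> Z \<Longrightarrow> (\<exists>v\<in>fst G. lab z = Gp (vertex_pt v)) \<or> (\<exists>\<omega>\<in>ends G. lab z = Ep \<omega>)"
    and continuous: "continuous_map (top_of_set Z) FT lab"
    and isolated: "z \<in> Z \<Longrightarrow> lab z = Gp (vertex_pt v) \<Longrightarrow> \<not> z islimpt Z"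
    and consecutive: "s \<in> Z \<Longrightarrow> t \<in> Z \<Longrightarrow> s < t \<Longrightarrow> {s<..<t} \<inter> Z = {} \<Longrightarrow>
      \<exists>u v. lab s = Gp (vertex_pt u) \<and> lab t = Gp (vertex_pt v) \<and> {u, v} \<in> snd G"

lemma curve_trace_cong:
  assumes "curve_trace G Z lab" "\<And>z. z \<in> Z \<Longrightarrow> lab z = lab' z"
  shows "curve_trace G Z lab'"
proof -
  interpret curve_trace G Z lab by (rule assms(1))
  show ?thesis
  proof
    show "continuous_map (top_of_set Z) FT lab'"
      by (rule continuous_map_eq[OF continuous]) (simp add: assms(2))
  qed (use compact label isolated consecutive assms(2) in metis)+
qed

lemma (in lf_graph) curve_trace_singleton:
  assumes "(\<exists>v\<in>fst G. lab z = Gp (vertex_pt v)) \<or> (\<exists>\<omega>\<in>ends G. lab z = Ep \<omega>)"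
  shows "curve_trace G {z} lab"
proof
  have "lab z \<in> topspace FT" using assms vertex_gpt by (auto simp: fpoints_def)
  then show "continuous_map (top_of_set {z}) FT lab"
    by (simp add: continuous_map_top_of_set_iff limitin_def at_within_def)
qed (use assms in \<open>auto simp: islimpt_finite\<close>)

lemma curve_trace_isometry:
  fixes d :: real
  assumes "curve_trace G Z lab" and d: "d = 1 \<or> d = - 1"
  shows "curve_trace G ((\<lambda>z. d * z + c) ` Z) (\<lambda>z. lab (d * (z - c)))"
proof -
  interpret curve_trace G Z lab by (rule assms(1))
  define \<phi> where "\<phi> z = d * z + c" for z
  define \<psi> where "\<psi> z = d * (z - c)" for z
  have inv: "\<psi> (\<phi> z) = z" "\<phi> (\<psi> z) = z" for z using d by (auto simp: \<phi>_def \<psi>_def)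
  have image: "z \<in> \<phi> ` Z \<longleftrightarrow> \<psi> z \<in> Z" for z using inv by (metis imageE imageI)
  have "curve_trace G (\<phi> ` Z) (\<lambda>z. lab (\<psi> z))"
  proof
    have "continuous_on Z \<phi>" unfolding \<phi>_def by (intro continuous_intros)
    then show "compact (\<phi> ` Z)" using compact by (rule compact_continuous_image)
    have "continuous_on (\<phi> ` Z) \<psi>" unfolding \<psi>_def by (intro continuous_intros)
    then have "continuous_map (top_of_set (\<phi> ` Z)) (top_of_set Z) \<psi>"
      using image by (auto simp: continuous_map_in_subtopology)
    from continuous_map_compose[OF this continuous]
    show "continuous_map (top_of_set (\<phi> ` Z)) FT (\<lambda>z. lab (\<psi> z))" by (simp add: comp_def)
  next
    fix z assume "z \<in> \<phi> ` Z"
    then show "(\<exists>v\<in>fst G. lab (\<psi> z) = Gp (vertex_pt v)) \<or> (\<exists>\<omega>\<in>ends G. lab (\<psi> z) = Ep \<omega>)"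
      using label image by blast
  next
    fix z v assume z: "z \<in> \<phi> ` Z" "lab (\<psi> z) = Gp (vertex_pt v)"
    have "\<bar>\<psi> x - \<psi> z\<bar> = \<bar>x - z\<bar>" for x using d by (auto simp: \<psi>_def)
    then have "\<psi> z islimpt Z" if "z islimpt \<phi> ` Z"
      using that unfolding islimpt_approachable_real by (metis image inv(2))
    then show "\<not> z islimpt \<phi> ` Z" using isolated z image by blast
  next
    fix s t assume st: "s \<in> \<phi> ` Z" "t \<in> \<phi> ` Z" "s < t" "{s<..<t} \<inter> \<phi> ` Z = {}"
    have "s < \<phi> z \<and> \<phi> z < t" if "\<psi> s < z \<and> z < \<psi> t \<or> \<psi> t < z \<and> z < \<psi> s" for z
      using d that st(3) by (auto simp: \<phi>_def \<psi>_def)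
    then have "{\<psi> s<..<\<psi> t} \<inter> Z = {}" "{\<psi> t<..<\<psi> s} \<inter> Z = {}"
      using st(4) by force+
    moreover have "\<psi> s < \<psi> t \<or> \<psi> t < \<psi> s" using d st(3) by (auto simp: \<psi>_def)
    moreover have "\<psi> s \<in> Z" "\<psi> t \<in> Z" using st(1,2) image by blast+
    ultimately show "\<exists>u v. lab (\<psi> s) = Gp (vertex_pt u) \<and> lab (\<psi> t) = Gp (vertex_pt v) \<and> {u, v} \<in> snd G"
      using consecutive[of "\<psi> s" "\<psi> t"] consecutive[of "\<psi> t" "\<psi> s"] by (auto simp: insert_commute)
  qed
  then show ?thesis unfolding \<phi>_def \<psi>_def .
qed

definition (in lf_graph) linked :: "'v fpoint \<Rightarrow> 'v fpoint \<Rightarrow> bool" where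
  "linked x y \<longleftrightarrow> (\<exists>u v. x = Gp (vertex_pt u) \<and> y = Gp (vertex_pt v) \<and> {u, v} \<in> snd G)"

lemma (in curve_trace) closed_trace: "closed Z"
  using compact by (rule compact_imp_closed)

lemma (in curve_trace) label_limit:
  assumes "lab x \<in> topspace FT"
  shows "limitin FT lab (lab x) (at x within Z)"
proof (cases "x \<in> Z")
  case True
  then show ?thesis using continuous unfolding continuous_map_top_of_set_iff by blast
next
  case False
  then have "at x within Z = bot" using closed_trace by (metis closed_limpt trivial_limit_within)
  then show ?thesis using assms by (simp add: limitin_def)
qed

lemma (in curve_trace) vertex_not_islimpt: "lab z = Gp (vertex_pt v) \<Longrightarrow> \<not> z islimpt Z"
  using isolated closed_trace closed_limpt by metis

lemma curve_trace_Un: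
  assumes Z: "curve_trace G Z lab" "curve_trace G Z' lab"
    and separated: "\<And>x y. x \<in> Z \<Longrightarrow> y \<in> Z' \<Longrightarrow> x \<le> s \<and> t \<le> y" "s \<in> Z" "t \<in> Z'" "s \<le> t"
    and join: "s = t \<or> lf_graph.linked G (lab s) (lab t)"
  shows "curve_trace G (Z \<union> Z') lab"
proof -
  interpret Z: curve_trace G Z lab by (rule Z(1))
  interpret Z': curve_trace G Z' lab by (rule Z(2))
  show ?thesis
  proof
    show "compact (Z \<union> Z')" using Z.compact Z'.compact by blast
    have "lab x \<in> topspace Z.FT" if "x \<in> Z \<union> Z'" for x
      using that Z.label Z'.label Z.vertex_gpt by (fastforce simp: fpoints_def)
    then show "continuous_map (top_of_set (Z \<union> Z')) Z.FT lab"
      using Z.label_limit Z'.label_limit unfolding continuous_map_top_of_set_iff at_within_union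
      by (simp add: limitin_def eventually_sup)
  next
    fix z v assume "lab z = Gp (vertex_pt v)"
    then show "\<not> z islimpt Z \<union> Z'"
      using Z.vertex_not_islimpt Z'.vertex_not_islimpt by (simp add: islimpt_Un)
  next
    fix x y assume xy: "x \<in> Z \<union> Z'" "y \<in> Z \<union> Z'" "x < y" "{x<..<y} \<inter> (Z \<union> Z') = {}"
    have nothing_between: "\<not> (x < z \<and> z < y)" if "z \<in> Z \<union> Z'" for z using xy(4) that by auto
    consider "x \<in> Z" "y \<in> Z" | "x \<in> Z'" "y \<in> Z'" | "x \<in> Z" "y \<in> Z'" "x \<notin> Z'" "y \<notin> Z"
      | "x \<in> Z'" "y \<in> Z" using xy(1,2) by blast
    then show "\<exists>u v. lab x = Gp (vertex_pt u) \<and> lab y = Gp (vertex_pt v) \<and> {u, v} \<in> snd G"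
    proof cases
      case 1
      then show ?thesis using Z.consecutive xy(3,4) by blast
    next
      case 2
      then show ?thesis using Z'.consecutive xy(3,4) by blast
    next
      case 3
      have "x \<le> s" "t \<le> y" "s \<noteq> y" "t \<noteq> x" using separated(1)[OF 3(1,2)] separated(2,3) 3(3,4) by auto
      then have "x = s" "y = t" using nothing_between[of s] nothing_between[of t] separated(2-4) by auto
      then show ?thesis using join xy(3) unfolding Z.linked_def by blast
    next
      case 4
      then show ?thesis using separated xy(3) by fastforce
    qed
  qed (use Z.label Z'.label in blast)
qed

context curve_trace
begin

definition jump :: "real \<Rightarrow> real \<Rightarrow> bool" where
  "jump s u \<longleftrightarrow> s \<in> Z \<and> u \<in> Z \<and> s < u \<and> {s<..<u} \<inter> Z = {}"

definition vertex_at :: "real \<Rightarrow> 'a" where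
  "vertex_at z = (THE v. lab z = Gp (vertex_pt v))"

text \<open>The curve with trace \<open>Z\<close>; the values outside the convex hull of \<open>Z\<close> are irrelevant.\<close>

definition curve :: "real \<Rightarrow> 'a fpoint" where
  "curve t = (if t \<in> Z then lab t else
     let s = Sup (Z \<inter> {..t}); u = Inf (Z \<inter> {t..})
     in Gp (edge_pt (vertex_at s) (vertex_at u) ((t - s) / (u - s))))"

lemma jumpD: "jump s u \<Longrightarrow> s \<in> Z \<and> u \<in> Z \<and> s < u"
  unfolding jump_def by blast

lemma not_in_jump: "jump s u \<Longrightarrow> z \<in> Z \<Longrightarrow> z \<le> s \<or> u \<le> z"
  unfolding jump_def by force

lemma jump_Sup_Inf:
  assumes "jump s u" "s < t" "t < u"
  shows "Sup (Z \<inter> {..t}) = s" "Inf (Z \<inter> {t..}) = u" "t \<notin> Z"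
proof -
  have in_Z: "s \<in> Z" "u \<in> Z" using jumpD[OF assms(1)] by auto
  have out: "z \<le> s \<or> u \<le> z" if "z \<in> Z" for z using not_in_jump[OF assms(1) that] .
  show "Sup (Z \<inter> {..t}) = s" by (rule cSup_eq_maximum) (use in_Z assms out in force)+
  show "Inf (Z \<inter> {t..}) = u" by (rule cInf_eq_minimum) (use in_Z assms out in force)+
  show "t \<notin> Z" using out[of t] assms by auto
qed

lemma jump_around:
  assumes "a \<in> Z" "b \<in> Z" "a \<le> t" "t \<le> b" "t \<notin> Z"
  obtains s u where "jump s u" "s < t" "t < u"
proof -
  have "compact (Z \<inter> {..t})" "compact (Z \<inter> {t..})" using compact compact_Int_closed by blast+
  moreover have "a \<in> Z \<inter> {..t}" "b \<in> Z \<inter> {t..}" using assms by auto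
  ultimately obtain s u where s: "s \<in> Z \<inter> {..t}" "\<forall>z\<in>Z \<inter> {..t}. z \<le> s"
    and u: "u \<in> Z \<inter> {t..}" "\<forall>z\<in>Z \<inter> {t..}. u \<le> z"
    using compact_attains_sup[of "Z \<inter> {..t}"] compact_attains_inf[of "Z \<inter> {t..}"] by blast
  have "s \<noteq> t" "u \<noteq> t" using s u assms(5) by auto
  then have st: "s < t" "t < u" using s u by auto
  have "z \<le> s \<or> u \<le> z" if "z \<in> Z" for z
    using bspec[OF s(2), of z] bspec[OF u(2), of z] that by force
  then have "jump s u" unfolding jump_def using s u st by force
  then show thesis using st by (rule that)
qed

lemma vertex_at: "lab z = Gp (vertex_pt v) \<Longrightarrow> vertex_at z = v"
  unfolding vertex_at_def by (rule the_equality) auto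

lemma jump_edge:
  assumes "jump s u"
  shows "lab s = Gp (vertex_pt (vertex_at s))" "lab u = Gp (vertex_pt (vertex_at u))"
    and "{vertex_at s, vertex_at u} \<in> snd G"
  using consecutive[of s u] assms vertex_at unfolding jump_def by metis+

lemma jump_unit: "jump s u \<Longrightarrow> s \<le> t \<Longrightarrow> t \<le> u \<Longrightarrow> (t - s) / (u - s) \<in> {0..1}"
  using jumpD by (auto simp: field_simps)

lemma curve_jump:
  assumes "jump s u" "s \<le> t" "t \<le> u"
  shows "curve t = Gp (edge_pt (vertex_at s) (vertex_at u) ((t - s) / (u - s)))"
proof -
  consider "t = s" | "t = u" | "s < t" "t < u" using assms(2,3) by fastforce
  then show ?thesis
  proof cases
    case 3
    then show ?thesis using jump_Sup_Inf[OF assms(1)] by (simp add: curve_def)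
  qed (use jumpD[OF assms(1)] jump_edge[OF assms(1)] in \<open>auto simp: curve_def\<close>)
qed

lemma continuous_curve_jump:
  assumes "jump s u"
  shows "continuous_map (top_of_set {s..u}) FT curve"
proof (rule continuous_map_eq)
  let ?\<gamma> = "\<lambda>c. Gp (edge_pt (vertex_at s) (vertex_at u) c)"
  have "continuous_map (top_of_set {s..u}) (top_of_set {0..1}) (\<lambda>t. (t - s) / (u - s))"
    using jumpD[OF assms] jump_unit[OF assms] by (auto simp: continuous_map_in_subtopology intro!: continuous_intros)
  then show "continuous_map (top_of_set {s..u}) FT (?\<gamma> \<circ> (\<lambda>t. (t - s) / (u - s)))"
    using continuous_edge_pt[OF jump_edge(3)[OF assms]] by (rule continuous_map_compose)
qed (simp add: curve_jump[OF assms])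

lemma curve_in_end_nbhd:
  assumes C: "C \<in> comps G S" and z: "z \<in> Z" "z' \<in> Z" "z \<le> t" "t \<le> z'"
    and near: "\<And>x. x \<in> Z \<Longrightarrow> z \<le> x \<Longrightarrow> x \<le> z' \<Longrightarrow> lab x \<in> end_nbhd G S C"
  shows "curve t \<in> end_nbhd G S C"
proof (cases "t \<in> Z")
  case True
  then show ?thesis using near z by (simp add: curve_def)
next
  case False
  obtain s u where j: "jump s u" "s < t" "t < u" using jump_around[OF z False] .
  then have "z \<le> s" "s \<le> z'" using not_in_jump[OF j(1) z(1)] z by auto
  then have C_s: "vertex_at s \<in> C"
    using near[of s] jumpD[OF j(1)] jump_edge(1)[OF j(1)] vertex_in_end_nbhd[OF C] by metis
  define c where "c = (t - s) / (u - s)"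
  have c: "0 < c" "c < 1" unfolding c_def using j(2,3) by (auto simp: field_simps)
  have e: "{vertex_at s, vertex_at u} \<in> snd G" by (rule jump_edge(3)[OF j(1)])
  then have "edge_pt (vertex_at s) (vertex_at u) c (vertex_at s) \<noteq> 0"
    using edge_vertices[OF e] c by (simp add: edge_pt_def vertex_pt_def)
  moreover have "curve t = Gp (edge_pt (vertex_at s) (vertex_at u) c)"
    using curve_jump[OF j(1)] j(2,3) by (simp add: c_def)
  ultimately show ?thesis
    using C_s edge_pt_gpt[OF e, of c] c unfolding end_nbhd_eq[OF C] by auto
qed

lemma accumulation_is_end:
  assumes "z \<in> Z" "z islimpt Z"
  obtains \<omega> where "\<omega> \<in> ends G" "lab z = Ep \<omega>"
  using label[OF assms(1)] isolated[OF assms(1)] assms(2) by blast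

lemma no_jump_accumulates:
  assumes t: "t \<in> Z" "\<nexists>u. jump t u" and b: "b \<in> Z" "t < b" and \<delta>: "\<delta> > 0"
  shows "\<exists>z\<in>Z. t < z \<and> z < t + \<delta>"
proof (rule ccontr)
  assume none: "\<not> ?thesis"
  define x where "x = min (t + \<delta> / 2) ((t + b) / 2)"
  have x: "t < x" "x < t + \<delta>" "x < b" unfolding x_def min_def using \<delta> b(2) by auto
  then have "x \<notin> Z" using none by blast
  then obtain s u where j: "jump s u" "s < x" "x < u"
    using jump_around[OF t(1) b(1), of x] x by (metis less_imp_le)
  then have "t \<le> s" using not_in_jump[OF j(1) t(1)] x by auto
  then have "s = t" using none jumpD[OF j(1)] j(2) x by force
  then show False using t(2) j(1) by blast
qed

lemma curve_limit_at_end: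
  assumes t: "t \<in> Z" "lab t = Ep \<omega>" and approach: "\<And>\<delta>. \<delta> > 0 \<Longrightarrow> \<exists>z\<in>Z. t < z \<and> z < t + \<delta>"
  shows "limitin FT curve (curve t) (at t within {t..b})"
  unfolding limitin_def
proof (intro conjI allI impI)
  have curve_t: "curve t = Ep \<omega>" using t by (simp add: curve_def)
  have \<omega>: "\<omega> \<in> ends G" using label[OF t(1)] t(2) by auto
  then show "curve t \<in> topspace FT" using curve_t by (simp add: fpoints_def)
  fix U assume U: "openin FT U \<and> curve t \<in> U"
  then obtain S C where S: "finite S" "S \<subseteq> fst G" "C \<in> comps G S" "lives_in \<omega> C" "end_nbhd G S C \<subseteq> U"
    using curve_t unfolding openin_FT basic_nbhd_def by force
  have "\<forall>\<^sub>F z in at t within Z. lab z \<in> end_nbhd G S C"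
    using continuous t \<omega> openin_end_nbhd[OF S(1-3)] S(4)
    unfolding continuous_map_top_of_set_iff limitin_def by (simp add: end_in_end_nbhd)
  then obtain \<delta> where \<delta>: "\<delta> > 0" "\<And>z. z \<in> Z \<Longrightarrow> z \<noteq> t \<Longrightarrow> dist z t < \<delta> \<Longrightarrow> lab z \<in> end_nbhd G S C"
    unfolding eventually_at by blast
  obtain z where z: "z \<in> Z" "t < z" "z < t + \<delta>" using approach \<delta>(1) by blast
  have "lab x \<in> end_nbhd G S C" if "x \<in> Z" "t \<le> x" "x \<le> z" for x
    using \<delta>(2)[of x] that z t(2) \<omega> S(4) by (cases "x = t") (auto simp: dist_real_def end_in_end_nbhd)
  then have "curve x \<in> U" if "t \<le> x" "x \<le> z" for x
    using curve_in_end_nbhd[OF S(3) t(1) z(1) that] S(5) by blast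
  then show "\<forall>\<^sub>F x in at t within {t..b}. curve x \<in> U"
    unfolding eventually_at using z(2) by (intro exI[of _ "z - t"]) (auto simp: dist_real_def)
qed

lemma curve_limit_right:
  assumes t: "t \<in> Z" and b: "b \<in> Z"
  shows "limitin FT curve (curve t) (at t within {t..b})"
proof -
  consider "t \<ge> b" | u where "t < b" "jump t u" | "t < b" "\<nexists>u. jump t u" by force
  then show ?thesis
  proof cases
    case 1
    then have empty: "{t..b} - {t} = {}" by auto
    have "at t within {t..b} = bot" unfolding at_within_def empty by simp
    then show ?thesis using label[OF t] t vertex_gpt by (fastforce simp: limitin_def fpoints_def curve_def)
  next
    case (2 u)
    have "limitin FT curve (curve t) (at t within {t..u})"
      using continuous_curve_jump[OF 2(2)] jumpD[OF 2(2)] unfolding continuous_map_top_of_set_iff by auto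
    moreover have "at t within {t..u} = at t within {t..b}"
      using 2(1) jumpD[OF 2(2)] by (simp add: at_within_Icc_at_right)
    ultimately show ?thesis by simp
  next
    case 3
    then have approach: "\<exists>z\<in>Z. t < z \<and> z < t + \<delta>" if "\<delta> > 0" for \<delta>
      using no_jump_accumulates[OF t _ b] that by blast
    then have "t islimpt Z" unfolding islimpt_approachable_real by force
    then obtain \<omega> where "lab t = Ep \<omega>" using accumulation_is_end t by blast
    then show ?thesis using curve_limit_at_end[OF t] approach by blast
  qed
qed

lemma curve_limit_left:
  assumes t: "t \<in> Z" and a: "a \<in> Z" "a \<le> t"
  shows "limitin FT curve (curve t) (at t within {a..t})"
proof -
  interpret mirror: curve_trace G "uminus ` Z" "\<lambda>z. lab (- z)"
    using curve_trace_isometry[OF curve_trace_axioms, of "- 1" 0] by simp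
  have curve_mirror: "mirror.curve (- x) = curve x" if x: "a \<le> x" "x \<le> t" for x
  proof (cases "x \<in> Z")
    case False
    obtain s u where j: "jump s u" "s < x" "x < u" using jump_around[OF a(1) t x False] by metis
    have "mirror.jump (- u) (- s)"
      using jumpD[OF j(1)] not_in_jump[OF j(1)] unfolding mirror.jump_def by fastforce
    then have "mirror.curve (- x) = Gp (edge_pt (mirror.vertex_at (- u)) (mirror.vertex_at (- s)) ((- x + u) / (- s + u)))"
      using mirror.curve_jump[of "- u" "- s" "- x"] j(2,3) by simp
    also have "(- x + u) / (- s + u) = 1 - (x - s) / (u - s)" using j(2,3) by (simp add: field_simps)
    finally show ?thesis
      using curve_jump[OF j(1)] j(2,3) by (simp add: edge_pt_swap mirror.vertex_at_def vertex_at_def)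
  qed (simp add: curve_def mirror.curve_def)
  have "limitin FT mirror.curve (mirror.curve (- t)) (at (- t) within {- t..- a})"
    by (intro mirror.curve_limit_right) (use t a in auto)
  moreover have "\<forall>\<^sub>F x in at t within {a..t}. curve x \<in> U"
    if lim: "\<forall>\<^sub>F x in at (- t) within {- t..- a}. mirror.curve x \<in> U" for U
  proof -
    obtain d where d: "d > 0"
      "\<forall>x\<in>{- t..- a}. x \<noteq> - t \<and> dist x (- t) < d \<longrightarrow> mirror.curve x \<in> U"
      using lim unfolding eventually_at by blast
    have "curve x \<in> U" if "x \<in> {a..t}" "x \<noteq> t" "dist x t < d" for x
    proof -
      have "mirror.curve (- x) \<in> U" using that d(2) by (simp add: dist_minus)
      then show ?thesis using that(1) curve_mirror by simp
    qed
    then show ?thesis unfolding eventually_at using d(1) by blast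
  qed
  ultimately show ?thesis
    using curve_mirror[OF a(2) order_refl] by (simp add: limitin_def)
qed

lemma continuous_curve:
  assumes a: "a \<in> Z" and b: "b \<in> Z"
  shows "continuous_map (top_of_set {a..b}) FT curve"
  unfolding continuous_map_top_of_set_iff
proof
  fix t assume t: "t \<in> {a..b}"
  show "limitin FT curve (curve t) (at t within {a..b})"
  proof (cases "t \<in> Z")
    case True
    have "{a..b} = {a..t} \<union> {t..b}" using t by auto
    then have "at t within {a..b} = sup (at t within {a..t}) (at t within {t..b})"
      by (simp only: at_within_union)
    then show ?thesis using curve_limit_left[OF True a] curve_limit_right[OF True b] t
      by (simp add: limitin_def eventually_sup)
  next
    case False
    then obtain s u where j: "jump s u" "s < t" "t < u" using jump_around[OF a b] t by auto
    have "limitin FT curve (curve t) (at t within {s..u})"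
      using continuous_curve_jump[OF j(1)] j unfolding continuous_map_top_of_set_iff by auto
    moreover have "at t within {s..u} = at t" using j(2,3) by (intro at_within_interior) simp
    moreover have "at t within {a..b} \<le> at t" by (rule at_le) simp
    ultimately show ?thesis unfolding limitin_def using filter_leD by metis
  qed
qed

lemma curve_inner:
  assumes "jump s u" "s < t" "t < u"
  obtains p where "curve t = Gp p" "{w. p w \<noteq> 0} = {vertex_at s, vertex_at u}"
    "vertex_at s \<noteq> vertex_at u" "p (vertex_at u) = (t - s) / (u - s)"
proof -
  have ne: "vertex_at s \<noteq> vertex_at u" using jump_edge(3)[OF assms(1)] edge_vertices by blast
  have "0 < (t - s) / (u - s)" "(t - s) / (u - s) < 1" using assms by (auto simp: field_simps)
  then show thesis
    using that[OF curve_jump[OF assms(1)] edge_pt_support[OF ne] ne edge_pt_target[OF ne]] assms(2,3) by simp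
qed

lemma curve_inner_not_label:
  assumes "jump s u" "s < t" "t < u" "z \<in> Z"
  shows "curve t \<noteq> curve z"
proof
  assume eq: "curve t = curve z"
  obtain p where p: "curve t = Gp p" "{w. p w \<noteq> 0} = {vertex_at s, vertex_at u}" "vertex_at s \<noteq> vertex_at u"
    using curve_inner[OF assms(1-3)] by metis
  then obtain v where "p = vertex_pt v" using label[OF assms(4)] eq assms(4) by (auto simp: curve_def)
  then show False using p(2,3) by (auto simp: doubleton_eq_iff)
qed

end

locale closed_curve_trace = curve_trace +
  fixes a b :: real
  assumes ends_in: "a \<in> Z" "b \<in> Z" and within: "Z \<subseteq> {a..b}" and closed: "lab a = lab b"
    and inj: "inj_on lab (Z - {b})"
    and spanning: "v \<in> fst G \<Longrightarrow> \<exists>z\<in>Z. lab z = Gp (vertex_pt v)"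
    and three: "\<exists>a\<in>fst G. \<exists>b\<in>fst G. \<exists>c\<in>fst G. a \<noteq> b \<and> a \<noteq> c \<and> b \<noteq> c"
begin

lemma inner_points: "\<exists>c\<in>Z. \<exists>d\<in>Z. a < c \<and> c < d \<and> d < b"
proof -
  have "\<exists>z\<in>Z - {b}. lab z = Gp (vertex_pt v)" if v: "v \<in> fst G" for v
  proof -
    obtain z where z: "z \<in> Z" "lab z = Gp (vertex_pt v)" using spanning[OF v] by blast
    show ?thesis
    proof (cases "z = b")
      case True
      have "a \<noteq> b"
      proof
        assume "a = b"
        then have "x = y" if "x \<in> Z" "y \<in> Z" for x y
          using subsetD[OF within that(1)] subsetD[OF within that(2)] by simp
        then have "x = y" if "x \<in> fst G" "y \<in> fst G" for x y
          using spanning[OF that(1)] spanning[OF that(2)] by force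
        then show False using three by metis
      qed
      then show ?thesis using True z closed ends_in by (intro bexI[of _ a]) auto
    qed (use z in blast)
  qed
  then obtain x y z where xyz: "x \<in> Z - {b}" "y \<in> Z - {b}" "z \<in> Z - {b}" "x \<noteq> y" "x \<noteq> z" "y \<noteq> z"
    using three by (metis fpoint.inject(1) vertex_pt_inject)
  have range: "a \<le> x \<and> x < b" if "x \<in> Z - {b}" for x using that within by fastforce
  have "\<exists>c\<in>Z. \<exists>d\<in>Z. a < c \<and> c < d \<and> d < b" if "x \<in> Z - {b}" "y \<in> Z - {b}" "x \<noteq> y" "x \<noteq> a" "y \<noteq> a" for x y
    using that range[of x] range[of y] by (cases "x < y") force+
  then show ?thesis using xyz by metis
qed

lemma inj_label: "x \<in> Z \<Longrightarrow> y \<in> Z \<Longrightarrow> x \<noteq> b \<Longrightarrow> y \<noteq> b \<Longrightarrow> lab x = lab y \<Longrightarrow> x = y"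
  using inj unfolding inj_on_def by blast

lemma jump_inject:
  assumes j: "jump s u" "jump s' u'"
    and eq: "{vertex_at s, vertex_at u} = {vertex_at s', vertex_at u'}"
  shows "s = s' \<and> u = u'"
proof -
  have Z: "s \<in> Z" "u \<in> Z" "s' \<in> Z" "u' \<in> Z" "s < u" "s' < u'" using jumpD j by blast+
  then have range: "u \<le> b" "u' \<le> b" "a \<le> s" "a \<le> s'" using within by auto
  consider "vertex_at s = vertex_at s'" | "vertex_at s = vertex_at u'" "vertex_at u = vertex_at s'"
    using eq by (metis doubleton_eq_iff)
  then show ?thesis
  proof cases
    case 1
    then have "lab s = lab s'" using jump_edge(1)[OF j(1)] jump_edge(1)[OF j(2)] by simp
    then have "s = s'" using inj_label[of s s'] Z range by auto
    then show ?thesis using not_in_jump[OF j(1) Z(4)] not_in_jump[OF j(2) Z(2)] Z(5,6) by auto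
  next
    case 2
    then have lab: "lab s = lab u'" "lab u = lab s'" using jump_edge(1,2)[OF j(1)] jump_edge(1,2)[OF j(2)] by simp_all
    have "u' = s \<or> u' = b \<and> s = a"
      using lab(1) Z range inj_label[of s u'] inj_label[of s a] closed ends_in by (cases "u' = b") auto
    moreover have "s' = u \<or> u = b \<and> s' = a"
      using lab(2) Z range inj_label[of u s'] inj_label[of s' a] closed ends_in by (cases "u = b") auto
    moreover have "\<not> (jump a x \<and> jump x b)" "\<not> jump a b" for x
      using inner_points not_in_jump[of a x] not_in_jump[of x b] not_in_jump[of a b] by force+
    ultimately show ?thesis using j Z(5,6) by auto
  qed
qed

lemma inj_on_curve: "inj_on curve {a..<b}"
proof (rule inj_onI)
  fix t t' assume t: "t \<in> {a..<b}" "t' \<in> {a..<b}" "curve t = curve t'"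
  have jump: "\<exists>s u. jump s u \<and> s < x \<and> x < u" if "x \<in> {a..<b}" "x \<notin> Z" for x
    using jump_around[OF ends_in, of x] that by fastforce
  consider "t \<in> Z" "t' \<in> Z" | "t \<in> Z \<longleftrightarrow> t' \<notin> Z" | "t \<notin> Z" "t' \<notin> Z" by blast
  then show "t = t'"
  proof cases
    case 1
    then show ?thesis using t inj_label by (simp add: curve_def)
  next
    case 2
    then show ?thesis using t jump[of t] jump[of t'] curve_inner_not_label by metis
  next
    case 3
    obtain s u where j: "jump s u" "s < t" "t < u" using jump[of t] 3 t by blast
    obtain s' u' where j': "jump s' u'" "s' < t'" "t' < u'" using jump[of t'] 3 t by blast
    obtain p where p: "curve t = Gp p" "{w. p w \<noteq> 0} = {vertex_at s, vertex_at u}"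
      "p (vertex_at u) = (t - s) / (u - s)" using curve_inner[OF j] by metis
    obtain p' where p': "curve t' = Gp p'" "{w. p' w \<noteq> 0} = {vertex_at s', vertex_at u'}"
      "p' (vertex_at u') = (t' - s') / (u' - s')" using curve_inner[OF j'] by metis
    have "p = p'" using p(1) p'(1) t(3) by simp
    moreover from this have "s = s' \<and> u = u'" using jump_inject[OF j(1) j'(1)] p(2) p'(2) by simp
    ultimately show ?thesis using p(3) p'(3) j(2,3) by simp
  qed
qed

lemma hamiltonian: "hamiltonian G"
proof -
  have "a < b" using inner_points by force
  then have "is_circle FT (curve ` {a..b})"
    using is_circle_closed_curve[OF _ Hausdorff_FT continuous_curve[OF ends_in] inj_on_curve] closed ends_in
    by (simp add: curve_def)
  moreover have "Gp (vertex_pt v) \<in> curve ` {a..b}" if "v \<in> fst G" for v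
    using spanning[OF that] within by (force simp: curve_def)
  ultimately show ?thesis unfolding hamiltonian_def by blast
qed

end

lemma (in lf_graph) hamiltonian_of_adjoining_traces:
  fixes a s t m d :: real
  assumes trace: "curve_trace G Z lab" "curve_trace G Z' lab"
    and ends_in: "a \<in> Z" "s \<in> Z" "t \<in> Z'" "m \<in> Z'" and within: "Z \<subseteq> {a..s}" "Z' \<subseteq> {t..m}"
    and first: "s \<le> t" "s = t \<or> linked (lab s) (lab t)"
    and last: "m \<le> d" "m = d \<or> linked (lab m) (lab d)" "lab d = lab a"
    and inj: "inj_on lab Z" "inj_on lab Z'" "\<And>x y. x \<in> Z \<Longrightarrow> y \<in> Z' \<Longrightarrow> lab x = lab y \<Longrightarrow> x = y \<or> y = d"
    and cover: "\<And>v. v \<in> fst G \<Longrightarrow> Gp (vertex_pt v) \<in> lab ` (Z \<union> Z')"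
    and three: "\<exists>a\<in>fst G. \<exists>b\<in>fst G. \<exists>c\<in>fst G. a \<noteq> b \<and> a \<noteq> c \<and> b \<noteq> c"
  shows "hamiltonian G"
proof -
  have left_right: "x \<le> s \<and> t \<le> y" if "x \<in> Z" "y \<in> Z'" for x y using that within by auto
  have st: "s \<in> Z \<union> Z'" "m \<in> Z \<union> Z'" using ends_in by auto
  have range: "a \<le> x \<and> x \<le> m" if "x \<in> Z \<union> Z'" for x
    using that within ends_in first(1) by fastforce
  have "curve_trace G (Z \<union> Z') lab"
    using curve_trace_Un[OF trace] left_right ends_in first by blast
  moreover have "curve_trace G {d} lab"
    using curve_trace.label[OF trace(1) ends_in(1)] last(3) by (intro curve_trace_singleton) simp
  ultimately have "curve_trace G (Z \<union> Z' \<union> {d}) lab"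
    by (rule curve_trace_Un) (use range st last in auto)
  moreover have "inj_on lab (Z \<union> Z' \<union> {d} - {d})"
  proof (rule inj_onI)
    fix x y assume xy: "x \<in> Z \<union> Z' \<union> {d} - {d}" "y \<in> Z \<union> Z' \<union> {d} - {d}" "lab x = lab y"
    then consider "x \<in> Z" "y \<in> Z" | "x \<in> Z'" "y \<in> Z'" | "x \<in> Z" "y \<in> Z'" | "x \<in> Z'" "y \<in> Z" by blast
    then show "x = y"
    proof cases
      case 3
      then show ?thesis using inj(3)[OF 3] xy by blast
    next
      case 4
      then show ?thesis using inj(3)[OF 4(2,1)] xy by auto
    qed (use xy(3) inj_onD[OF inj(1)] inj_onD[OF inj(2)] in blast)+
  qed
  moreover have "Z \<union> Z' \<union> {d} \<subseteq> {a..d}"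
    using range last(1) ends_in by fastforce
  moreover have "\<exists>z\<in>Z \<union> Z' \<union> {d}. lab z = Gp (vertex_pt v)" if "v \<in> fst G" for v
    using cover[OF that] by force
  ultimately have "closed_curve_trace G (Z \<union> Z' \<union> {d}) lab a d"
    using three ends_in(1) last(3) by (simp add: closed_curve_trace_def closed_curve_trace_axioms_def)
  then show ?thesis by (rule closed_curve_trace.hamiltonian)
qed

lemma (in lf_graph) hamiltonian_of_consecutive_traces:
  fixes a s t m :: real
  assumes trace: "curve_trace G Z lab" "curve_trace G Z' lab'"
    and ends_in: "a \<in> Z" "s \<in> Z" "t \<in> Z'" "m \<in> Z'" and within: "Z \<subseteq> {a..s}" "Z' \<subseteq> {t..m}"
    and first: "s \<le> t" "if s = t then lab s = lab' t else linked (lab s) (lab' t)"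
    and last: "lab' m = lab a \<or> linked (lab' m) (lab a)"
    and inj: "inj_on lab Z" "inj_on lab' Z'"
    and meet: "\<And>x y. x \<in> Z \<Longrightarrow> y \<in> Z' \<Longrightarrow> lab x = lab' y \<Longrightarrow> x = y \<or> x = a \<and> y = m"
    and cover: "\<And>v. v \<in> fst G \<Longrightarrow> Gp (vertex_pt v) \<in> lab ` Z \<union> lab' ` Z'"
    and three: "\<exists>a\<in>fst G. \<exists>b\<in>fst G. \<exists>c\<in>fst G. a \<noteq> b \<and> a \<noteq> c \<and> b \<noteq> c"
  shows "hamiltonian G"
proof -
  define d where "d = (if lab' m = lab a then m else m + 1)"
  define l where "l z = (if z \<in> Z then lab z else if z \<in> Z' then lab' z else lab a)" for z
  have d: "m \<le> d" "d = m \<longleftrightarrow> lab' m = lab a" by (auto simp: d_def)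
  have l: "l z = lab z" if "z \<in> Z" for z using that by (simp add: l_def)
  have l': "l z = lab' z" if z: "z \<in> Z'" for z
  proof (cases "z \<in> Z")
    case True
    then have "z = s" "z = t" using within z first(1) by force+
    then show ?thesis using l[OF True] first(2) by simp
  next
    case False
    then show ?thesis using z by (simp add: l_def)
  qed
  have l_d: "l d = lab a"
  proof (cases "d = m")
    case True
    then show ?thesis using l'[OF ends_in(4)] d(2) by simp
  next
    case False
    then have "d \<notin> Z" "d \<notin> Z'" using within ends_in first(1) d(1) by force+
    then show ?thesis by (simp add: l_def)
  qed
  show ?thesis
  proof (rule hamiltonian_of_adjoining_traces[OF _ _ ends_in within first(1) _ d(1)])
    show "curve_trace G Z l" by (rule curve_trace_cong[OF trace(1)]) (simp add: l)
    show "curve_trace G Z' l" by (rule curve_trace_cong[OF trace(2)]) (simp add: l')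
    show "s = t \<or> linked (l s) (l t)" using first(2) l[OF ends_in(2)] l'[OF ends_in(3)] by (simp split: if_splits)
    show "m = d \<or> linked (l m) (l d)" using last d(2) l'[OF ends_in(4)] l_d by auto
    show "x = y \<or> y = d" if "x \<in> Z" "y \<in> Z'" "l x = l y" for x y
      using meet[OF that(1,2)] that(3) l[OF that(1)] l'[OF that(2)] d(2) by auto
    show "Gp (vertex_pt v) \<in> l ` (Z \<union> Z')" if "v \<in> fst G" for v
    proof -
      have "l ` Z = lab ` Z" "l ` Z' = lab' ` Z'" using l l' by simp_all
      then show ?thesis using cover[OF that] by (simp add: image_Un)
    qed
  qed (use inj l l' l_d ends_in(1) three in \<open>simp_all add: inj_on_def\<close>)
qed

theorem (in lf_graph) hamiltonian_of_two_traces: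
  fixes a\<^sub>1 b\<^sub>1 a\<^sub>2 b\<^sub>2 :: real
  assumes trace: "curve_trace G Z\<^sub>1 lab\<^sub>1" "curve_trace G Z\<^sub>2 lab\<^sub>2"
    and ends_in: "a\<^sub>1 \<in> Z\<^sub>1" "b\<^sub>1 \<in> Z\<^sub>1" "a\<^sub>2 \<in> Z\<^sub>2" "b\<^sub>2 \<in> Z\<^sub>2"
    and within: "Z\<^sub>1 \<subseteq> {a\<^sub>1..b\<^sub>1}" "Z\<^sub>2 \<subseteq> {a\<^sub>2..b\<^sub>2}"
    and start: "lab\<^sub>1 a\<^sub>1 = lab\<^sub>2 a\<^sub>2 \<or> linked (lab\<^sub>1 a\<^sub>1) (lab\<^sub>2 a\<^sub>2)"
    and finish: "lab\<^sub>1 b\<^sub>1 = lab\<^sub>2 b\<^sub>2 \<or> linked (lab\<^sub>2 b\<^sub>2) (lab\<^sub>1 b\<^sub>1)"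
    and inj: "inj_on lab\<^sub>1 Z\<^sub>1" "inj_on lab\<^sub>2 Z\<^sub>2"
    and meet: "\<And>x y. x \<in> Z\<^sub>1 \<Longrightarrow> y \<in> Z\<^sub>2 \<Longrightarrow> lab\<^sub>1 x = lab\<^sub>2 y \<Longrightarrow> x = a\<^sub>1 \<and> y = a\<^sub>2 \<or> x = b\<^sub>1 \<and> y = b\<^sub>2"
    and cover: "\<And>v. v \<in> fst G \<Longrightarrow> Gp (vertex_pt v) \<in> lab\<^sub>1 ` Z\<^sub>1 \<union> lab\<^sub>2 ` Z\<^sub>2"
    and three: "\<exists>a\<in>fst G. \<exists>b\<in>fst G. \<exists>c\<in>fst G. a \<noteq> b \<and> a \<noteq> c \<and> b \<noteq> c"
  shows "hamiltonian G"
proof -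
  \<comment> \<open>The first trace is run backwards and placed on the negative axis; the second one follows it.\<close>
  define c :: real where "c = (if lab\<^sub>1 a\<^sub>1 = lab\<^sub>2 a\<^sub>2 then 0 else 1)"
  define Z\<^sub>1' where "Z\<^sub>1' = (\<lambda>z. a\<^sub>1 - z) ` Z\<^sub>1"
  define Z\<^sub>2' where "Z\<^sub>2' = (\<lambda>z. z + (c - a\<^sub>2)) ` Z\<^sub>2"
  have c: "0 \<le> c" "0 = c \<longleftrightarrow> lab\<^sub>1 a\<^sub>1 = lab\<^sub>2 a\<^sub>2" by (auto simp: c_def)
  show ?thesis
  proof (rule hamiltonian_of_consecutive_traces)
    show "curve_trace G Z\<^sub>1' (\<lambda>z. lab\<^sub>1 (a\<^sub>1 - z))"
      using curve_trace_isometry[OF trace(1), of "- 1" a\<^sub>1] by (simp add: Z\<^sub>1'_def)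
    show "curve_trace G Z\<^sub>2' (\<lambda>z. lab\<^sub>2 (z - (c - a\<^sub>2)))"
      using curve_trace_isometry[OF trace(2), of 1 "c - a\<^sub>2"] by (simp add: Z\<^sub>2'_def)
    show "a\<^sub>1 - b\<^sub>1 \<in> Z\<^sub>1'" "0 \<in> Z\<^sub>1'" "c \<in> Z\<^sub>2'" "b\<^sub>2 + (c - a\<^sub>2) \<in> Z\<^sub>2'"
      using ends_in unfolding Z\<^sub>1'_def Z\<^sub>2'_def by force+
    show "Z\<^sub>1' \<subseteq> {a\<^sub>1 - b\<^sub>1..0}" "Z\<^sub>2' \<subseteq> {c..b\<^sub>2 + (c - a\<^sub>2)}"
      using within unfolding Z\<^sub>1'_def Z\<^sub>2'_def by auto
    show "inj_on (\<lambda>z. lab\<^sub>1 (a\<^sub>1 - z)) Z\<^sub>1'" "inj_on (\<lambda>z. lab\<^sub>2 (z - (c - a\<^sub>2))) Z\<^sub>2'"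
      using inj unfolding Z\<^sub>1'_def Z\<^sub>2'_def inj_on_def by auto
    show "Gp (vertex_pt v) \<in> (\<lambda>z. lab\<^sub>1 (a\<^sub>1 - z)) ` Z\<^sub>1' \<union> (\<lambda>z. lab\<^sub>2 (z - (c - a\<^sub>2))) ` Z\<^sub>2'" if "v \<in> fst G" for v
      using cover[OF that] unfolding Z\<^sub>1'_def Z\<^sub>2'_def image_image by simp
    fix z z' assume "z \<in> Z\<^sub>1'" "z' \<in> Z\<^sub>2'" "lab\<^sub>1 (a\<^sub>1 - z) = lab\<^sub>2 (z' - (c - a\<^sub>2))"
    then obtain x y where xy: "x \<in> Z\<^sub>1" "y \<in> Z\<^sub>2" "z = a\<^sub>1 - x" "z' = y + (c - a\<^sub>2)" "lab\<^sub>1 x = lab\<^sub>2 y"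
      unfolding Z\<^sub>1'_def Z\<^sub>2'_def by auto
    then show "z = z' \<or> z = a\<^sub>1 - b\<^sub>1 \<and> z' = b\<^sub>2 + (c - a\<^sub>2)" using meet[OF xy(1,2,5)] c(2) by auto
  qed (use c start finish three in auto)
qed

subsection \<open>Caterpillar spines laid out along an interval\<close>

text \<open>The spine vertices sit at positions \<open>\<tau>\<close> in the unit interval, \<open>E\<close> is the set of
  positions occupied by ends, and \<open>sp\<close> sends a leaf to the spine vertex it hangs from.\<close>

locale spine =
  fixes V SP :: "'v set" and adj :: "'v \<Rightarrow> 'v \<Rightarrow> bool" and sp :: "'v \<Rightarrow> 'v"
    and \<tau> :: "'v \<Rightarrow> real" and E :: "real set"
  assumes adj_sym: "adj u v \<Longrightarrow> adj v u"
    and adj_V: "adj u v \<Longrightarrow> u \<in> V \<and> v \<in> V \<and> u \<noteq> v"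
    and connected: "u \<in> V \<Longrightarrow> v \<in> V \<Longrightarrow> adj\<^sup>*\<^sup>* u v"
    and SP_subset: "SP \<subseteq> V"
    and sp_SP: "z \<in> V \<Longrightarrow> sp z \<in> SP" and sp_id: "s \<in> SP \<Longrightarrow> sp s = s"
    and sp_adj: "z \<in> V \<Longrightarrow> z \<notin> SP \<Longrightarrow> adj z (sp z)"
    and finite_block: "s \<in> SP \<Longrightarrow> finite {z \<in> V. sp z = s}"
    and E_closed: "closed E" and E_unit: "E \<subseteq> {0..1}"
    and \<tau>_unit: "s \<in> SP \<Longrightarrow> \<tau> s \<in> {0..1}" and \<tau>_inj: "inj_on \<tau> SP"
    and \<tau>_not_E: "s \<in> SP \<Longrightarrow> \<tau> s \<notin> E"
    and spine_discrete: "t \<in> {0..1} \<Longrightarrow> t \<notin> E \<Longrightarrow> \<exists>\<epsilon>>0. finite {s \<in> SP. \<bar>\<tau> s - t\<bar> < \<epsilon>}"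
    and spine_adj: "s \<in> SP \<Longrightarrow> s' \<in> SP \<Longrightarrow> \<tau> s < \<tau> s' \<Longrightarrow> \<forall>u\<in>SP. \<not> (\<tau> s < \<tau> u \<and> \<tau> u < \<tau> s') \<Longrightarrow>
      \<forall>e\<in>E. \<not> (\<tau> s < e \<and> e < \<tau> s') \<Longrightarrow> adj s s'"
    and spine_around: "t \<in> {0..1} \<Longrightarrow> t \<notin> E \<Longrightarrow>
      \<exists>s\<in>SP. \<exists>s'\<in>SP. \<tau> s \<le> t \<and> t \<le> \<tau> s' \<and> (\<forall>e\<in>E. \<not> (\<tau> s \<le> e \<and> e \<le> \<tau> s'))"
    and ray_to_end: "x \<in> E \<Longrightarrow> \<exists>r. (\<forall>n. adj (r n) (r (Suc n))) \<and> (\<lambda>n. \<tau> (sp (r n))) \<longlonglongrightarrow> x"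
begin

definition pos :: "'v \<Rightarrow> real" where "pos z = \<tau> (sp z)"

text \<open>Two vertices lie in the same gap of \<open>E\<close> iff they cut \<open>E\<close> in the same way.\<close>

definition end_cut :: "'v \<Rightarrow> real set" where "end_cut z = {e \<in> E. e < pos z}"

definition adj_sq :: "'v \<Rightarrow> 'v \<Rightarrow> bool" where
  "adj_sq u w \<longleftrightarrow> adj u w \<or> u \<noteq> w \<and> (\<exists>v. adj u v \<and> adj v w)"

definition consecutive :: "'v \<Rightarrow> 'v \<Rightarrow> bool" where
  "consecutive s u \<longleftrightarrow> s \<in> SP \<and> u \<in> SP \<and> \<tau> s < \<tau> u \<and> end_cut s = end_cut u \<and>
     (\<forall>w\<in>SP. \<not> (\<tau> s < \<tau> w \<and> \<tau> w < \<tau> u))"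

lemma E_range: "e \<in> E \<Longrightarrow> 0 \<le> e \<and> e \<le> 1"
  using E_unit by auto

lemma SP_V: "s \<in> SP \<Longrightarrow> s \<in> V"
  using SP_subset by blast

lemma pos_SP: "s \<in> SP \<Longrightarrow> pos s = \<tau> s"
  by (simp add: pos_def sp_id)

lemma sp_sp: "z \<in> V \<Longrightarrow> sp (sp z) = sp z"
  using sp_id sp_SP by blast

lemma pos_sp: "z \<in> V \<Longrightarrow> pos (sp z) = pos z"
  by (simp add: pos_def sp_sp)

lemma \<tau>_sp: "\<tau> (sp z) = pos z"
  by (simp add: pos_def)

lemma cut_sp: "z \<in> V \<Longrightarrow> end_cut (sp z) = end_cut z"
  by (simp add: end_cut_def pos_sp)

lemma pos_unit: "z \<in> V \<Longrightarrow> 0 \<le> pos z \<and> pos z \<le> 1"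
  using \<tau>_unit sp_SP unfolding pos_def by force

lemma pos_not_E: "z \<in> V \<Longrightarrow> pos z \<notin> E"
  using \<tau>_not_E sp_SP unfolding pos_def by blast

lemma pos_eq_iff: "z \<in> V \<Longrightarrow> z' \<in> V \<Longrightarrow> pos z = pos z' \<longleftrightarrow> sp z = sp z'"
  using \<tau>_inj sp_SP unfolding pos_def inj_on_def by metis

lemma adj_sq_sym: "adj_sq u v \<Longrightarrow> adj_sq v u"
  unfolding adj_sq_def using adj_sym by blast

lemma adj_sq_block: "z \<in> V \<Longrightarrow> z' \<in> V \<Longrightarrow> sp z = sp z' \<Longrightarrow> z \<noteq> z' \<Longrightarrow> adj_sq z z'"
  unfolding adj_sq_def using sp_adj[of z] sp_adj[of z'] sp_id adj_sym by metis

lemma cut_eq_iff: "end_cut z = end_cut z' \<longleftrightarrow> (\<forall>e\<in>E. e < pos z \<longleftrightarrow> e < pos z')"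
  unfolding end_cut_def by blast

lemma cut_eqI:
  assumes "pos z \<le> pos z'" "\<And>e. e \<in> E \<Longrightarrow> \<not> (pos z \<le> e \<and> e < pos z')"
  shows "end_cut z = end_cut z'"
  using assms unfolding cut_eq_iff by force

lemma cut_between:
  assumes "end_cut z = end_cut z'" "pos z \<le> pos w" "pos w \<le> pos z'"
  shows "end_cut w = end_cut z"
  using assms unfolding cut_eq_iff by force

lemma no_end_between: "z \<in> V \<Longrightarrow> z' \<in> V \<Longrightarrow> end_cut z = end_cut z' \<Longrightarrow> {pos z..pos z'} \<inter> E = {}"
  using pos_not_E[of z'] unfolding cut_eq_iff by (force simp: order_le_less)

lemma finite_spine_compact:
  assumes K: "compact K" "K \<inter> E = {}"
  shows "finite {s \<in> SP. \<tau> s \<in> K}"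
proof -
  have "compact (K \<inter> {0..1::real})" using K by (intro compact_Int compact_Icc)
  moreover have "\<forall>t\<in>K \<inter> {0..1}. \<exists>\<epsilon>>0. finite {s \<in> SP. \<bar>\<tau> s - t\<bar> < \<epsilon>}"
    using spine_discrete K by blast
  then obtain \<epsilon> where \<epsilon>: "\<And>t. t \<in> K \<inter> {0..1} \<Longrightarrow> \<epsilon> t > 0 \<and> finite {s \<in> SP. \<bar>\<tau> s - t\<bar> < \<epsilon> t}" by metis
  moreover have "K \<inter> {0..1} \<subseteq> (\<Union>t\<in>K \<inter> {0..1}. ball t (\<epsilon> t))" using \<epsilon> by force
  ultimately obtain D where D: "D \<subseteq> K \<inter> {0..1}" "finite D" "K \<inter> {0..1} \<subseteq> (\<Union>t\<in>D. ball t (\<epsilon> t))"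
    by (metis (no_types, lifting) compactE_image open_ball)
  have "{s \<in> SP. \<tau> s \<in> K} \<subseteq> (\<Union>t\<in>D. {s \<in> SP. \<bar>\<tau> s - t\<bar> < \<epsilon> t})"
  proof
    fix s assume "s \<in> {s \<in> SP. \<tau> s \<in> K}"
    then have s: "s \<in> SP" "\<tau> s \<in> K \<inter> {0..1}" using \<tau>_unit by auto
    then obtain t where "t \<in> D" "\<tau> s \<in> ball t (\<epsilon> t)" using D by blast
    then show "s \<in> (\<Union>t\<in>D. {s \<in> SP. \<bar>\<tau> s - t\<bar> < \<epsilon> t})"
      using s by (auto simp: dist_real_def abs_minus_commute)
  qed
  then show ?thesis by (rule finite_subset) (use D \<epsilon> in blast)
qed

lemma finite_compact:
  assumes K: "compact K" "K \<inter> E = {}"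
  shows "finite {z \<in> V. pos z \<in> K}"
proof -
  have "{z \<in> V. pos z \<in> K} \<subseteq> (\<Union>s\<in>{s \<in> SP. \<tau> s \<in> K}. {z \<in> V. sp z = s})"
    using sp_SP by (auto simp: pos_def)
  then show ?thesis by (rule finite_subset) (use finite_spine_compact[OF K] finite_block in auto)
qed

lemma finite_between:
  assumes "z \<in> V" "z' \<in> V" "end_cut z = end_cut z'"
  shows "finite {w \<in> V. pos z \<le> pos w \<and> pos w \<le> pos z'}"
  using finite_compact[OF compact_Icc no_end_between[OF assms]] by simp

lemma consecutiveD: "consecutive s u \<Longrightarrow> s \<in> SP \<and> u \<in> SP \<and> s \<in> V \<and> u \<in> V \<and> \<tau> s < \<tau> u \<and> end_cut s = end_cut u"
  unfolding consecutive_def using SP_V by blast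

lemma consecutive_adj:
  assumes "consecutive s u"
  shows "adj s u"
proof (rule spine_adj)
  show "\<forall>e\<in>E. \<not> (\<tau> s < e \<and> e < \<tau> u)"
    using consecutiveD[OF assms] unfolding cut_eq_iff by (metis less_asym' pos_SP)
qed (use assms in \<open>auto simp: consecutive_def\<close>)

lemma not_between_consecutive: "consecutive s u \<Longrightarrow> w \<in> SP \<Longrightarrow> \<tau> w \<le> \<tau> s \<or> \<tau> u \<le> \<tau> w"
  unfolding consecutive_def by force

lemma consecutive_adj_sq:
  assumes "consecutive s u" "a \<in> V" "b \<in> V" "sp a = s" "sp b = u" "a \<in> SP \<or> b \<in> SP"
  shows "adj_sq a b"
proof -
  have su: "adj s u" "s \<noteq> u" using consecutive_adj consecutiveD assms(1) by blast+
  then have ab: "a \<noteq> b" using assms(4,5) by auto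
  show ?thesis
  proof (cases "a \<in> SP \<and> b \<in> SP")
    case True
    then show ?thesis using su assms(4,5) sp_id unfolding adj_sq_def by auto
  next
    case False
    then consider "a = s" "b \<notin> SP" | "b = u" "a \<notin> SP" using assms(4-6) sp_id by auto
    then show ?thesis
    proof cases
      case 1
      then show ?thesis using su(1) ab sp_adj[of b] adj_sym assms(3,5) unfolding adj_sq_def by blast
    next
      case 2
      then show ?thesis using su(1) ab sp_adj[of a] assms(2,4) unfolding adj_sq_def by blast
    qed
  qed
qed

lemma consecutive_twice_adj_sq: "consecutive s u \<Longrightarrow> consecutive u s' \<Longrightarrow> adj_sq s s'"
  unfolding adj_sq_def using consecutive_adj consecutiveD by (metis less_asym')

lemma successor_exists:
  assumes s: "s \<in> SP" "s' \<in> SP" "end_cut s = end_cut s'" "\<tau> s < \<tau> s'"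
  shows "\<exists>u. consecutive s u \<and> \<tau> u \<le> \<tau> s'"
proof -
  let ?A = "{u \<in> SP. \<tau> s < \<tau> u \<and> \<tau> u \<le> \<tau> s'}"
  have "?A \<subseteq> {w \<in> V. pos s \<le> pos w \<and> pos w \<le> pos s'}" using s SP_V pos_SP by auto
  then have "finite ?A" by (rule finite_subset) (rule finite_between[OF SP_V[OF s(1)] SP_V[OF s(2)] s(3)])
  moreover have "s' \<in> ?A" using s by auto
  ultimately obtain u where u: "u \<in> ?A" "\<And>w. w \<in> ?A \<Longrightarrow> \<tau> u \<le> \<tau> w"
    using ex_is_arg_min_if_finite[of ?A \<tau>] unfolding is_arg_min_linorder by blast
  have "end_cut u = end_cut s" using cut_between[OF s(3), of u] u s pos_SP by auto
  moreover have "\<not> (\<tau> s < \<tau> w \<and> \<tau> w < \<tau> u)" if "w \<in> SP" for w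
    using u(2)[of w] u(1) that by auto
  ultimately show ?thesis unfolding consecutive_def using u s by (intro exI[of _ u]) auto
qed

lemma spine_right_of_end:
  assumes e: "e \<in> E" "e < t" "e < 1" "\<forall>e'\<in>E. \<not> (e < e' \<and> e' < t)"
  shows "\<exists>s u. consecutive s u \<and> e < \<tau> s \<and> \<tau> u < t"
proof -
  have near: "\<exists>s\<in>SP. e < \<tau> s \<and> \<tau> s \<le> x" if x: "e < x" "x < t" "x \<le> 1" for x
  proof -
    have "x \<in> {0..1}" "x \<notin> E" using x e E_range[OF e(1)] by auto
    then obtain s s' where s: "s \<in> SP" "\<tau> s \<le> x" "x \<le> \<tau> s'" "\<forall>e\<in>E. \<not> (\<tau> s \<le> e \<and> e \<le> \<tau> s')"
      using spine_around by blast
    then have "e < \<tau> s" using e x by force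
    then show ?thesis using s by blast
  qed
  define x where "x = min ((e + t) / 2) 1"
  have x: "e < x" "x < t" "x \<le> 1" unfolding x_def using e by (auto simp: min_def)
  obtain s' where s': "s' \<in> SP" "e < \<tau> s'" "\<tau> s' \<le> x" using near[OF x] by blast
  obtain s where s: "s \<in> SP" "e < \<tau> s" "\<tau> s \<le> (e + \<tau> s') / 2" using near[of "(e + \<tau> s') / 2"] s' x by auto
  have less: "\<tau> s < \<tau> s'" using s(3) s'(2) by (simp add: field_simps)
  moreover from this have "end_cut s = end_cut s'"
  proof (intro cut_eqI)
    show "\<not> (pos s \<le> e' \<and> e' < pos s')" if "e' \<in> E" for e'
      using bspec[OF e(4) that] s(2) s'(3) x(2) by (auto simp: pos_SP s(1) s'(1))
  qed (simp add: pos_SP s(1) s'(1))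
  ultimately obtain u where "consecutive s u" "\<tau> u \<le> \<tau> s'" using successor_exists s s' by blast
  then show ?thesis using s s' x by (intro exI[of _ s] exI[of _ u]) auto
qed

lemma spine_start:
  assumes E0: "0 \<notin> E"
  shows "\<exists>x u. consecutive x u \<and> \<tau> x = 0"
proof -
  obtain x where x: "x \<in> SP" "\<tau> x = 0" using spine_around[of 0] E0 \<tau>_unit by force
  obtain d where d: "d > 0" "\<forall>e\<in>E. d \<le> dist 0 e" using separate_point_closed[OF E_closed E0] by blast
  define t where "t = min (d / 2) 1"
  have t: "0 < t" "t < d" "t \<le> 1" unfolding t_def using d by auto
  have far: "t < e" if "e \<in> E" for e using d(2) that t(2) E_range[OF that] by (force simp: dist_real_def)
  then have "t \<notin> E" by force
  then obtain s s' where s: "s' \<in> SP" "\<tau> s \<le> t" "t \<le> \<tau> s'" "\<forall>e\<in>E. \<not> (\<tau> s \<le> e \<and> e \<le> \<tau> s')"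
    using spine_around[of t] t by auto
  have "end_cut x = end_cut s'"
  proof (rule cut_eqI)
    show "pos x \<le> pos s'" using x s pos_SP t by auto
    show "\<not> (pos x \<le> e \<and> e < pos s')" if "e \<in> E" for e
      using s(2,4) that far[OF that] pos_SP[OF s(1)] by auto
  qed
  then show ?thesis using successor_exists[OF x(1) s(1)] x s(3) t(1) by auto
qed

lemma mirror: "spine V SP adj sp (\<lambda>s. 1 - \<tau> s) ((\<lambda>e. 1 - e) ` E)"
proof
  have mem: "t \<in> (\<lambda>e. 1 - e) ` E \<longleftrightarrow> 1 - t \<in> E" for t by force
  have "closed ((\<lambda>t. 1 - t) -` E)" using E_closed by (intro closed_vimage continuous_intros)
  also have "(\<lambda>t. 1 - t) -` E = (\<lambda>e. 1 - e) ` E" using mem by blast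
  finally show "closed ((\<lambda>e. 1 - e) ` E)" .
  show "(\<lambda>e. 1 - e) ` E \<subseteq> {0..1}" using E_range by auto
  show "inj_on (\<lambda>s. 1 - \<tau> s) SP" using \<tau>_inj by (simp add: inj_on_def)
  show "\<exists>\<epsilon>>0. finite {s \<in> SP. \<bar>1 - \<tau> s - t\<bar> < \<epsilon>}" if "t \<in> {0..1}" "t \<notin> (\<lambda>e. 1 - e) ` E" for t
  proof -
    have "\<bar>1 - \<tau> s - t\<bar> = \<bar>\<tau> s - (1 - t)\<bar>" for s by simp
    then show ?thesis using spine_discrete[of "1 - t"] that mem by simp
  qed
  show "\<exists>s\<in>SP. \<exists>s'\<in>SP. 1 - \<tau> s \<le> t \<and> t \<le> 1 - \<tau> s' \<and> (\<forall>e\<in>(\<lambda>e. 1 - e) ` E. \<not> (1 - \<tau> s \<le> e \<and> e \<le> 1 - \<tau> s'))"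
    if "t \<in> {0..1}" "t \<notin> (\<lambda>e. 1 - e) ` E" for t
  proof -
    have "1 - t \<in> {0..1}" "1 - t \<notin> E" using that mem by auto
    then obtain s s' where "s \<in> SP" "s' \<in> SP" "\<tau> s \<le> 1 - t" "1 - t \<le> \<tau> s'" "\<forall>e\<in>E. \<not> (\<tau> s \<le> e \<and> e \<le> \<tau> s')"
      using spine_around by blast
    then show ?thesis by (intro bexI[of _ s'] bexI[of _ s]) auto
  qed
  show "\<exists>r. (\<forall>n. adj (r n) (r (Suc n))) \<and> (\<lambda>n. 1 - \<tau> (sp (r n))) \<longlonglongrightarrow> x" if x: "x \<in> (\<lambda>e. 1 - e) ` E" for x
  proof -
    obtain r where r: "\<forall>n. adj (r n) (r (Suc n))" "(\<lambda>n. \<tau> (sp (r n))) \<longlonglongrightarrow> 1 - x"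
      using ray_to_end[of "1 - x"] x mem by blast
    have "(\<lambda>n. 1 - \<tau> (sp (r n))) \<longlonglongrightarrow> 1 - (1 - x)" by (intro tendsto_intros r(2))
    then show ?thesis using r(1) by auto
  qed
  show "adj s s'" if "s \<in> SP" "s' \<in> SP" "1 - \<tau> s < 1 - \<tau> s'"
    "\<forall>u\<in>SP. \<not> (1 - \<tau> s < 1 - \<tau> u \<and> 1 - \<tau> u < 1 - \<tau> s')"
    "\<forall>e\<in>(\<lambda>e. 1 - e) ` E. \<not> (1 - \<tau> s < e \<and> e < 1 - \<tau> s')" for s s'
    using spine_adj[of s' s] that adj_sym by force
  show "1 - \<tau> s \<in> {0..1}" "1 - \<tau> s \<notin> (\<lambda>e. 1 - e) ` E" if "s \<in> SP" for s
    using \<tau>_unit[OF that] \<tau>_not_E[OF that] by auto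
qed (fact adj_sym adj_V connected SP_subset sp_SP sp_id sp_adj finite_block)+

interpretation mirror: spine V SP adj sp "\<lambda>s. 1 - \<tau> s" "(\<lambda>e. 1 - e) ` E"
  by (rule mirror)

lemma mirror_pos: "mirror.pos z = 1 - pos z"
  by (simp add: pos_def mirror.pos_def)

lemma mirror_cut_eq_iff:
  assumes "z \<in> V" "z' \<in> V"
  shows "mirror.end_cut z = mirror.end_cut z' \<longleftrightarrow> end_cut z = end_cut z'"
proof -
  have "1 - e < mirror.pos w \<longleftrightarrow> \<not> e < pos w" if "w \<in> V" "e \<in> E" for w e
    using pos_not_E[OF that(1)] that(2) by (cases "e = pos w") (auto simp: mirror_pos)
  then show ?thesis using assms unfolding mirror.cut_eq_iff cut_eq_iff by auto
qed

lemma mirror_consecutive: "mirror.consecutive s u \<longleftrightarrow> consecutive u s"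
proof (cases "s \<in> SP \<and> u \<in> SP")
  case True
  then have "mirror.end_cut s = mirror.end_cut u \<longleftrightarrow> end_cut u = end_cut s"
    using mirror_cut_eq_iff[of s u] SP_V by auto
  then show ?thesis unfolding mirror.consecutive_def consecutive_def by auto
qed (auto simp: consecutive_def mirror.consecutive_def)

lemma predecessor_exists:
  assumes "s \<in> SP" "s' \<in> SP" "end_cut s = end_cut s'" "\<tau> s < \<tau> s'"
  shows "\<exists>u. consecutive u s' \<and> \<tau> s \<le> \<tau> u"
  using mirror.successor_exists[OF assms(2,1)] assms mirror_cut_eq_iff[OF SP_V SP_V] mirror_consecutive by auto

lemma spine_left_of_end:
  assumes "e \<in> E" "t < e" "0 < e" "\<forall>e'\<in>E. \<not> (t < e' \<and> e' < e)"
  shows "\<exists>s u. consecutive s u \<and> t < \<tau> s \<and> \<tau> u < e"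
  using mirror.spine_right_of_end[of "1 - e" "1 - t"] assms unfolding mirror_consecutive by force

lemma spine_finish: "1 \<notin> E \<Longrightarrow> \<exists>u x. consecutive u x \<and> \<tau> x = 1"
  using mirror.spine_start unfolding mirror_consecutive by force

lemma parity_exists: "\<exists>par :: 'v \<Rightarrow> bool. \<forall>s u. consecutive s u \<longrightarrow> par s \<noteq> par u"
proof -
  define rep where "rep s = (SOME s'. s' \<in> SP \<and> end_cut s' = end_cut s)" for s
  define B where "B s = {w \<in> SP. \<tau> (rep s) \<le> \<tau> w \<and> \<tau> w < \<tau> s \<or> \<tau> s \<le> \<tau> w \<and> \<tau> w < \<tau> (rep s)}" for s
  have rep: "rep s \<in> SP" "end_cut (rep s) = end_cut s" if "s \<in> SP" for s
    using someI[of "\<lambda>s'. s' \<in> SP \<and> end_cut s' = end_cut s" s] that unfolding rep_def by auto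
  have fin: "finite (B s)" if s: "s \<in> SP" for s
  proof -
    have "B s \<subseteq> {w \<in> V. pos (rep s) \<le> pos w \<and> pos w \<le> pos s} \<union> {w \<in> V. pos s \<le> pos w \<and> pos w \<le> pos (rep s)}"
      unfolding B_def using SP_V pos_SP rep(1) s by auto
    then show ?thesis by (rule finite_subset) (use finite_between rep s SP_V in simp)
  qed
  have "even (card (B s)) \<noteq> even (card (B u))" if su: "consecutive s u" for s u
  proof -
    have S: "s \<in> SP" "u \<in> SP" "\<tau> s < \<tau> u" "end_cut s = end_cut u" using consecutiveD[OF su] by auto
    have rep_u: "rep u = rep s" unfolding rep_def using S(4) by simp
    have w: "\<tau> w < \<tau> u \<longleftrightarrow> \<tau> w < \<tau> s \<or> w = s" if "w \<in> SP" for w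
      using not_between_consecutive[OF su that] inj_onD[OF \<tau>_inj, of w s] that S by force
    consider "\<tau> (rep s) \<le> \<tau> s" | "\<tau> u \<le> \<tau> (rep s)"
      using not_between_consecutive[OF su rep(1)[OF S(1)]] by blast
    then have "B u = insert s (B s) \<and> s \<notin> B s \<or> B s = insert s (B u) \<and> s \<notin> B u"
    proof cases
      case 1
      then have "\<not> (\<tau> s \<le> \<tau> w \<and> \<tau> w < \<tau> (rep s))" "\<not> (\<tau> u \<le> \<tau> w \<and> \<tau> w < \<tau> (rep s))" for w
        using S(3) by auto
      then show ?thesis using 1 w S(1) unfolding B_def rep_u by auto
    next
      case 2
      have "\<tau> s \<le> \<tau> w \<longleftrightarrow> \<tau> u \<le> \<tau> w \<or> w = s" if "w \<in> SP" for w using w[OF that] S(3) by force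
      moreover have "\<not> (\<tau> (rep s) \<le> \<tau> w \<and> \<tau> w < \<tau> s)" "\<not> (\<tau> (rep s) \<le> \<tau> w \<and> \<tau> w < \<tau> u)" for w
        using 2 S(3) by auto
      ultimately show ?thesis using 2 S unfolding B_def rep_u by auto
    qed
    then show ?thesis using fin[OF S(1)] fin[OF S(2)] by auto
  qed
  then show ?thesis by (intro exI[of _ "\<lambda>s. even (card (B s))"]) blast
qed

lemma width_exists:
  assumes s: "s \<in> SP"
  shows "\<exists>w>0. w \<le> 1/4 \<and> (\<forall>s'\<in>SP. s' \<noteq> s \<longrightarrow> 3 * w \<le> \<bar>\<tau> s - \<tau> s'\<bar>) \<and> (\<forall>e\<in>E. 3 * w \<le> \<bar>\<tau> s - e\<bar>)"
proof -
  obtain \<epsilon> where \<epsilon>: "\<epsilon> > 0" "finite {s' \<in> SP. \<bar>\<tau> s' - \<tau> s\<bar> < \<epsilon>}"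
    using spine_discrete[OF \<tau>_unit[OF s] \<tau>_not_E[OF s]] by blast
  let ?F = "\<tau> ` ({s' \<in> SP. \<bar>\<tau> s' - \<tau> s\<bar> < \<epsilon>} - {s})"
  have "closed (E \<union> ?F)" using \<epsilon>(2) by (intro closed_Un E_closed finite_imp_closed finite_imageI) auto
  moreover have "\<tau> s \<notin> E \<union> ?F" using \<tau>_not_E[OF s] inj_onD[OF \<tau>_inj] s by force
  ultimately obtain d where d: "d > 0" "\<forall>x\<in>E \<union> ?F. d \<le> dist (\<tau> s) x"
    using separate_point_closed[of "E \<union> ?F" "\<tau> s"] by blast
  define w where "w = min (1/4) (min \<epsilon> d / 3)"
  have w: "0 < w" "w \<le> 1/4" "3 * w \<le> \<epsilon>" "3 * w \<le> d" unfolding w_def using \<epsilon> d by (auto simp: min_def)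
  have "3 * w \<le> \<bar>\<tau> s - \<tau> s'\<bar>" if "s' \<in> SP" "s' \<noteq> s" for s'
  proof (cases "\<bar>\<tau> s' - \<tau> s\<bar> < \<epsilon>")
    case True
    then have "\<tau> s' \<in> E \<union> ?F" using that by blast
    then show ?thesis using d(2) w(4) by (force simp: dist_real_def)
  qed (use w in auto)
  moreover have "3 * w \<le> \<bar>\<tau> s - e\<bar>" if "e \<in> E" for e using d(2) w(4) that by (force simp: dist_real_def)
  ultimately show ?thesis using w by blast
qed

lemma spread_exists:
  "\<exists>\<rho> :: 'v \<Rightarrow> real. (\<forall>z. 0 < \<rho> z \<and> \<rho> z < 1/2) \<and> (\<forall>s\<in>SP. inj_on \<rho> {z \<in> V. sp z = s})"
proof -
  have "\<forall>s\<in>SP. \<exists>g :: 'v \<Rightarrow> nat. inj_on g {z \<in> V. sp z = s}"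
    using finite_block finite_imp_inj_to_nat_seg by metis
  then obtain g :: "'v \<Rightarrow> 'v \<Rightarrow> nat" where g: "\<And>s. s \<in> SP \<Longrightarrow> inj_on (g s) {z \<in> V. sp z = s}" by metis
  show ?thesis
    by (rule exI[of _ "\<lambda>z. 1 / (real (g (sp z) z) + 3)"])
      (use g in \<open>auto simp: inj_on_def field_simps\<close>)
qed

end

subsection \<open>A route between the two ends of the spine\<close>

lemma loop_erasure:
  fixes f :: "nat \<Rightarrow> 'v" and \<kappa> :: "'v \<Rightarrow> 'c"
  defines "fin \<equiv> \<lambda>t. finite {m. \<kappa> (f m) = \<kappa> (f t)}"
  obtains J last where "0 \<in> J" "inj_on (\<lambda>t. \<kappa> (f t)) J"
    "\<And>t. t \<in> J \<Longrightarrow> fin t \<Longrightarrow> Suc (last t) \<in> J \<and> t \<le> last t \<and> \<kappa> (f (last t)) = \<kappa> (f t)"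
    "\<And>t t'. t \<in> J \<Longrightarrow> t' \<in> J \<Longrightarrow> t < t' \<Longrightarrow> fin t \<and> last t < t'"
proof -
  define last where "last t = Max {m. \<kappa> (f m) = \<kappa> (f t)}" for t
  define a where "a = rec_nat 0 (\<lambda>_ t. Suc (last t))"
  have a: "a 0 = 0" "a (Suc k) = Suc (last (a k))" for k by (simp_all add: a_def)
  define J where "J = {a k |k. \<forall>j<k. fin (a j)}"
  have last_ge: "m \<le> last t" if "fin t" "\<kappa> (f m) = \<kappa> (f t)" for m t
    using that unfolding last_def fin_def by (intro Max_ge) auto
  have last: "\<kappa> (f (last t)) = \<kappa> (f t)" if "fin t" for t
    using Max_in[of "{m. \<kappa> (f m) = \<kappa> (f t)}"] that unfolding last_def fin_def by auto
  have step: "last (a k) < a k'" if "k < k'" "\<forall>j<k'. fin (a j)" for k k' using that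
  proof (induction k')
    case (Suc k')
    then show ?case using a last_ge[of "a k'" "a k'"] by (cases "k = k'") (auto simp: less_Suc_eq)
  qed simp
  have mono: "fin t \<and> last t < t'" if t: "t \<in> J" "t' \<in> J" "t < t'" for t t'
  proof -
    obtain k k' where k: "t = a k" "t' = a k'" "\<forall>j<k. fin (a j)" "\<forall>j<k'. fin (a j)"
      using t(1,2) unfolding J_def by blast
    have "k < k'"
    proof (rule ccontr)
      assume "\<not> k < k'"
      then have "a k' \<le> a k" using step[of k' k] last_ge[of "a k'" "a k'"] k by (cases "k = k'") auto
      then show False using t(3) k by simp
    qed
    then show ?thesis using step k by blast
  qed
  show thesis
  proof (rule that[of J last])
    show "0 \<in> J" unfolding J_def by (intro CollectI exI[of _ 0]) (simp add: a(1))
    show "inj_on (\<lambda>t. \<kappa> (f t)) J"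
      using mono last_ge by (intro linorder_inj_onI') (metis leD)
    show "Suc (last t) \<in> J \<and> t \<le> last t \<and> \<kappa> (f (last t)) = \<kappa> (f t)" if t: "t \<in> J" "fin t" for t
    proof -
      obtain k where k: "t = a k" "\<forall>j<k. fin (a j)" using t(1) unfolding J_def by blast
      have "\<forall>j<Suc k. fin (a j)" using k t(2) by (auto simp: less_Suc_eq)
      then have "Suc (last t) \<in> J" unfolding J_def
        by (intro CollectI exI[of _ "Suc k"]) (simp add: a(2) k(1))
      then show ?thesis using last_ge[OF t(2) refl] last[OF t(2)] by blast
    qed
  qed (rule mono)
qed

text \<open>An escape leads to the right end of the interval; it enters the gap visited at time \<open>t\<close> at
  \<open>inn t\<close> and leaves it at \<open>out t\<close>.\<close>

locale escape = spine V SP adj sp \<tau> E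
  for V SP :: "'v set" and adj sp \<tau> E +
  fixes J :: "nat set" and inn out :: "nat \<Rightarrow> 'v"
  assumes start: "0 \<in> J"
    and inn_V: "t \<in> J \<Longrightarrow> inn t \<in> V" and out_V: "t \<in> J \<Longrightarrow> out t \<in> V"
    and out_cut: "t \<in> J \<Longrightarrow> end_cut (out t) = end_cut (inn t)"
    and cut_inj: "inj_on (\<lambda>t. end_cut (inn t)) J"
    and step: "t \<in> J \<Longrightarrow> t' \<in> J \<Longrightarrow> t < t' \<Longrightarrow> \<forall>k\<in>J. \<not> (t < k \<and> k < t') \<Longrightarrow> adj (out t) (inn t')"
    and last_gap: "t \<in> J \<Longrightarrow> \<forall>t'\<in>J. t' \<le> t \<Longrightarrow> e \<in> E \<Longrightarrow> \<not> (pos (inn t) < e \<and> e < 1)"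
    and end_if_infinite: "infinite J \<Longrightarrow> 1 \<in> E"
    and limit: "infinite J \<Longrightarrow> 0 < \<delta> \<Longrightarrow> \<exists>N. \<forall>t\<in>J. N \<le> t \<longrightarrow> 1 - \<delta> < pos (inn t) \<and> 1 - \<delta> < pos (out t)"

lemma escape_restart:
  assumes "escape V SP adj sp \<tau> E J inn out" "u \<in> J"
  shows "escape V SP adj sp \<tau> E {n. n + u \<in> J} (\<lambda>n. inn (n + u)) (\<lambda>n. out (n + u))"
proof -
  interpret escape V SP adj sp \<tau> E J inn out by (rule assms(1))
  have fin: "finite {n. n + u \<in> J}" if "finite J"
    using finite_vimageI[OF that, of "\<lambda>n. n + u"] by (simp add: vimage_def)
  show ?thesis
  proof
    show "inj_on (\<lambda>n. end_cut (inn (n + u))) {n. n + u \<in> J}"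
      using cut_inj unfolding inj_on_def by force
    show "adj (out (t + u)) (inn (t' + u))"
      if t: "t \<in> {n. n + u \<in> J}" "t' \<in> {n. n + u \<in> J}" "t < t'" "\<forall>k\<in>{n. n + u \<in> J}. \<not> (t < k \<and> k < t')" for t t'
    proof (rule step)
      show "\<forall>k\<in>J. \<not> (t + u < k \<and> k < t' + u)"
      proof
        fix k assume "k \<in> J"
        then show "\<not> (t + u < k \<and> k < t' + u)" using bspec[OF t(4), of "k - u"] by auto
      qed
    qed (use t in auto)
    show "\<not> (pos (inn (t + u)) < e \<and> e < 1)"
      if t: "t \<in> {n. n + u \<in> J}" "\<forall>t'\<in>{n. n + u \<in> J}. t' \<le> t" "e \<in> E" for t e
    proof (rule last_gap[OF _ _ t(3)])
      show "\<forall>t'\<in>J. t' \<le> t + u"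
      proof
        fix t' assume "t' \<in> J"
        then show "t' \<le> t + u" using bspec[OF t(2), of "t' - u"] by (cases "u \<le> t'") auto
      qed
    qed (use t in simp)
    show "\<exists>N. \<forall>t\<in>{n. n + u \<in> J}. N \<le> t \<longrightarrow> 1 - \<delta> < pos (inn (t + u)) \<and> 1 - \<delta> < pos (out (t + u))"
      if "infinite {n. n + u \<in> J}" "0 < \<delta>" for \<delta>
    proof -
      have "infinite J" using that(1) fin by blast
      then obtain N where N: "\<forall>t\<in>J. N \<le> t \<longrightarrow> 1 - \<delta> < pos (inn t) \<and> 1 - \<delta> < pos (out t)"
        using limit[OF _ \<open>0 < \<delta>\<close>] by blast
      then show ?thesis by (intro exI[of _ N]) auto
    qed
    show "1 \<in> E" if "infinite {n. n + u \<in> J}" using end_if_infinite that fin by blast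
  qed (use assms(2) inn_V out_V out_cut in auto)
qed

context spine
begin

definition walk :: "(nat \<Rightarrow> 'v) \<Rightarrow> bool" where
  "walk f \<longleftrightarrow> (\<forall>k. f k \<in> V) \<and> (\<forall>k. f k = f (Suc k) \<or> adj (f k) (f (Suc k)))"

definition exits :: "(nat \<Rightarrow> 'v) \<Rightarrow> bool" where
  "exits f \<longleftrightarrow> walk f \<and>
     ((\<exists>K m. (\<forall>k\<ge>K. f k = m) \<and> (\<forall>e\<in>E. \<not> (pos m < e \<and> e < 1))) \<or>
      1 \<in> E \<and> (\<forall>z\<in>V. \<exists>e\<in>E. pos z < e \<and> e < 1) \<and> (\<lambda>k. pos (f k)) \<longlonglongrightarrow> 1)"

lemma walk_extend:
  assumes "u \<in> V" "walk g"
  shows "\<exists>f K. walk f \<and> f 0 = u \<and> (\<forall>k. f (k + K) = g k)"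
proof -
  have "adj\<^sup>*\<^sup>* u (g 0)" using connected assms unfolding walk_def by blast
  then show ?thesis using assms(1)
  proof (induction rule: converse_rtranclp_induct)
    case base
    then show ?case using assms by (intro exI[of _ g] exI[of _ 0]) auto
  next
    case (step x y)
    then obtain f K where f: "walk f" "f 0 = y" "\<forall>k. f (k + K) = g k" using adj_V by blast
    have "walk (case_nat x f)" unfolding walk_def
      using f step adj_V by (auto simp: walk_def split: nat.splits)
    then show ?case using f(3) by (intro exI[of _ "case_nat x f"] exI[of _ "Suc K"]) auto
  qed
qed

lemma exit_walk_exists:
  assumes v: "v \<in> V"
  shows "\<exists>f. exits f \<and> f 0 = v"
proof (cases "\<exists>m\<in>V. \<forall>e\<in>E. \<not> (pos m < e \<and> e < 1)")
  case True
  then obtain m where m: "m \<in> V" "\<forall>e\<in>E. \<not> (pos m < e \<and> e < 1)" by blast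
  have "walk (\<lambda>_. m)" unfolding walk_def using m by simp
  then obtain f K where f: "walk f" "f 0 = v" "\<forall>k. f (k + K) = m" using walk_extend[OF v] by blast
  have "\<forall>k\<ge>K. f k = m" using f(3) by (metis le_add_diff_inverse2)
  then have "exits f" unfolding exits_def using f(1) m(2) by blast
  then show ?thesis using f(2) by blast
next
  case False
  have E1: "1 \<in> E"
  proof (rule ccontr)
    assume "1 \<notin> E"
    then obtain u x where "consecutive u x" "\<tau> x = 1" using spine_finish by blast
    then show False using False consecutiveD pos_SP by (metis less_asym)
  qed
  then obtain r where r: "\<forall>n. adj (r n) (r (Suc n))" "(\<lambda>n. \<tau> (sp (r n))) \<longlonglongrightarrow> 1"
    using ray_to_end by blast
  then have "walk r" unfolding walk_def using adj_V by blast
  then obtain f K where f: "walk f" "f 0 = v" "\<forall>k. f (k + K) = r k" using walk_extend[OF v] by blast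
  have "(\<lambda>k. pos (f (k + K))) \<longlonglongrightarrow> 1" using r(2) f(3) by (simp add: pos_def)
  then have "(\<lambda>k. pos (f k)) \<longlonglongrightarrow> 1" by (rule LIMSEQ_offset)
  then have "exits f" unfolding exits_def using f(1) E1 False by blast
  then show ?thesis using f(2) by blast
qed

lemma last_gap_cong:
  assumes "end_cut z = end_cut z'" "z' \<in> V" "e \<in> E" "\<not> (pos z' < e \<and> e < 1)"
  shows "\<not> (pos z < e \<and> e < 1)"
  using assms pos_not_E[OF assms(2)] unfolding cut_eq_iff by (metis less_asym linorder_neqE)

lemma exits_infinitely_often:
  assumes f: "exits f" and inf: "infinite {m. end_cut (f m) = end_cut (f t)}" and e: "e \<in> E"
  shows "\<not> (pos (f t) < e \<and> e < 1)"
  using f unfolding exits_def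
proof (elim conjE disjE exE)
  fix K m assume m: "\<forall>k\<ge>K. f k = m" "\<forall>e\<in>E. \<not> (pos m < e \<and> e < 1)" and "walk f"
  then have "m \<in> V" unfolding walk_def by (metis order_refl)
  moreover obtain k where "k \<ge> K" "end_cut (f k) = end_cut (f t)"
    using inf unfolding infinite_nat_iff_unbounded_le by blast
  ultimately show ?thesis using last_gap_cong[of "f t" m e] m e by auto
next
  assume E: "\<forall>z\<in>V. \<exists>e\<in>E. pos z < e \<and> e < 1" and lim: "(\<lambda>k. pos (f k)) \<longlonglongrightarrow> 1" and "walk f"
  then obtain e' where e': "e' \<in> E" "pos (f t) < e'" "e' < 1" unfolding walk_def by blast
  obtain K where "\<forall>k\<ge>K. e' < pos (f k)"
    using order_tendstoD(1)[OF lim e'(3)] unfolding eventually_sequentially by blast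
  moreover obtain k where "k \<ge> K" "end_cut (f k) = end_cut (f t)"
    using inf unfolding infinite_nat_iff_unbounded_le by blast
  ultimately show ?thesis using e'(1,2) unfolding cut_eq_iff by force
qed

lemma exits_converges:
  assumes f: "exits f" and fin: "\<And>K. \<exists>t\<ge>K. finite {m. end_cut (f m) = end_cut (f t)}"
  shows "1 \<in> E \<and> (\<lambda>k. pos (f k)) \<longlonglongrightarrow> 1"
  using f unfolding exits_def
proof (elim conjE disjE exE)
  fix K m assume m: "\<forall>k\<ge>K. f k = m"
  obtain t where t: "K \<le> t" "finite {m. end_cut (f m) = end_cut (f t)}" using fin by blast
  have "{K..} \<subseteq> {k. end_cut (f k) = end_cut (f t)}" using m t(1) by auto
  then show ?thesis using t(2) infinite_Ici[of K] finite_subset by blast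
qed blast

lemma escape_exists:
  assumes v: "v \<in> V"
  shows "\<exists>J inn out. escape V SP adj sp \<tau> E J inn out \<and> inn 0 = v"
proof -
  obtain f where f: "exits f" "f 0 = v" using exit_walk_exists[OF v] by blast
  then have walk: "f k \<in> V" "f k = f (Suc k) \<or> adj (f k) (f (Suc k))" for k
    unfolding exits_def walk_def by blast+
  define fin where "fin t \<longleftrightarrow> finite {m. end_cut (f m) = end_cut (f t)}" for t
  obtain J last where J: "0 \<in> J" "inj_on (\<lambda>t. end_cut (f t)) J"
    and last: "\<And>t. t \<in> J \<Longrightarrow> fin t \<Longrightarrow> Suc (last t) \<in> J \<and> t \<le> last t \<and> end_cut (f (last t)) = end_cut (f t)"
    and mono: "\<And>t t'. t \<in> J \<Longrightarrow> t' \<in> J \<Longrightarrow> t < t' \<Longrightarrow> fin t \<and> last t < t'"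
    unfolding fin_def by (rule loop_erasure[of end_cut f]) blast
  define out where "out t = (if fin t then f (last t) else f t)" for t
  have all_fin: "fin t" if "infinite J" "t \<in> J" for t
    using that mono unfolding infinite_nat_iff_unbounded by blast
  have lim: "1 \<in> E \<and> (\<lambda>k. pos (f k)) \<longlonglongrightarrow> 1" if inf: "infinite J"
    using exits_converges[OF f(1)] all_fin[OF inf] inf unfolding fin_def infinite_nat_iff_unbounded_le by blast
  have "escape V SP adj sp \<tau> E J f out"
  proof
    show "out t \<in> V" for t unfolding out_def using walk(1) by simp
    show "end_cut (out t) = end_cut (f t)" if "t \<in> J" for t unfolding out_def using last that by simp
    show "adj (out t) (f t')" if t: "t \<in> J" "t' \<in> J" "t < t'" "\<forall>k\<in>J. \<not> (t < k \<and> k < t')" for t t'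
    proof -
      have l: "fin t" "last t < t'" "Suc (last t) \<in> J" "t \<le> last t" "end_cut (f (last t)) = end_cut (f t)"
        using mono[OF t(1-3)] last[OF t(1)] by blast+
      then have t': "t' = Suc (last t)" using t(4) by force
      have "end_cut (f t') \<noteq> end_cut (f t)" using inj_on_eq_iff[OF J(2) t(2,1)] t(3) by simp
      then have "f (last t) \<noteq> f t'" using l(5) by metis
      then show ?thesis using walk(2)[of "last t"] l(1) by (simp add: out_def t')
    qed
    show "\<not> (pos (f t) < e \<and> e < 1)" if t: "t \<in> J" "\<forall>t'\<in>J. t' \<le> t" "e \<in> E" for t e
    proof -
      have "\<not> fin t" using last[OF t(1)] t(2) by force
      then show ?thesis using exits_infinitely_often[OF f(1) _ t(3)] unfolding fin_def by blast
    qed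
    show "\<exists>N. \<forall>t\<in>J. N \<le> t \<longrightarrow> 1 - \<delta> < pos (f t) \<and> 1 - \<delta> < pos (out t)"
      if inf: "infinite J" and \<delta>: "0 < \<delta>" for \<delta>
    proof -
      have "1 - \<delta> < 1" using \<delta> by simp
      then obtain N where N: "\<forall>k\<ge>N. 1 - \<delta> < pos (f k)"
        using order_tendstoD(1)[OF lim[OF inf, THEN conjunct2]] unfolding eventually_sequentially by blast
      have "1 - \<delta> < pos (f t) \<and> 1 - \<delta> < pos (out t)" if "t \<in> J" "N \<le> t" for t
        using N last[OF that(1) all_fin[OF inf that(1)]] that(2) unfolding out_def by auto
      then show ?thesis by blast
    qed
  qed (use walk(1) J lim in auto)
  then show ?thesis using f(2) by blast
qed

end

text \<open>The route passes through the gaps indexed by \<open>J\<close>, entering the \<open>i\<close>-th one at \<open>ent i\<close> and leaving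
  it at \<open>ext i\<close>. These vertices merely determine the gap if \<open>i\<close> is the least, respectively the
  greatest, element of \<open>J\<close>; that gap then borders on 0, respectively 1.\<close>

locale routed = spine V SP adj sp \<tau> E
  for V SP :: "'v set" and adj sp \<tau> E +
  fixes J :: "int set" and ent ext :: "int \<Rightarrow> 'v"
  assumes J_nonempty: "J \<noteq> {}"
    and ent_V: "i \<in> J \<Longrightarrow> ent i \<in> V" and ext_V: "i \<in> J \<Longrightarrow> ext i \<in> V"
    and ext_cut: "i \<in> J \<Longrightarrow> end_cut (ext i) = end_cut (ent i)"
    and cut_inj: "inj_on (\<lambda>i. end_cut (ent i)) J"
    and bridge: "i \<in> J \<Longrightarrow> j \<in> J \<Longrightarrow> i < j \<Longrightarrow> \<forall>k\<in>J. \<not> (i < k \<and> k < j) \<Longrightarrow> adj (ext i) (ent j)"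
    and first_gap: "i \<in> J \<Longrightarrow> \<forall>j\<in>J. i \<le> j \<Longrightarrow> e \<in> E \<Longrightarrow> \<not> (0 < e \<and> e < pos (ent i))"
    and last_gap: "i \<in> J \<Longrightarrow> \<forall>j\<in>J. j \<le> i \<Longrightarrow> e \<in> E \<Longrightarrow> \<not> (pos (ent i) < e \<and> e < 1)"
    and below_end: "\<forall>i\<in>J. \<exists>j\<in>J. j < i \<Longrightarrow> 0 \<in> E"
    and below_limit: "\<forall>i\<in>J. \<exists>j\<in>J. j < i \<Longrightarrow> 0 < \<delta> \<Longrightarrow>
      \<exists>N. \<forall>i\<in>J. i < N \<longrightarrow> pos (ent i) < \<delta> \<and> pos (ext i) < \<delta>"
    and above_end: "\<forall>i\<in>J. \<exists>j\<in>J. i < j \<Longrightarrow> 1 \<in> E"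
    and above_limit: "\<forall>i\<in>J. \<exists>j\<in>J. i < j \<Longrightarrow> 0 < \<delta> \<Longrightarrow>
      \<exists>N. \<forall>i\<in>J. N < i \<longrightarrow> 1 - \<delta> < pos (ent i) \<and> 1 - \<delta> < pos (ext i)"

text \<open>Two escapes, to the left and to the right end, that start in a common gap and meet nowhere else
  combine to a route.\<close>

locale escape_pair = spine V SP adj sp \<tau> E
    + L: escape V SP adj sp "\<lambda>s. 1 - \<tau> s" "(\<lambda>e. 1 - e) ` E" L inL outL
    + R: escape V SP adj sp \<tau> E R inR outR
  for V SP :: "'v set" and adj sp \<tau> E L inL outL R inR outR +
  assumes meet: "end_cut (inL 0) = end_cut (inR 0)"
    and apart: "n \<in> L \<Longrightarrow> m \<in> R \<Longrightarrow> end_cut (inL n) = end_cut (inR m) \<Longrightarrow> n = 0 \<and> m = 0"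
begin

definition J :: "int set" where "J = (\<lambda>n. - int n) ` L \<union> int ` R"

definition ent :: "int \<Rightarrow> 'v" where "ent i = (if i \<le> 0 then outL (nat (- i)) else inR (nat i))"

definition ext :: "int \<Rightarrow> 'v" where "ext i = (if i < 0 then inL (nat (- i)) else outR (nat i))"

lemma J_iff: "i \<in> J \<longleftrightarrow> (if i < 0 then nat (- i) \<in> L else nat i \<in> R)"
  unfolding J_def using L.start R.start by (cases "i = 0") force+

lemma zero_in_J: "0 \<in> J"
  using R.start by (simp add: J_iff)

lemma outL_cut: "n \<in> L \<Longrightarrow> end_cut (outL n) = end_cut (inL n)"
  using L.out_cut mirror_cut_eq_iff L.inn_V L.out_V by blast

lemma ent_cut: "n \<in> L \<Longrightarrow> end_cut (ent (- int n)) = end_cut (inL n)"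
    "m \<in> R \<Longrightarrow> end_cut (ent (int m)) = end_cut (inR m)"
  using outL_cut[OF L.start] outL_cut meet by (cases "m = 0"; simp add: ent_def)+

lemma ent_ext_V: "i \<in> J \<Longrightarrow> ent i \<in> V \<and> ext i \<in> V"
  using L.inn_V L.out_V R.inn_V R.out_V L.start unfolding ent_def ext_def J_iff by (auto split: if_splits)

lemma ext_ent_cut: "i \<in> J \<Longrightarrow> end_cut (ext i) = end_cut (ent i)"
  using outL_cut[OF L.start] outL_cut R.out_cut meet unfolding J_iff ent_def ext_def by (auto split: if_splits)

lemma infinite_L:
  assumes unb: "\<forall>i\<in>J. \<exists>j\<in>J. j < i"
  shows "infinite L"
proof
  assume fin: "finite L"
  then have "- int (Max L) \<in> J" unfolding J_def using L.start by (blast intro: Max_in)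
  then obtain j where j: "j \<in> J" "j < - int (Max L)" using unb by blast
  then have "nat (- j) \<in> L" unfolding J_iff by (simp split: if_splits)
  from Max_ge[OF fin this] show False using j(2) by linarith
qed

lemma infinite_R:
  assumes unb: "\<forall>i\<in>J. \<exists>j\<in>J. i < j"
  shows "infinite R"
proof
  assume fin: "finite R"
  then have "int (Max R) \<in> J" unfolding J_def using R.start by (blast intro: Max_in)
  then obtain j where j: "j \<in> J" "int (Max R) < j" using unb by blast
  then have "nat j \<in> R" unfolding J_iff by (simp split: if_splits)
  from Max_ge[OF fin this] show False using j(2) by linarith
qed

lemma ent_cut_inj: "inj_on (\<lambda>i. end_cut (ent i)) J"
proof (rule inj_onI)
  fix i j assume ij: "i \<in> J" "j \<in> J" "end_cut (ent i) = end_cut (ent j)"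
  have mixed: "- int n = int m"
    if "n \<in> L" "m \<in> R" "end_cut (ent (- int n)) = end_cut (ent (int m))" for n m
    using apart[OF that(1,2)] that ent_cut by simp
  from ij(1,2) show "i = j"
    unfolding J_def
  proof (elim UnE imageE)
    fix n n' assume n: "i = - int n" "n \<in> L" "j = - int n'" "n' \<in> L"
    then have "end_cut (inL n) = end_cut (inL n')" using ij(3) ent_cut(1) by simp
    then show ?thesis using inj_onD[OF L.cut_inj] mirror_cut_eq_iff L.inn_V n by simp
  next
    fix m m' assume "i = int m" "m \<in> R" "j = int m'" "m' \<in> R"
    then show ?thesis using inj_onD[OF R.cut_inj] ij(3) ent_cut(2) by simp
  next
    fix n m assume "i = - int n" "n \<in> L" "j = int m" "m \<in> R"
    then show ?thesis using mixed[of n m] ij(3) by simp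
  next
    fix m n assume "i = int m" "m \<in> R" "j = - int n" "n \<in> L"
    then show ?thesis using mixed[of n m] ij(3) by simp
  qed
qed

lemma adj_ext_ent:
  assumes ij: "i \<in> J" "j \<in> J" "i < j" "\<forall>k\<in>J. \<not> (i < k \<and> k < j)"
  shows "adj (ext i) (ent j)"
proof (cases "j \<le> 0")
  case True
  have "\<not> (nat (- j) < k \<and> k < nat (- i))" if "k \<in> L" for k
    using bspec[OF ij(4), of "- int k"] that unfolding J_def by force
  then have "adj (outL (nat (- j))) (inL (nat (- i)))"
    by (intro L.step) (use ij(1-3) True L.start in \<open>auto simp: J_iff split: if_splits\<close>)
  then show ?thesis using adj_sym ij(3) True unfolding ent_def ext_def by simp
next
  case False
  then have i: "0 \<le> i" using bspec[OF ij(4) zero_in_J] by linarith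
  have "\<not> (nat i < k \<and> k < nat j)" if "k \<in> R" for k
    using bspec[OF ij(4), of "int k"] that unfolding J_def by force
  then have "adj (outR (nat i)) (inR (nat j))"
    by (intro R.step) (use ij(1-3) False i R.start in \<open>auto simp: J_iff split: if_splits\<close>)
  then show ?thesis using False i unfolding ent_def ext_def by simp
qed

lemma ent_first_gap:
  assumes i: "i \<in> J" "\<forall>j\<in>J. i \<le> j" and e: "e \<in> E"
  shows "\<not> (0 < e \<and> e < pos (ent i))"
proof -
  have "i \<le> 0" by (rule bspec[OF i(2) zero_in_J])
  then have "i = - int (nat (- i))" "nat (- i) \<in> L" using i(1)[unfolded J_iff] L.start by (cases "i = 0"; simp)+
  then obtain n where n: "i = - int n" "n \<in> L" by blast
  have "\<forall>n'\<in>L. n' \<le> n" using i(2) n(1) unfolding J_def by force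
  from L.last_gap[OF n(2) this, of "1 - e"] have "\<not> (0 < e \<and> e < pos (inL n))" using e unfolding mirror_pos by force
  then show ?thesis using ent_cut(1)[OF n(2)] e n(1) unfolding cut_eq_iff by auto
qed

lemma ent_last_gap:
  assumes i: "i \<in> J" "\<forall>j\<in>J. j \<le> i" and e: "e \<in> E"
  shows "\<not> (pos (ent i) < e \<and> e < 1)"
proof -
  have "0 \<le> i" by (rule bspec[OF i(2) zero_in_J])
  then have "i = int (nat i)" "nat i \<in> R" using i(1)[unfolded J_iff] by simp_all
  then obtain m where m: "i = int m" "m \<in> R" by blast
  have "\<forall>m'\<in>R. m' \<le> m" using i(2) m(1) unfolding J_def by force
  from R.last_gap[OF m(2) this e] show ?thesis
    using last_gap_cong[OF ent_cut(2)[OF m(2)] R.inn_V[OF m(2)] e] unfolding m(1) by simp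
qed

lemma routed: "routed V SP adj sp \<tau> E J ent ext"
proof
  show "\<exists>N. \<forall>i\<in>J. i < N \<longrightarrow> pos (ent i) < \<delta> \<and> pos (ext i) < \<delta>"
    if unb: "\<forall>i\<in>J. \<exists>j\<in>J. j < i" and \<delta>: "0 < \<delta>" for \<delta>
  proof -
    obtain N where N: "\<forall>n\<in>L. N \<le> n \<longrightarrow> pos (inL n) < \<delta> \<and> pos (outL n) < \<delta>"
      using L.limit[OF infinite_L[OF unb] \<delta>] unfolding mirror_pos by auto
    then show ?thesis unfolding ent_def ext_def by (intro exI[of _ "- int N"]) (auto simp: J_iff)
  qed
  show "\<exists>N. \<forall>i\<in>J. N < i \<longrightarrow> 1 - \<delta> < pos (ent i) \<and> 1 - \<delta> < pos (ext i)"
    if unb: "\<forall>i\<in>J. \<exists>j\<in>J. i < j" and \<delta>: "0 < \<delta>" for \<delta>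
  proof -
    obtain N where N: "\<forall>n\<in>R. N \<le> n \<longrightarrow> 1 - \<delta> < pos (inR n) \<and> 1 - \<delta> < pos (outR n)"
      using R.limit[OF infinite_R[OF unb] \<delta>] by auto
    then show ?thesis unfolding ent_def ext_def by (intro exI[of _ "int N"]) (auto simp: J_iff)
  qed
  show "0 \<in> E" if "\<forall>i\<in>J. \<exists>j\<in>J. j < i" using L.end_if_infinite[OF infinite_L[OF that]] by force
  show "1 \<in> E" if "\<forall>i\<in>J. \<exists>j\<in>J. i < j" using R.end_if_infinite[OF infinite_R[OF that]] .
qed (use ent_ext_V ext_ent_cut ent_cut_inj adj_ext_ent ent_first_gap ent_last_gap zero_in_J in blast)+

end

context spine
begin

interpretation mirror: spine V SP adj sp "\<lambda>s. 1 - \<tau> s" "(\<lambda>e. 1 - e) ` E"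
  by (rule mirror)

lemma common_gaps_finite:
  assumes left: "escape V SP adj sp (\<lambda>s. 1 - \<tau> s) ((\<lambda>e. 1 - e) ` E) L inL outL"
    and right: "escape V SP adj sp \<tau> E R inR outR"
  shows "finite {n \<in> L. \<exists>m\<in>R. end_cut (inL n) = end_cut (inR m)}" (is "finite ?F")
proof -
  interpret L: escape V SP adj sp "\<lambda>s. 1 - \<tau> s" "(\<lambda>e. 1 - e) ` E" L inL outL by (rule left)
  interpret R: escape V SP adj sp \<tau> E R inR outR by (rule right)
  have inj: "inj_on (\<lambda>n. end_cut (inL n)) L"
    using L.cut_inj mirror_cut_eq_iff L.inn_V unfolding inj_on_def by blast
  have fin: "finite {n \<in> L. \<exists>m\<in>M. end_cut (inL n) = end_cut (inR m)}" if "finite M" for M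
  proof (rule inj_on_finite)
    show "(\<lambda>n. end_cut (inL n)) ` {n \<in> L. \<exists>m\<in>M. end_cut (inL n) = end_cut (inR m)} \<subseteq> (\<lambda>m. end_cut (inR m)) ` M"
      by auto
  qed (use inj that in \<open>auto intro: inj_on_subset\<close>)
  consider "finite L" | "finite R" | "infinite L" "infinite R" by blast
  then show ?thesis
  proof cases
    case 3
    obtain n n' where n: "n \<in> L" "n' \<in> L" "n < n'"
      using 3(1) L.start unfolding infinite_nat_iff_unbounded by blast
    then have "end_cut (inL n) \<noteq> end_cut (inL n')" using inj_on_eq_iff[OF inj n(1,2)] n(3) by simp
    then obtain e where e: "e \<in> E" "e < pos (inL n) \<longleftrightarrow> \<not> e < pos (inL n')" unfolding cut_eq_iff by blast
    have "0 \<le> pos z \<and> pos z \<le> 1 \<and> pos z \<noteq> e" if "z \<in> V" for z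
      using pos_unit[OF that] pos_not_E[OF that] e(1) by blast
    then have inner: "0 < e" "e < 1" using e(2) L.inn_V[OF n(1)] L.inn_V[OF n(2)] by force+
    obtain N where N: "\<forall>n\<in>L. N \<le> n \<longrightarrow> pos (inL n) < e"
      using L.limit[OF 3(1) inner(1)] unfolding mirror_pos by auto
    obtain M where M: "\<forall>m\<in>R. M \<le> m \<longrightarrow> e < pos (inR m)"
      using R.limit[OF 3(2), of "1 - e"] inner(2) by auto
    have "?F \<subseteq> {..<N} \<union> {n \<in> L. \<exists>m\<in>{..<M}. end_cut (inL n) = end_cut (inR m)}"
    proof
      fix n assume "n \<in> ?F"
      then obtain m where nm: "n \<in> L" "m \<in> R" "end_cut (inL n) = end_cut (inR m)" by blast
      then have "n < N \<or> m < M" using N M e(1) unfolding cut_eq_iff by (metis less_asym linorder_not_le)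
      then show "n \<in> {..<N} \<union> {n \<in> L. \<exists>m\<in>{..<M}. end_cut (inL n) = end_cut (inR m)}" using nm by blast
    qed
    then show ?thesis by (rule finite_subset) (simp add: fin)
  qed (use fin in simp_all)
qed

lemma V_nonempty: "V \<noteq> {}"
  using spine_start ray_to_end[of 0] consecutiveD adj_V by blast

lemma route_exists: "\<exists>J ent ext. routed V SP adj sp \<tau> E J ent ext"
proof -
  obtain v where v: "v \<in> V" using V_nonempty by blast
  obtain L inL outL where left: "escape V SP adj sp (\<lambda>s. 1 - \<tau> s) ((\<lambda>e. 1 - e) ` E) L inL outL" "inL 0 = v"
    using mirror.escape_exists[OF v] by blast
  obtain R inR outR where right: "escape V SP adj sp \<tau> E R inR outR" "inR 0 = v"
    using escape_exists[OF v] by blast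
  interpret L: escape V SP adj sp "\<lambda>s. 1 - \<tau> s" "(\<lambda>e. 1 - e) ` E" L inL outL by (rule left(1))
  interpret R: escape V SP adj sp \<tau> E R inR outR by (rule right(1))
  let ?F = "{n \<in> L. \<exists>m\<in>R. end_cut (inL n) = end_cut (inR m)}"
  have "0 \<in> ?F" using L.start R.start left(2) right(2) by (auto intro!: bexI[of _ 0])
  moreover have "finite ?F" by (rule common_gaps_finite[OF left(1) right(1)])
  ultimately have t: "Max ?F \<in> ?F" and max: "\<And>n. n \<in> ?F \<Longrightarrow> n \<le> Max ?F"
    using Max_in[of ?F] Max_ge[of ?F] by blast+
  define t where "t = Max ?F"
  obtain u where u: "u \<in> R" "end_cut (inL t) = end_cut (inR u)" using t unfolding t_def by blast
  have t_in_L: "t \<in> L" using t unfolding t_def by blast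
  have apart: "n = 0 \<and> m = 0" if h: "n + t \<in> L" "m + u \<in> R" "end_cut (inL (n + t)) = end_cut (inR (m + u))" for n m
  proof -
    have "n + t \<le> t" using max[of "n + t"] h unfolding t_def by blast
    then have n: "n = 0" by simp
    then have "end_cut (inR (m + u)) = end_cut (inR u)" using h(3) u(2) by simp
    then have "m + u = u" using inj_onD[OF R.cut_inj] h(2) u(1) by blast
    then show ?thesis using n by simp
  qed
  have "escape_pair V SP adj sp \<tau> E {n. n + t \<in> L} (\<lambda>n. inL (n + t)) (\<lambda>n. outL (n + t))
      {n. n + u \<in> R} (\<lambda>n. inR (n + u)) (\<lambda>n. outR (n + u))"
    unfolding escape_pair_def escape_pair_axioms_def
    using spine_axioms escape_restart[OF left(1) t_in_L] escape_restart[OF right(1) u(1)] u(2) apart by simp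
  then show ?thesis using escape_pair.routed by blast
qed

end

subsection \<open>Sections\<close>

text \<open>The \<open>i\<close>-th section is the part of the \<open>i\<close>-th gap between the positions \<open>entry i\<close> and \<open>exit i\<close>;
  it is traversed in the direction \<open>dir i\<close>.\<close>

context routed
begin

definition has_pred :: "int \<Rightarrow> bool" where "has_pred i \<longleftrightarrow> (\<exists>j\<in>J. j < i)"

definition has_succ :: "int \<Rightarrow> bool" where "has_succ i \<longleftrightarrow> (\<exists>j\<in>J. i < j)"

definition entry :: "int \<Rightarrow> real" where "entry i = (if has_pred i then pos (ent i) else 0)"

definition exit :: "int \<Rightarrow> real" where "exit i = (if has_succ i then pos (ext i) else 1)"

definition dir :: "int \<Rightarrow> real" where "dir i = (if entry i \<le> exit i then 1 else - 1)"

definition visited :: "'v \<Rightarrow> bool" where "visited z \<longleftrightarrow> (\<exists>i\<in>J. end_cut (ent i) = end_cut z)"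

definition idx :: "'v \<Rightarrow> int" where "idx z = (THE i. i \<in> J \<and> end_cut (ent i) = end_cut z)"

definition in_section :: "'v \<Rightarrow> bool" where
  "in_section z \<longleftrightarrow> visited z \<and> pos z \<in> closed_segment (entry (idx z)) (exit (idx z))"

lemma dir_cases: "dir i = 1 \<or> dir i = - 1"
  unfolding dir_def by auto

lemma idx_eq: "i \<in> J \<Longrightarrow> end_cut (ent i) = end_cut z \<Longrightarrow> idx z = i \<and> visited z"
  unfolding idx_def visited_def using cut_inj by (auto simp: inj_on_def intro!: the_equality)

lemma visited_idx: "visited z \<Longrightarrow> idx z \<in> J \<and> end_cut (ent (idx z)) = end_cut z"
  using idx_eq unfolding visited_def by metis

lemma visited_cong: "end_cut z = end_cut z' \<Longrightarrow> visited z = visited z' \<and> idx z = idx z'"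
  unfolding visited_def idx_def by simp

lemma in_section_idx: "in_section z \<Longrightarrow> idx z \<in> J \<and> end_cut (ent (idx z)) = end_cut z"
  unfolding in_section_def using visited_idx by blast

lemma idx_sp: "z \<in> V \<Longrightarrow> idx (sp z) = idx z"
  using visited_cong cut_sp by blast

lemma in_section_sp: "z \<in> V \<Longrightarrow> in_section (sp z) = in_section z"
  unfolding in_section_def using visited_cong[of "sp z" z] cut_sp pos_sp by simp

lemma in_section_same_cut:
  "in_section z \<Longrightarrow> in_section z' \<Longrightarrow> idx z = idx z' \<Longrightarrow> end_cut z = end_cut z'"
  using in_section_idx by metis

lemma in_section_between:
  assumes z: "in_section z" "in_section z'" "idx z = idx z'" "pos z \<le> pos w" "pos w \<le> pos z'"
  shows "in_section w" "idx w = idx z"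
proof -
  have "end_cut w = end_cut z" using cut_between in_section_same_cut z by blast
  then have "visited w = visited z" "idx w = idx z" using visited_cong by blast+
  then show "in_section w" "idx w = idx z"
    using z by (auto simp: in_section_def closed_segment_eq_real_ivl split: if_splits)
qed

lemma in_section_dir:
  assumes "in_section z"
  shows "dir (idx z) * entry (idx z) \<le> dir (idx z) * pos z" "dir (idx z) * pos z \<le> dir (idx z) * exit (idx z)"
  using assms by (auto simp: in_section_def dir_def closed_segment_eq_real_ivl split: if_splits)

lemma first_section: "i \<in> J \<Longrightarrow> \<not> has_pred i \<Longrightarrow> entry i = 0 \<and> dir i = 1"
  using pos_unit[OF ext_V] by (simp add: entry_def exit_def dir_def)

lemma ent_section:
  "i \<in> J \<Longrightarrow> has_pred i \<Longrightarrow> in_section (ent i) \<and> idx (ent i) = i \<and> pos (ent i) = entry i"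
  using idx_eq[of i "ent i"] by (auto simp: in_section_def entry_def)

lemma ext_section:
  "i \<in> J \<Longrightarrow> has_succ i \<Longrightarrow> in_section (ext i) \<and> idx (ext i) = i \<and> pos (ext i) = exit i"
  using idx_eq[of i "ext i"] ext_cut by (auto simp: in_section_def exit_def)

lemma first_section_exists: "0 \<notin> E \<Longrightarrow> \<exists>i\<in>J. \<not> has_pred i"
  using below_end unfolding has_pred_def by blast

lemma
  assumes i: "i \<in> J" and e: "e \<in> E"
  shows ext_first_gap: "\<forall>j\<in>J. i \<le> j \<Longrightarrow> \<not> (0 < e \<and> e < pos (ext i))"
    and ext_last_gap: "\<forall>j\<in>J. j \<le> i \<Longrightarrow> \<not> (pos (ext i) < e \<and> e < 1)"
proof -
  have "e < pos (ext i) \<longleftrightarrow> e < pos (ent i)" using ext_cut[OF i] e unfolding cut_eq_iff by blast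
  moreover have "e \<noteq> pos (ent i)" using pos_not_E[OF ent_V[OF i]] e by blast
  ultimately show "\<forall>j\<in>J. i \<le> j \<Longrightarrow> \<not> (0 < e \<and> e < pos (ext i))"
    "\<forall>j\<in>J. j \<le> i \<Longrightarrow> \<not> (pos (ext i) < e \<and> e < 1)"
    using first_gap[OF i _ e] last_gap[OF i _ e] by force+
qed

lemma mirror_routed:
  "routed V SP adj sp (\<lambda>s. 1 - \<tau> s) ((\<lambda>e. 1 - e) ` E) (uminus ` J) (\<lambda>i. ext (- i)) (\<lambda>i. ent (- i))"
proof -
  interpret mirror: spine V SP adj sp "\<lambda>s. 1 - \<tau> s" "(\<lambda>e. 1 - e) ` E" by (rule mirror)
  have mem: "i \<in> uminus ` J \<longleftrightarrow> - i \<in> J" "e \<in> (\<lambda>e. 1 - e) ` E \<longleftrightarrow> 1 - e \<in> E" for i e by force+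
  have cut: "mirror.end_cut z = mirror.end_cut z' \<longleftrightarrow> end_cut z = end_cut z'" if "z \<in> V" "z' \<in> V" for z z'
    by (rule mirror_cut_eq_iff[OF that])
  have down: "\<forall>i\<in>J. \<exists>j\<in>J. i < j" if "\<forall>i\<in>uminus ` J. \<exists>j\<in>uminus ` J. j < i" using that by force
  have up: "\<forall>i\<in>J. \<exists>j\<in>J. j < i" if "\<forall>i\<in>uminus ` J. \<exists>j\<in>uminus ` J. i < j" using that by force
  show ?thesis
  proof
    show "inj_on (\<lambda>i. mirror.end_cut (ext (- i))) (uminus ` J)"
      using inj_onD[OF cut_inj] cut ext_V ext_cut by (auto simp: inj_on_def)
    show "adj (ent (- i)) (ext (- j))"
      if ij: "i \<in> uminus ` J" "j \<in> uminus ` J" "i < j" "\<forall>k\<in>uminus ` J. \<not> (i < k \<and> k < j)" for i j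
    proof (rule adj_sym, rule bridge)
      show "\<forall>k\<in>J. \<not> (- j < k \<and> k < - i)" using ij(4) by force
    qed (use ij mem in auto)
    show "\<not> (0 < e \<and> e < mirror.pos (ext (- i)))"
      if i: "i \<in> uminus ` J" "\<forall>j\<in>uminus ` J. i \<le> j" "e \<in> (\<lambda>e. 1 - e) ` E" for i e
      using ext_last_gap[of "- i" "1 - e"] i by (force simp: mem mirror_pos)
    show "\<not> (mirror.pos (ext (- i)) < e \<and> e < 1)"
      if i: "i \<in> uminus ` J" "\<forall>j\<in>uminus ` J. j \<le> i" "e \<in> (\<lambda>e. 1 - e) ` E" for i e
      using ext_first_gap[of "- i" "1 - e"] i by (force simp: mem mirror_pos)
    show "0 \<in> (\<lambda>e. 1 - e) ` E" if "\<forall>i\<in>uminus ` J. \<exists>j\<in>uminus ` J. j < i"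
      using above_end[OF down[OF that]] by (simp add: mem)
    show "1 \<in> (\<lambda>e. 1 - e) ` E" if "\<forall>i\<in>uminus ` J. \<exists>j\<in>uminus ` J. i < j"
      using below_end[OF up[OF that]] by (simp add: mem)
    show "\<exists>N. \<forall>i\<in>uminus ` J. i < N \<longrightarrow> mirror.pos (ext (- i)) < \<delta> \<and> mirror.pos (ent (- i)) < \<delta>"
      if unb: "\<forall>i\<in>uminus ` J. \<exists>j\<in>uminus ` J. j < i" and \<delta>: "0 < \<delta>" for \<delta>
    proof -
      obtain N where "\<forall>i\<in>J. N < i \<longrightarrow> 1 - \<delta> < pos (ent i) \<and> 1 - \<delta> < pos (ext i)"
        using above_limit[OF down[OF unb] \<delta>] by blast
      then show ?thesis by (intro exI[of _ "- N"]) (auto simp: mirror_pos)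
    qed
    show "\<exists>N. \<forall>i\<in>uminus ` J. N < i \<longrightarrow> 1 - \<delta> < mirror.pos (ext (- i)) \<and> 1 - \<delta> < mirror.pos (ent (- i))"
      if unb: "\<forall>i\<in>uminus ` J. \<exists>j\<in>uminus ` J. i < j" and \<delta>: "0 < \<delta>" for \<delta>
    proof -
      obtain N where "\<forall>i\<in>J. i < N \<longrightarrow> pos (ent i) < \<delta> \<and> pos (ext i) < \<delta>"
        using below_limit[OF up[OF unb] \<delta>] by blast
      then show ?thesis by (intro exI[of _ "- N"]) (auto simp: mirror_pos)
    qed
  qed (use J_nonempty ent_V ext_V cut ext_cut mem in auto)
qed

interpretation mirror: routed V SP adj sp "\<lambda>s. 1 - \<tau> s" "(\<lambda>e. 1 - e) ` E" "uminus ` J" "\<lambda>i. ext (- i)" "\<lambda>i. ent (- i)"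
  by (rule mirror_routed)

lemma mirror_has_pred: "mirror.has_pred i \<longleftrightarrow> has_succ (- i)"
  and mirror_has_succ: "mirror.has_succ i \<longleftrightarrow> has_pred (- i)"
  by (force simp: has_pred_def has_succ_def mirror.has_pred_def mirror.has_succ_def)+

lemma mirror_entry: "mirror.entry i = 1 - exit (- i)"
  and mirror_exit: "mirror.exit i = 1 - entry (- i)"
  by (simp_all add: mirror.entry_def mirror.exit_def entry_def exit_def mirror_has_pred mirror_has_succ mirror_pos)

lemma mirror_dir: "mirror.dir i = dir (- i)"
  by (simp add: mirror.dir_def dir_def mirror_entry mirror_exit)

lemma mirror_visited:
  assumes "z \<in> V"
  shows "mirror.visited z \<longleftrightarrow> visited z" "visited z \<Longrightarrow> mirror.idx z = - idx z"
proof -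
  have cut: "mirror.end_cut (ext i) = mirror.end_cut z \<longleftrightarrow> end_cut (ent i) = end_cut z" if "i \<in> J" for i
    using mirror_cut_eq_iff[OF ext_V[OF that] assms] ext_cut[OF that] by simp
  then show "mirror.visited z \<longleftrightarrow> visited z" unfolding mirror.visited_def visited_def by force
  show "mirror.idx z = - idx z" if "visited z"
    using mirror.idx_eq[of "- idx z" z] visited_idx[OF that] cut by simp
qed

lemma mirror_in_section: "z \<in> V \<Longrightarrow> mirror.in_section z \<longleftrightarrow> in_section z"
  using mirror_visited[of z] unfolding mirror.in_section_def in_section_def
  by (auto simp: mirror_entry mirror_exit mirror_pos closed_segment_eq_real_ivl)

end

subsection \<open>Alternating strands\<close>

locale layout = spine V SP adj sp \<tau> E
  for V SP :: "'v set" and adj sp \<tau> E +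
  fixes X :: "'v \<Rightarrow> real"
  assumes X_less: "z \<in> V \<Longrightarrow> z' \<in> V \<Longrightarrow> pos z < pos z' \<Longrightarrow> X z < X z'"
    and X_inj: "inj_on X V"
    and X_near: "z \<in> V \<Longrightarrow> \<bar>X z - pos z\<bar> \<le> 1/4"
    and X_near_end: "z \<in> V \<Longrightarrow> e \<in> E \<Longrightarrow> 3 * \<bar>X z - pos z\<bar> \<le> \<bar>pos z - e\<bar>"
begin

lemma X_eq_iff: "z \<in> V \<Longrightarrow> z' \<in> V \<Longrightarrow> X z = X z' \<longleftrightarrow> z = z'"
  using X_inj by (auto simp: inj_on_def)

lemma X_less_imp_pos: "z \<in> V \<Longrightarrow> z' \<in> V \<Longrightarrow> X z \<le> X z' \<Longrightarrow> pos z \<le> pos z'"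
  using X_less[of z' z] by force

lemma X_less_block: "z \<in> V \<Longrightarrow> z' \<in> V \<Longrightarrow> sp z \<noteq> sp z' \<Longrightarrow> pos z \<le> pos z' \<Longrightarrow> X z < X z'"
  using X_less[of z z'] pos_eq_iff[of z z'] by force

lemma X_end: "z \<in> V \<Longrightarrow> e \<in> E \<Longrightarrow> e < X z \<longleftrightarrow> e < pos z" "z \<in> V \<Longrightarrow> e \<in> E \<Longrightarrow> X z \<noteq> e"
  using X_near_end[of z e] pos_not_E[of z] by (cases "e = pos z"; auto simp: abs_if split: if_splits)+

lemma X_discrete:
  assumes t: "t \<notin> E"
  shows "\<exists>\<epsilon>>0. finite {z \<in> V. \<bar>X z - t\<bar> < \<epsilon>}"
proof -
  obtain d where d: "d > 0" "\<forall>e\<in>E. d \<le> dist t e" using separate_point_closed[OF E_closed t] by blast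
  define K where "K = {0..1} \<inter> (\<Inter>e\<in>E. {x. 3 * d / 8 \<le> \<bar>x - e\<bar>})"
  have "compact K" unfolding K_def
    by (intro compact_Int_closed compact_Icc closed_INT ballI closed_Collect_le continuous_intros)
  moreover have "K \<inter> E = {}" unfolding K_def using d by force
  ultimately have "finite {z \<in> V. pos z \<in> K}" by (rule finite_compact)
  moreover have "{z \<in> V. \<bar>X z - t\<bar> < d / 2} \<subseteq> {z \<in> V. pos z \<in> K}"
  proof
    fix z assume "z \<in> {z \<in> V. \<bar>X z - t\<bar> < d / 2}"
    then have z: "z \<in> V" "\<bar>X z - t\<bar> < d / 2" by auto
    have "3 * d / 8 \<le> \<bar>pos z - e\<bar>" if e: "e \<in> E" for e
    proof -
      have "d \<le> \<bar>t - e\<bar>" using d e by (auto simp: dist_real_def)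
      moreover have "3 * \<bar>X z - pos z\<bar> \<le> \<bar>pos z - e\<bar>" using X_near_end z e by blast
      moreover have "\<bar>t - e\<bar> \<le> \<bar>X z - t\<bar> + \<bar>X z - pos z\<bar> + \<bar>pos z - e\<bar>" by linarith
      ultimately have "d \<le> d / 2 + \<bar>pos z - e\<bar> / 3 + \<bar>pos z - e\<bar>" using z(2) by linarith
      then show ?thesis by simp
    qed
    then show "z \<in> {z \<in> V. pos z \<in> K}" using z pos_unit[OF z(1)] unfolding K_def by auto
  qed
  ultimately have "finite {z \<in> V. \<bar>X z - t\<bar> < d / 2}" by (rule rev_finite_subset)
  then show ?thesis using d by (intro exI[of _ "d / 2"]) auto
qed

definition alternates_at :: "'v set \<Rightarrow> 'v \<Rightarrow> 'v \<Rightarrow> bool" where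
  "alternates_at B s u \<longleftrightarrow>
     (s \<in> B \<and> (\<forall>b\<in>B. sp b = s \<longrightarrow> X b \<le> X s)) \<or> (u \<in> B \<and> (\<forall>b\<in>B. sp b = u \<longrightarrow> X u \<le> X b))"

lemma next_at_spine:
  assumes B: "B \<subseteq> V" "a \<in> B" "b \<in> B" "X a < X b" "\<forall>c\<in>B. \<not> (X a < X c \<and> X c < X b)"
    and sp: "sp a \<noteq> sp b"
  shows "\<lbrakk>sp a \<in> B; \<forall>c\<in>B. sp c = sp a \<longrightarrow> X c \<le> X (sp a)\<rbrakk> \<Longrightarrow> a = sp a"
    and "\<lbrakk>sp b \<in> B; \<forall>c\<in>B. sp c = sp b \<longrightarrow> X (sp b) \<le> X c\<rbrakk> \<Longrightarrow> b = sp b"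
    and "c \<in> SP \<Longrightarrow> \<tau> (sp a) < \<tau> c \<Longrightarrow> \<tau> c < \<tau> (sp b) \<Longrightarrow> c \<notin> B"
proof -
  have V: "a \<in> V" "b \<in> V" "sp a \<in> V" "sp b \<in> V" using B sp_SP SP_V by auto
  have less: "pos a < pos b" using X_less_imp_pos[OF V(1,2)] B(4) pos_eq_iff[OF V(1,2)] sp by force
  show "a = sp a" if "sp a \<in> B" "\<forall>c\<in>B. sp c = sp a \<longrightarrow> X c \<le> X (sp a)"
  proof -
    have "X a \<le> X (sp a)" using that(2) B(2) by blast
    moreover have "X (sp a) < X b" using X_less[OF V(3,2)] less pos_sp V(1) by simp
    ultimately show ?thesis using B(5) that(1) X_eq_iff[OF V(1,3)] by force
  qed
  show "b = sp b" if "sp b \<in> B" "\<forall>c\<in>B. sp c = sp b \<longrightarrow> X (sp b) \<le> X c"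
  proof -
    have "X (sp b) \<le> X b" using that(2) B(3) by blast
    moreover have "X a < X (sp b)" using X_less[OF V(1,4)] less pos_sp V(2) by simp
    ultimately show ?thesis using B(5) that(1) X_eq_iff[OF V(2,4)] by force
  qed
  show "c \<notin> B" if "c \<in> SP" "\<tau> (sp a) < \<tau> c" "\<tau> c < \<tau> (sp b)"
    using B(5) X_less[of a c] X_less[of c b] V \<tau>_sp that SP_V pos_SP[of c] by auto
qed

lemma alternating_adj_sq:
  assumes B: "B \<subseteq> V" "a \<in> B" "b \<in> B" "X a < X b" "\<forall>c\<in>B. \<not> (X a < X c \<and> X c < X b)"
    and cut: "end_cut a = end_cut b"
    and alt: "\<And>s u. consecutive s u \<Longrightarrow> pos a \<le> \<tau> s \<Longrightarrow> \<tau> u \<le> pos b \<Longrightarrow> alternates_at B s u"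
  shows "adj_sq a b"
proof (cases "sp a = sp b")
  case True
  then show ?thesis using adj_sq_block B by blast
next
  case False
  have V: "a \<in> V" "b \<in> V" using B by auto
  define s s' where "s = sp a" and "s' = sp b"
  have S: "s \<in> SP" "s' \<in> SP" "\<tau> s = pos a" "\<tau> s' = pos b" "end_cut s = end_cut s'" "sp a = s" "sp b = s'"
    using V sp_SP cut_sp cut unfolding s_def s'_def pos_def by auto
  note at_spine = next_at_spine[OF B False, unfolded S(6,7)]
  have less: "\<tau> s < \<tau> s'" using X_less_imp_pos[OF V] B(4) pos_eq_iff[OF V] False S(3,4) by force
  have eq_s': "w = s'" if "w \<in> SP" "w \<in> B" "\<tau> s < \<tau> w" "\<tau> w \<le> \<tau> s'" for w
    using at_spine(3)[of w] that inj_onD[OF \<tau>_inj, of w s'] S(2) by force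
  obtain u where u: "consecutive s u" "\<tau> u \<le> \<tau> s'" using successor_exists[OF S(1,2,5) less] by blast
  have uD: "u \<in> SP" "\<tau> s < \<tau> u" "end_cut u = end_cut s'" using consecutiveD[OF u(1)] S(5) by auto
  have "alternates_at B s u" using alt u S(3,4) by simp
  then consider "s \<in> B" "\<forall>b\<in>B. sp b = s \<longrightarrow> X b \<le> X s" "u = s'"
    | "s \<in> B" "\<forall>b\<in>B. sp b = s \<longrightarrow> X b \<le> X s" "u \<noteq> s'" | "u \<in> B" "\<forall>b\<in>B. sp b = u \<longrightarrow> X u \<le> X b"
    unfolding alternates_at_def by blast
  then show ?thesis
  proof cases
    case 1
    then have "a = s" using at_spine(1) by blast
    then show ?thesis using consecutive_adj_sq[OF u(1) V S(6)] S(1,7) 1(3) by metis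
  next
    case 2
    then have us: "\<tau> u < \<tau> s'" using u(2) uD(1) S(2) inj_onD[OF \<tau>_inj, of u s'] by force
    obtain w where w: "consecutive u w" "\<tau> w \<le> \<tau> s'" using successor_exists[OF uD(1) S(2) uD(3) us] by blast
    have "alternates_at B u w" using alt[OF w(1)] uD(2) w(2) S(3,4) by simp
    then have wB: "w \<in> B" "\<forall>b\<in>B. sp b = w \<longrightarrow> X w \<le> X b"
      using at_spine(3)[OF uD(1,2) us] unfolding alternates_at_def by blast+
    then have "w = s'" using eq_s' consecutiveD[OF w(1)] uD(2) w(2) by auto
    then have "a = s" "b = w" using at_spine(1,2) 2(1,2) wB by blast+
    then show ?thesis using consecutive_twice_adj_sq[OF u(1) w(1)] by blast
  next
    case 3
    then have "u = s'" using eq_s' uD u(2) by blast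
    moreover from this have "b = s'" using at_spine(2) 3 by blast
    ultimately show ?thesis using consecutive_adj_sq[OF u(1) V S(6)] S(2,7) by metis
  qed
qed

lemma block_minimum:
  assumes "x \<in> SP" "\<And>s. s \<in> SP \<Longrightarrow> \<tau> x \<le> \<tau> s" "B \<subseteq> V" "{b \<in> B. sp b = x} \<noteq> {}"
  shows "\<exists>b\<in>B. sp b = x \<and> (\<forall>c\<in>B. X b \<le> X c)"
proof -
  have "finite {b \<in> B. sp b = x}" using finite_block[OF assms(1)] by (rule rev_finite_subset) (use assms(3) in auto)
  then obtain b where b: "b \<in> B" "sp b = x" "\<And>c. c \<in> B \<Longrightarrow> sp c = x \<Longrightarrow> X b \<le> X c"
    using ex_is_arg_min_if_finite[OF _ assms(4), of X] unfolding is_arg_min_linorder by blast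
  have "X b \<le> X c" if c: "c \<in> B" for c
  proof (cases "sp c = x")
    case False
    then have "X b < X c" using X_less_block[of b c] assms(2,3) b(1,2) c sp_SP[of c] unfolding pos_def by auto
    then show ?thesis by simp
  qed (use b(3) c in blast)
  then show ?thesis using b(1,2) by blast
qed

lemma next_block_minimum:
  assumes "consecutive x u" "\<And>s. s \<in> SP \<Longrightarrow> \<tau> x \<le> \<tau> s" "B \<subseteq> V" "{b \<in> B. sp b = x} = {}"
    and u: "u \<in> B" "\<forall>b\<in>B. sp b = u \<longrightarrow> X u \<le> X b" and c: "c \<in> B"
  shows "X u \<le> X c"
proof (cases "sp c = u")
  case False
  have cV: "c \<in> V" "u \<in> V" using assms(3) c u(1) by auto
  have "sp c \<noteq> x" using assms(4) c by blast
  then have "\<tau> x < \<tau> (sp c)"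
    using assms(2)[OF sp_SP[OF cV(1)]] inj_onD[OF \<tau>_inj, of x "sp c"] consecutiveD[OF assms(1)] sp_SP[OF cV(1)] by force
  then have "pos u \<le> pos c"
    using not_between_consecutive[OF assms(1) sp_SP[OF cV(1)]] consecutiveD[OF assms(1)] pos_SP[of u] unfolding pos_def by auto
  then show ?thesis using X_less_block[OF cV(2,1)] False consecutiveD[OF assms(1)] sp_id[of u] by force
qed (use u c in blast)

lemma alternating_start:
  assumes x: "consecutive x u" "\<And>s. s \<in> SP \<Longrightarrow> \<tau> x \<le> \<tau> s"
    and B: "B \<subseteq> V" "B' \<subseteq> V" "B \<inter> B' = {}" "{z \<in> V. sp z = x} \<subseteq> B \<union> B'"
    and next_block: "{b \<in> B. sp b = x} = {} \<Longrightarrow> u \<in> B \<and> (\<forall>b\<in>B. sp b = u \<longrightarrow> X u \<le> X b)"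
      "{b \<in> B'. sp b = x} = {} \<Longrightarrow> u \<in> B' \<and> (\<forall>b\<in>B'. sp b = u \<longrightarrow> X u \<le> X b)"
  shows "\<exists>b\<in>B. \<exists>b'\<in>B'. adj_sq b b' \<and> (\<forall>c\<in>B. X b \<le> X c) \<and> (\<forall>c\<in>B'. X b' \<le> X c)"
proof -
  have D: "x \<in> SP" "u \<in> SP" "u \<in> V" "sp u = u" "x \<in> V" "sp x = x" using consecutiveD[OF x(1)] sp_id by auto
  have minimum: "\<exists>b\<in>S. (\<forall>c\<in>S. X b \<le> X c) \<and> (sp b = x \<or> b = u \<and> {b \<in> S. sp b = x} = {})"
    if S: "S \<subseteq> V" "{b \<in> S. sp b = x} = {} \<Longrightarrow> u \<in> S \<and> (\<forall>b\<in>S. sp b = u \<longrightarrow> X u \<le> X b)" for S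
  proof (cases "{b \<in> S. sp b = x} = {}")
    case True
    then show ?thesis using next_block_minimum[OF x S(1) True] S(2) by blast
  next
    case False
    then show ?thesis using block_minimum[OF D(1) x(2) S(1)] by blast
  qed
  obtain b where b: "b \<in> B" "\<forall>c\<in>B. X b \<le> X c" "sp b = x \<or> b = u \<and> {b \<in> B. sp b = x} = {}"
    using minimum[OF B(1) next_block(1)] by blast
  obtain b' where b': "b' \<in> B'" "\<forall>c\<in>B'. X b' \<le> X c" "sp b' = x \<or> b' = u \<and> {b \<in> B'. sp b = x} = {}"
    using minimum[OF B(2) next_block(2)] by blast
  have V: "b \<in> V" "b' \<in> V" "b \<noteq> b'" using b(1) b'(1) B by auto
  have "\<not> ({b \<in> B. sp b = x} = {} \<and> {b \<in> B'. sp b = x} = {})" using B(4) D(5,6) by blast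
  then consider "sp b = x" "sp b' = x" | "sp b = x" "b' = u" | "b = u" "sp b' = x" using b(3) b'(3) by blast
  then have "adj_sq b b'"
  proof cases
    case 1
    then show ?thesis using adj_sq_block V by simp
  next
    case 2
    then show ?thesis using consecutive_adj_sq[OF x(1) V(1,2)] D(2,4) by simp
  next
    case 3
    then show ?thesis using consecutive_adj_sq[OF x(1) V(2,1)] D(2,4) adj_sq_sym by simp
  qed
  then show ?thesis using b b' by blast
qed

lemma alternating_near_end:
  assumes "e \<in> E" "e < t" "e < 1" "\<forall>e'\<in>E. \<not> (e < e' \<and> e' < t)"
    and "\<And>s u. consecutive s u \<Longrightarrow> e < \<tau> s \<Longrightarrow> \<tau> u < t \<Longrightarrow> alternates_at B s u"
  shows "\<exists>b\<in>B. b \<in> SP \<and> e < \<tau> b \<and> \<tau> b < t"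
proof -
  obtain s u where su: "consecutive s u" "e < \<tau> s" "\<tau> u < t" using spine_right_of_end[OF assms(1-4)] by blast
  then have "s \<in> B \<or> u \<in> B" using assms(5) unfolding alternates_at_def by blast
  then show ?thesis using su consecutiveD[OF su(1)] by (meson less_trans)
qed

lemma mirror_layout: "layout V SP adj sp (\<lambda>s. 1 - \<tau> s) ((\<lambda>e. 1 - e) ` E) (\<lambda>z. 1 - X z)"
proof -
  interpret mirror: spine V SP adj sp "\<lambda>s. 1 - \<tau> s" "(\<lambda>e. 1 - e) ` E" by (rule mirror)
  show ?thesis
  proof
    show "1 - X z < 1 - X z'" if "z \<in> V" "z' \<in> V" "mirror.pos z < mirror.pos z'" for z z'
      using X_less[of z' z] that by (simp add: mirror_pos)
    show "inj_on (\<lambda>z. 1 - X z) V" using X_inj by (simp add: inj_on_def)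
    show "\<bar>1 - X z - mirror.pos z\<bar> \<le> 1/4" if "z \<in> V" for z
      using X_near[OF that] by (simp add: mirror_pos abs_minus_commute)
    show "3 * \<bar>1 - X z - mirror.pos z\<bar> \<le> \<bar>mirror.pos z - e\<bar>" if z: "z \<in> V" "e \<in> (\<lambda>e. 1 - e) ` E" for z e
    proof -
      have "3 * \<bar>X z - pos z\<bar> \<le> \<bar>pos z - (1 - e)\<bar>" using X_near_end[OF z(1), of "1 - e"] z(2) by force
      then show ?thesis by (simp add: mirror_pos abs_minus_commute algebra_simps)
    qed
  qed
qed

interpretation mirror: layout V SP adj sp "\<lambda>s. 1 - \<tau> s" "(\<lambda>e. 1 - e) ` E" "\<lambda>z. 1 - X z"
  by (rule mirror_layout)

lemma mirror_alternates_at: "mirror.alternates_at B s u \<longleftrightarrow> alternates_at B u s"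
  unfolding mirror.alternates_at_def alternates_at_def by auto

end

subsection \<open>Indexing a strand by the integers\<close>

lemma int_set_unbounded_below:
  fixes J :: "int set"
  assumes "J \<noteq> {}" "\<forall>i\<in>J. \<exists>j\<in>J. j < i"
  shows "\<exists>j\<in>J. j < N"
proof (rule ccontr)
  assume "\<not> ?thesis"
  then have bound: "\<forall>j\<in>J. N \<le> j" by auto
  obtain j where "j \<in> J" using assms(1) by blast
  then obtain i where i: "i \<in> J" "\<forall>j. j \<in> J \<longrightarrow> nat (i - N) \<le> nat (j - N)"
    using ex_has_least_nat[of "\<lambda>i. i \<in> J" j "\<lambda>i. nat (i - N)"] by blast
  then obtain j where "j \<in> J" "j < i" using assms(2) by blast
  then show False using i bound by force
qed

lemma int_index_exists:
  fixes less :: "'a \<Rightarrow> 'a \<Rightarrow> bool"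
  assumes irrefl: "\<And>a. \<not> less a a" and trans: "\<And>a b c. less a b \<Longrightarrow> less b c \<Longrightarrow> less a c"
    and total: "\<And>a b. a \<in> K \<Longrightarrow> b \<in> K \<Longrightarrow> a = b \<or> less a b \<or> less b a"
    and interval: "\<And>a b. a \<in> K \<Longrightarrow> b \<in> K \<Longrightarrow> finite {c \<in> K. less a c \<and> less c b}"
  shows "\<exists>\<nu> :: 'a \<Rightarrow> int. \<forall>a\<in>K. \<forall>b\<in>K. less a b \<longleftrightarrow> \<nu> a < \<nu> b"
proof (cases "K = {}")
  case False
  then obtain k where k: "k \<in> K" by blast
  define above where "above a = {c \<in> K. \<not> less c k \<and> less c a}" for a
  define below where "below a = {c \<in> K. \<not> less c a \<and> less c k}" for a
  define \<nu> where "\<nu> a = int (card (above a)) - int (card (below a))" for a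
  have fin: "finite {c \<in> K. \<not> less c a \<and> less c b}" if "a \<in> K" "b \<in> K" for a b
  proof (rule finite_subset)
    show "{c \<in> K. \<not> less c a \<and> less c b} \<subseteq> insert a {c \<in> K. less a c \<and> less c b}" using total that by blast
  qed (use interval that in simp)
  have mono: "\<nu> a < \<nu> b" if ab: "a \<in> K" "b \<in> K" "less a b" for a b
  proof -
    have sub: "above a \<subseteq> above b" "below b \<subseteq> below a"
      unfolding above_def below_def using trans ab by blast+
    have f: "finite (above b)" "finite (below a)"
      unfolding above_def below_def using fin k ab by blast+
    have "a \<in> above b \<and> a \<notin> above a \<or> a \<in> below a \<and> a \<notin> below b"
      unfolding above_def below_def using ab irrefl by blast
    then have "card (above a) < card (above b) \<or> card (below b) < card (below a)"
      using psubset_card_mono f sub by blast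
    moreover have "card (above a) \<le> card (above b)" "card (below b) \<le> card (below a)"
      using card_mono f sub by blast+
    ultimately show ?thesis unfolding \<nu>_def by linarith
  qed
  have "less a b \<longleftrightarrow> \<nu> a < \<nu> b" if "a \<in> K" "b \<in> K" for a b
    using mono[OF that] mono[OF that(2,1)] total[OF that] by force
  then show ?thesis by blast
qed simp

definition squash :: "int \<Rightarrow> real" where
  "squash n = (if n < 0 then 1 / (2 * (1 - real_of_int n)) else 1 - 1 / (2 * (1 + real_of_int n)))"

lemma squash_uminus: "squash (- n) = 1 - squash n"
  unfolding squash_def by (auto simp: field_simps)

lemma squash_range: "0 < squash n" "squash n < 1"
  unfolding squash_def by (auto simp: field_simps)

lemma squash_mono:
  assumes "m < n"
  shows "squash m < squash n"
proof -
  have neg: "squash k < 1/2" if "k < 0" for k using that unfolding squash_def by (simp add: field_simps)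
  have nonneg: "1/2 \<le> squash k" if "\<not> k < 0" for k using that unfolding squash_def by (simp add: field_simps)
  consider "n < 0" | "\<not> m < 0" | "m < 0" "\<not> n < 0" by linarith
  then show ?thesis
  proof cases
    case 3
    then show ?thesis using neg[of m] nonneg[of n] by linarith
  qed (use assms in \<open>simp_all add: squash_def field_simps\<close>)
qed

lemma squash_less_iff: "squash m < squash n \<longleftrightarrow> m < n"
  using squash_mono[of m n] squash_mono[of n m] by (cases m n rule: linorder_cases) auto

lemma squash_near_1:
  assumes "0 < \<epsilon>"
  shows "\<exists>N. \<forall>n>N. 1 - \<epsilon> < squash n"
proof -
  obtain N :: nat where N: "1 / \<epsilon> < real N" using reals_Archimedean2 by blast
  have "1 - \<epsilon> < squash n" if n: "int N < n" for n
  proof -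
    have "real N < real_of_int n" using n by linarith
    then have "1 / \<epsilon> < 2 + 2 * real_of_int n" using N of_nat_0_le_iff[of N, where ?'a = real] by linarith
    then show ?thesis using n assms unfolding squash_def by (auto simp: field_simps)
  qed
  then show ?thesis by blast
qed

lemma squash_discrete:
  assumes "t \<noteq> 0" "t \<noteq> 1"
  shows "\<exists>\<epsilon>>0. finite {n. \<bar>squash n - t\<bar> < \<epsilon>}"
proof -
  define \<epsilon> where "\<epsilon> = min \<bar>t\<bar> \<bar>t - 1\<bar> / 2"
  have \<epsilon>: "0 < \<epsilon>" "2 * \<epsilon> \<le> \<bar>t\<bar>" "2 * \<epsilon> \<le> \<bar>t - 1\<bar>" unfolding \<epsilon>_def using assms by auto
  then obtain N where N: "\<forall>n>N. 1 - \<epsilon> < squash n" using squash_near_1 by blast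
  have "n \<in> {- N..N}" if "\<bar>squash n - t\<bar> < \<epsilon>" for n
  proof (rule ccontr)
    assume "n \<notin> {- N..N}"
    then have "1 - \<epsilon> < squash n \<or> 1 - \<epsilon> < squash (- n)" using N by force
    then have "1 - \<epsilon> < squash n \<or> squash n < \<epsilon>" unfolding squash_uminus by argo
    then show False using that \<epsilon>(2,3) squash_range[of n] by argo
  qed
  then have "{n. \<bar>squash n - t\<bar> < \<epsilon>} \<subseteq> {- N..N}" by blast
  then have "finite {n. \<bar>squash n - t\<bar> < \<epsilon>}" by (rule finite_subset) simp
  then show ?thesis using \<epsilon>(1) by blast
qed

subsection \<open>Pairs of strands\<close>

text \<open>A strand visits the vertices of \<open>B\<close> at the positions \<open>f\<close> and the ends in \<open>L\<close> where they lie.\<close>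

locale strand = spine V SP adj sp \<tau> E
  for V SP :: "'v set" and adj sp \<tau> E +
  fixes B :: "'v set" and f :: "'v \<Rightarrow> real" and L :: "real set"
  assumes strand_V: "B \<subseteq> V" and strand_L: "L \<subseteq> E" "closed L"
    and strand_inj: "inj_on f B" and strand_not_L: "b \<in> B \<Longrightarrow> f b \<notin> L"
    and strand_bounded: "bounded (f ` B)"
    and strand_discrete: "t \<notin> L \<Longrightarrow> \<exists>\<epsilon>>0. finite {b \<in> B. \<bar>f b - t\<bar> < \<epsilon>}"
    and strand_limit: "e \<in> L \<Longrightarrow> 0 < \<delta> \<Longrightarrow> \<exists>\<eta>>0. \<forall>b\<in>B. \<bar>f b - e\<bar> < \<eta> \<longrightarrow> \<bar>pos b - e\<bar> < \<delta>"
    and strand_consecutive: "s \<in> f ` B \<union> L \<Longrightarrow> t \<in> f ` B \<union> L \<Longrightarrow> s < t \<Longrightarrow> {s<..<t} \<inter> (f ` B \<union> L) = {} \<Longrightarrow>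
      \<exists>a\<in>B. \<exists>b\<in>B. s = f a \<and> t = f b \<and> adj_sq a b"

locale strand_pair = spine V SP adj sp \<tau> E + A: strand V SP adj sp \<tau> E A f E + Q: strand V SP adj sp \<tau> E Q g "E \<inter> {0, 1}"
  for V SP :: "'v set" and adj sp \<tau> E A f Q g +
  fixes a\<^sub>1 b\<^sub>1 a\<^sub>2 b\<^sub>2 :: real
  assumes partition: "A \<union> Q = V" "A \<inter> Q = {}"
    and ends_in: "a\<^sub>1 \<in> f ` A \<union> E" "b\<^sub>1 \<in> f ` A \<union> E" "a\<^sub>2 \<in> g ` Q \<union> E \<inter> {0, 1}" "b\<^sub>2 \<in> g ` Q \<union> E \<inter> {0, 1}"
    and within: "f ` A \<union> E \<subseteq> {a\<^sub>1..b\<^sub>1}" "g ` Q \<union> E \<inter> {0, 1} \<subseteq> {a\<^sub>2..b\<^sub>2}"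
    and start: "if 0 \<in> E then a\<^sub>1 = 0 \<and> a\<^sub>2 = 0 else \<exists>a\<in>A. \<exists>q\<in>Q. a\<^sub>1 = f a \<and> a\<^sub>2 = g q \<and> adj_sq a q"
    and finish: "if 1 \<in> E then b\<^sub>1 = 1 \<and> b\<^sub>2 = 1 else \<exists>a\<in>A. \<exists>q\<in>Q. b\<^sub>1 = f a \<and> b\<^sub>2 = g q \<and> adj_sq a q"

context layout
begin

lemma alternating_right_of_end:
  assumes B: "B \<subseteq> V" and alt: "\<And>s u. consecutive s u \<Longrightarrow> alternates_at B s u"
    and e: "e \<in> E" and x: "x \<in> X ` B \<union> E" "e < x"
  shows "\<exists>y\<in>X ` B \<union> E. e < y \<and> y < x"
proof (rule ccontr)
  assume none: "\<not> ?thesis"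
  define t where "t = (if x \<in> E then x else pos (inv_into B X x))"
  have c: "inv_into B X x \<in> B" "X (inv_into B X x) = x" if "x \<notin> E"
    using x that inv_into_into[of x X B] f_inv_into_f[of x X B] by auto
  have t: "e < t" "t \<le> 1" "\<And>e'. e' \<in> E \<Longrightarrow> e' < t \<longleftrightarrow> e' < x"
    using x(2) c X_end(1)[of "inv_into B X x"] pos_unit[of "inv_into B X x"] B e E_range unfolding t_def by auto
  have "e < 1" "\<forall>e'\<in>E. \<not> (e < e' \<and> e' < t)" using t none by auto
  then have "\<exists>b\<in>B. b \<in> SP \<and> e < \<tau> b \<and> \<tau> b < t" using alternating_near_end[OF e t(1)] alt by blast
  then obtain b where b: "b \<in> B" "e < pos b" "pos b < t" using pos_SP by auto
  have "e < X b" using X_end(1) b B e by blast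
  moreover have "X b < x"
  proof (cases "x \<in> E")
    case True
    then show ?thesis using X_end[of b x] b B unfolding t_def by force
  next
    case False
    then show ?thesis using X_less[of b "inv_into B X x"] c b B unfolding t_def by auto
  qed
  ultimately show False using none b(1) by blast
qed

end

context layout
begin

interpretation mirror: layout V SP adj sp "\<lambda>s. 1 - \<tau> s" "(\<lambda>e. 1 - e) ` E" "\<lambda>z. 1 - X z"
  by (rule mirror_layout)

lemma alternating_left_of_end:
  assumes B: "B \<subseteq> V" and alt: "\<And>s u. consecutive s u \<Longrightarrow> alternates_at B s u"
    and e: "e \<in> E" and x: "x \<in> X ` B \<union> E" "x < e"
  shows "\<exists>y\<in>X ` B \<union> E. x < y \<and> y < e"
proof -
  have image: "(\<lambda>z. 1 - X z) ` B \<union> (\<lambda>e. 1 - e) ` E = (\<lambda>y. 1 - y) ` (X ` B \<union> E)" by auto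
  have "\<exists>y\<in>(\<lambda>y. 1 - y) ` (X ` B \<union> E). 1 - e < y \<and> y < 1 - x"
    unfolding image[symmetric]
  proof (rule mirror.alternating_right_of_end[OF B])
    show "mirror.alternates_at B s u" if "mirror.consecutive s u" for s u
      using alt that by (simp add: mirror_consecutive mirror_alternates_at)
  qed (use e x image in auto)
  then show ?thesis by auto
qed

lemma alternating_strand:
  assumes B: "B \<subseteq> V" and alt: "\<And>s u. consecutive s u \<Longrightarrow> alternates_at B s u"
  shows "strand V SP adj sp \<tau> E B X E"
proof
  show "inj_on X B" using X_inj B by (rule inj_on_subset)
  show "X b \<notin> E" if "b \<in> B" for b using X_end(2) that B by blast
  have "\<bar>X b\<bar> \<le> 2" if "b \<in> B" for b
    using X_near[OF subsetD[OF B that]] pos_unit[OF subsetD[OF B that]] by linarith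
  then show "bounded (X ` B)" by (auto simp: bounded_iff)
  show "\<exists>\<epsilon>>0. finite {b \<in> B. \<bar>X b - t\<bar> < \<epsilon>}" if t: "t \<notin> E" for t
  proof -
    obtain \<epsilon> where "\<epsilon> > 0" "finite {z \<in> V. \<bar>X z - t\<bar> < \<epsilon>}" using X_discrete[OF t] by blast
    then show ?thesis by (intro exI[of _ \<epsilon>]) (auto elim!: rev_finite_subset intro: subsetD[OF B])
  qed
  show "\<exists>\<eta>>0. \<forall>b\<in>B. \<bar>X b - e\<bar> < \<eta> \<longrightarrow> \<bar>pos b - e\<bar> < \<delta>" if e: "e \<in> E" "0 < \<delta>" for e \<delta>
  proof (intro exI[of _ "\<delta> / 2"] conjI ballI impI)
    fix b assume b: "b \<in> B" "\<bar>X b - e\<bar> < \<delta> / 2"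
    have "3 * \<bar>X b - pos b\<bar> \<le> \<bar>pos b - e\<bar>" using X_near_end b B e by blast
    then have "2 * \<bar>pos b - e\<bar> \<le> 3 * \<bar>X b - e\<bar>" by argo
    then show "\<bar>pos b - e\<bar> < \<delta>" using b(2) e(2) by simp
  qed (use e in simp)
  show "\<exists>a\<in>B. \<exists>b\<in>B. s = X a \<and> t = X b \<and> adj_sq a b"
    if st: "s \<in> X ` B \<union> E" "t \<in> X ` B \<union> E" "s < t" "{s<..<t} \<inter> (X ` B \<union> E) = {}" for s t
  proof -
    have none: "\<not> (s < y \<and> y < t)" if "y \<in> X ` B \<union> E" for y using st(4) that by auto
    have "s \<notin> E" using alternating_right_of_end[OF B alt _ st(2,3)] none by blast
    moreover have "t \<notin> E" using alternating_left_of_end[OF B alt _ st(1,3)] none by blast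
    ultimately obtain a b where ab: "a \<in> B" "s = X a" "b \<in> B" "t = X b" using st(1,2) by blast
    have V: "a \<in> V" "b \<in> V" using ab B by auto
    have "end_cut a = end_cut b" unfolding cut_eq_iff
    proof
      fix e assume e: "e \<in> E"
      then show "e < pos a \<longleftrightarrow> e < pos b"
        using none[of e] X_end[OF V(1) e] X_end[OF V(2) e] ab st(3) by auto
    qed
    then have "adj_sq a b" by (intro alternating_adj_sq[of B]) (use ab B st(3) none alt in auto)
    then show ?thesis using ab by blast
  qed
qed (use B E_closed in auto)

end

locale int_indexed = spine V SP adj sp \<tau> E
  for V SP :: "'v set" and adj sp \<tau> E +
  fixes Q :: "'v set" and \<nu> :: "'v \<Rightarrow> int"
  assumes Q_V: "Q \<subseteq> V" and \<nu>_inj: "inj_on \<nu> Q"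
    and \<nu>_adj: "a \<in> Q \<Longrightarrow> b \<in> Q \<Longrightarrow> \<nu> a < \<nu> b \<Longrightarrow> \<forall>c\<in>Q. \<not> (\<nu> a < \<nu> c \<and> \<nu> c < \<nu> b) \<Longrightarrow> adj_sq a b"
    and below: "0 \<in> E \<Longrightarrow> 0 < \<delta> \<Longrightarrow> \<exists>q\<in>Q. \<forall>c\<in>Q. \<nu> c \<le> \<nu> q \<longrightarrow> pos c < \<delta>"
    and above: "1 \<in> E \<Longrightarrow> 0 < \<delta> \<Longrightarrow> \<exists>q\<in>Q. \<forall>c\<in>Q. \<nu> q \<le> \<nu> c \<longrightarrow> 1 - pos c < \<delta>"
    and least: "0 \<notin> E \<Longrightarrow> \<exists>q\<in>Q. \<forall>c\<in>Q. \<nu> q \<le> \<nu> c"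
    and greatest: "1 \<notin> E \<Longrightarrow> \<exists>q\<in>Q. \<forall>c\<in>Q. \<nu> c \<le> \<nu> q"
begin

definition place :: "'v \<Rightarrow> real" where "place q = squash (\<nu> q)"

lemma place_range: "0 < place q" "place q < 1"
  unfolding place_def by (rule squash_range)+

lemma place_less_iff: "place a < place b \<longleftrightarrow> \<nu> a < \<nu> b"
  unfolding place_def by (rule squash_less_iff)

lemma place_le_iff: "place a \<le> place b \<longleftrightarrow> \<nu> a \<le> \<nu> b"
  using place_less_iff[of b a] by linarith

lemma place_inj: "inj_on place Q"
proof -
  have "inj_on squash (\<nu> ` Q)" using squash_mono by (intro linorder_inj_onI') (metis less_irrefl)
  then show ?thesis using comp_inj_on[OF \<nu>_inj] unfolding place_def comp_def by blast
qed

lemma place_discrete: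
  assumes "t \<notin> E \<inter> {0, 1}"
  shows "\<exists>\<epsilon>>0. finite {q \<in> Q. \<bar>place q - t\<bar> < \<epsilon>}"
proof -
  consider "t = 0" "0 \<notin> E" | "t = 1" "1 \<notin> E" | "t \<noteq> 0" "t \<noteq> 1" using assms by blast
  then show ?thesis
  proof cases
    case 1
    then obtain q where "q \<in> Q" "\<forall>c\<in>Q. place q \<le> place c" using least place_le_iff by blast
    then have "{c \<in> Q. \<bar>place c - t\<bar> < place q} = {}" using 1 by force
    then show ?thesis using place_range(1)[of q] by (metis finite.emptyI)
  next
    case 2
    then obtain q where "q \<in> Q" "\<forall>c\<in>Q. place c \<le> place q" using greatest place_le_iff by blast
    then have "{c \<in> Q. \<bar>place c - t\<bar> < 1 - place q} = {}" using 2 by force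
    then show ?thesis using place_range(2)[of q] by (metis diff_gt_0_iff_gt finite.emptyI)
  next
    case 3
    then obtain \<epsilon> where \<epsilon>: "\<epsilon> > 0" "finite {n. \<bar>squash n - t\<bar> < \<epsilon>}" using squash_discrete by blast
    have "{q \<in> Q. \<bar>place q - t\<bar> < \<epsilon>} = \<nu> -` {n. \<bar>squash n - t\<bar> < \<epsilon>} \<inter> Q" unfolding place_def by auto
    then show ?thesis using finite_vimage_IntI[OF \<epsilon>(2) \<nu>_inj] \<epsilon>(1) by auto
  qed
qed

lemma place_limit:
  assumes e: "e \<in> E \<inter> {0, 1}" and \<delta>: "0 < \<delta>"
  shows "\<exists>\<eta>>0. \<forall>q\<in>Q. \<bar>place q - e\<bar> < \<eta> \<longrightarrow> \<bar>pos q - e\<bar> < \<delta>"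
proof -
  have unit: "0 \<le> pos q" "pos q \<le> 1" if "q \<in> Q" for q using pos_unit that Q_V by auto
  consider "e = 0" "0 \<in> E" | "e = 1" "1 \<in> E" using e by blast
  then show ?thesis
  proof cases
    case 1
    then obtain q where q: "\<forall>c\<in>Q. place c \<le> place q \<longrightarrow> pos c < \<delta>" using below \<delta> place_le_iff by blast
    show ?thesis
    proof (intro exI[of _ "place q"] conjI ballI impI)
      show "\<bar>pos c - e\<bar> < \<delta>" if "c \<in> Q" "\<bar>place c - e\<bar> < place q" for c
        using q that unit(1)[OF that(1)] 1(1) by simp
    qed (rule place_range)
  next
    case 2
    then obtain q where q: "\<forall>c\<in>Q. place q \<le> place c \<longrightarrow> 1 - pos c < \<delta>" using above \<delta> place_le_iff by blast
    show ?thesis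
    proof (intro exI[of _ "1 - place q"] conjI ballI impI)
      show "\<bar>pos c - e\<bar> < \<delta>" if "c \<in> Q" "\<bar>place c - e\<bar> < 1 - place q" for c
      proof -
        have "place q \<le> place c" using that(2) 2(1) by linarith
        then show ?thesis using q that(1) unit(2)[OF that(1)] 2(1) by simp
      qed
    qed (use place_range in simp)
  qed
qed

lemma no_least_place:
  assumes E: "0 \<in> E" and q: "q \<in> Q"
  shows "\<exists>c\<in>Q. place c < place q"
proof -
  have "0 < pos q" using pos_unit[of q] pos_not_E[of q] E q Q_V by (auto simp: order_le_less)
  then obtain c where "c \<in> Q" "\<not> \<nu> q \<le> \<nu> c" using below[OF E] q by (metis less_irrefl)
  then show ?thesis using place_less_iff by (metis not_le)
qed

lemma no_greatest_place:
  assumes E: "1 \<in> E" and q: "q \<in> Q"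
  shows "\<exists>c\<in>Q. place q < place c"
proof -
  have "pos q < 1" using pos_unit[of q] pos_not_E[of q] E q Q_V by (auto simp: order_le_less)
  then obtain c where "c \<in> Q" "\<not> \<nu> c \<le> \<nu> q"
    using above[OF E, of "1 - pos q"] q by (metis diff_gt_0_iff_gt less_irrefl)
  then show ?thesis using place_less_iff by (metis not_le)
qed

lemma Q_nonempty: "\<exists>q. q \<in> Q"
  using least below[of 1] by (cases "0 \<in> E") auto

lemma place_consecutive:
  assumes st: "s \<in> place ` Q \<union> E \<inter> {0, 1}" "t \<in> place ` Q \<union> E \<inter> {0, 1}" "s < t"
    and gap: "{s<..<t} \<inter> (place ` Q \<union> E \<inter> {0, 1}) = {}"
  shows "\<exists>a\<in>Q. \<exists>b\<in>Q. s = place a \<and> t = place b \<and> adj_sq a b"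
proof -
  have none: "\<not> (s < place q \<and> place q < t)" if "q \<in> Q" for q
    using equals0D[OF gap, of "place q"] that by simp
  have unit: "0 \<le> z \<and> z \<le> 1" if "z \<in> place ` Q \<union> E \<inter> {0, 1}" for z
    using that place_range less_imp_le by auto
  have "s \<in> place ` Q"
  proof (rule ccontr)
    assume "s \<notin> place ` Q"
    then have s: "s = 0" "0 \<in> E" using st(1,3) unit[OF st(2)] by auto
    then have "\<exists>q\<in>Q. place q < t" using st(2,3) no_least_place[OF s(2)] Q_nonempty place_range by auto
    then show False using none s place_range by auto
  qed
  moreover have "t \<in> place ` Q"
  proof (rule ccontr)
    assume "t \<notin> place ` Q"
    then have t: "t = 1" "1 \<in> E" using st(2,3) unit[OF st(1)] by auto
    then have "\<exists>q\<in>Q. s < place q" using calculation no_greatest_place[OF t(2)] by auto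
    then show False using none t place_range by auto
  qed
  ultimately obtain a b where ab: "a \<in> Q" "s = place a" "b \<in> Q" "t = place b" by blast
  then have "adj_sq a b" using \<nu>_adj[OF ab(1,3)] st(3) none place_less_iff by auto
  then show ?thesis using ab by blast
qed

lemma strand: "strand V SP adj sp \<tau> E Q place (E \<inter> {0, 1})"
proof
  show "place q \<notin> E \<inter> {0, 1}" for q using place_range[of q] by auto
  show "bounded (place ` Q)"
    by (intro boundedI[of _ 1]) (auto simp: abs_of_pos[OF place_range(1)] less_imp_le[OF place_range(2)])
  show "E \<inter> {0, 1} \<subseteq> E" "closed (E \<inter> {0, 1})" using E_closed by (auto intro: closed_Int)
qed (fact Q_V place_inj place_discrete place_limit place_consecutive)+

end

context layout
begin

lemma alternating_before_first_end:
  assumes B: "B \<subseteq> V" and alt: "\<And>s u. consecutive s u \<Longrightarrow> alternates_at B s u" and E: "0 \<notin> E" "e \<in> E"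
  shows "\<exists>b\<in>B. X b < e"
proof -
  have "compact E" using E_closed E_unit by (metis bounded_closed_interval bounded_subset compact_eq_bounded_closed)
  then obtain m where m: "m \<in> E" "\<forall>e\<in>E. m \<le> e" using compact_attains_inf[of E] E(2) by blast
  have "0 < m" using m E(1) E_range[OF m(1)] by (cases "m = 0") auto
  then obtain s u where su: "consecutive s u" "\<tau> u < m" using spine_left_of_end[OF m(1), of 0] m(2) by force
  then obtain b where b: "b \<in> B" "pos b < m"
    using alt[OF su(1)] consecutiveD[OF su(1)] pos_SP unfolding alternates_at_def by force
  then have "X b < m" using X_end[of b m] B m(1) by force
  then show ?thesis using b(1) m(2) E(2) by force
qed

end

context layout
begin

interpretation mirror: layout V SP adj sp "\<lambda>s. 1 - \<tau> s" "(\<lambda>e. 1 - e) ` E" "\<lambda>z. 1 - X z"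
  by (rule mirror_layout)

lemma alternating_after_last_end:
  assumes B: "B \<subseteq> V" and alt: "\<And>s u. consecutive s u \<Longrightarrow> alternates_at B s u" and E: "1 \<notin> E" "e \<in> E"
  shows "\<exists>b\<in>B. e < X b"
proof -
  have "\<exists>b\<in>B. 1 - X b < 1 - e"
    by (rule mirror.alternating_before_first_end[OF B])
      (use alt E in \<open>auto simp: mirror_consecutive mirror_alternates_at\<close>)
  then show ?thesis by simp
qed

end

subsection \<open>Splitting the vertices into two strands\<close>

text \<open>The first strand \<open>A\<close> runs through the whole interval from left to right. The second strand \<open>Q\<close>
  runs through the sections one after the other, each in its own direction.\<close>

locale stranding = routed V SP adj sp \<tau> E J ent ext + layout V SP adj sp \<tau> E X
  for V SP :: "'v set" and adj sp \<tau> E J ent ext X +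
  fixes A Q :: "'v set"
  assumes partition: "A \<union> Q = V" "A \<inter> Q = {}"
    and Q_section: "q \<in> Q \<Longrightarrow> in_section q"
    and Q_spine: "i \<in> J \<Longrightarrow> \<exists>q\<in>Q. q \<in> SP \<and> idx q = i"
    and A_alternates: "consecutive s u \<Longrightarrow> alternates_at A s u"
    and Q_alternates: "consecutive s u \<Longrightarrow> in_section s \<Longrightarrow> in_section u \<Longrightarrow> alternates_at Q s u"
    and Q_bridge: "i \<in> J \<Longrightarrow> j \<in> J \<Longrightarrow> i < j \<Longrightarrow> \<forall>k\<in>J. \<not> (i < k \<and> k < j) \<Longrightarrow>
      a \<in> Q \<Longrightarrow> idx a = i \<Longrightarrow> \<forall>c\<in>Q. idx c = i \<longrightarrow> dir i * X c \<le> dir i * X a \<Longrightarrow>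
      b \<in> Q \<Longrightarrow> idx b = j \<Longrightarrow> \<forall>c\<in>Q. idx c = j \<longrightarrow> dir j * X b \<le> dir j * X c \<Longrightarrow> adj_sq a b"
begin

definition precedes :: "'v \<Rightarrow> 'v \<Rightarrow> bool" where
  "precedes a b \<longleftrightarrow> idx a < idx b \<or> idx a = idx b \<and> dir (idx a) * X a < dir (idx a) * X b"

lemma A_V: "A \<subseteq> V" and Q_V: "Q \<subseteq> V"
  using partition by auto

lemma Q_idx: "q \<in> Q \<Longrightarrow> idx q \<in> J"
  using Q_section in_section_idx by blast

lemma precedes_idx: "precedes a b \<Longrightarrow> idx a \<le> idx b"
  unfolding precedes_def by auto

lemma precedes_irrefl: "\<not> precedes a a"
  unfolding precedes_def by auto

lemma precedes_trans: "precedes a b \<Longrightarrow> precedes b c \<Longrightarrow> precedes a c"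
  unfolding precedes_def by auto

lemma precedes_total:
  assumes "a \<in> Q" "b \<in> Q"
  shows "a = b \<or> precedes a b \<or> precedes b a"
proof -
  have "X a = X b \<longleftrightarrow> a = b" using X_eq_iff assms Q_V by blast
  then have "dir (idx a) * X a = dir (idx a) * X b \<longleftrightarrow> a = b" using dir_cases[of "idx a"] by auto
  then show ?thesis unfolding precedes_def by (metis linorder_neqE)
qed

lemma precedes_pos:
  assumes "a \<in> V" "b \<in> V" "idx a = idx b" "precedes a b"
  shows "dir (idx a) * pos a \<le> dir (idx a) * pos b"
  using dir_cases[of "idx a"] X_less_imp_pos[of a b] X_less_imp_pos[of b a] assms unfolding precedes_def by auto

lemma mirror_stranding: "stranding V SP adj sp (\<lambda>s. 1 - \<tau> s) ((\<lambda>e. 1 - e) ` E)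
  (uminus ` J) (\<lambda>i. ext (- i)) (\<lambda>i. ent (- i)) (\<lambda>z. 1 - X z) A Q"
proof -
  interpret mirror: routed V SP adj sp "\<lambda>s. 1 - \<tau> s" "(\<lambda>e. 1 - e) ` E" "uminus ` J" "\<lambda>i. ext (- i)" "\<lambda>i. ent (- i)"
    by (rule mirror_routed)
  interpret mirror: layout V SP adj sp "\<lambda>s. 1 - \<tau> s" "(\<lambda>e. 1 - e) ` E" "\<lambda>z. 1 - X z"
    by (rule mirror_layout)
  have idx: "mirror.idx q = - idx q" if "q \<in> Q" for q
    using that Q_V Q_section mirror_visited(2)[of q] unfolding in_section_def by blast
  have sect: "mirror.in_section z \<longleftrightarrow> in_section z" if "z \<in> V" for z by (rule mirror_in_section[OF that])
  have flip: "d * (1 - x) \<le> d * (1 - y) \<longleftrightarrow> d * y \<le> d * x" for d x y :: real by (simp add: right_diff_distrib)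
  show ?thesis
  proof
    show "mirror.in_section q" if "q \<in> Q" for q using that Q_V Q_section sect by blast
    show "\<exists>q\<in>Q. q \<in> SP \<and> mirror.idx q = i" if "i \<in> uminus ` J" for i
      using that Q_spine idx by force
    show "mirror.alternates_at A s u" if "mirror.consecutive s u" for s u
      using A_alternates that by (simp add: mirror_consecutive mirror_alternates_at)
    show "mirror.alternates_at Q s u" if "mirror.consecutive s u" "mirror.in_section s" "mirror.in_section u" for s u
      using Q_alternates that consecutiveD[of u s] sect by (simp add: mirror_consecutive mirror_alternates_at)
    show "adj_sq a b"
      if ij: "i \<in> uminus ` J" "j \<in> uminus ` J" "i < j" "\<forall>k\<in>uminus ` J. \<not> (i < k \<and> k < j)"
        and a: "a \<in> Q" "mirror.idx a = i" "\<forall>c\<in>Q. mirror.idx c = i \<longrightarrow> mirror.dir i * (1 - X c) \<le> mirror.dir i * (1 - X a)"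
        and b: "b \<in> Q" "mirror.idx b = j" "\<forall>c\<in>Q. mirror.idx c = j \<longrightarrow> mirror.dir j * (1 - X b) \<le> mirror.dir j * (1 - X c)"
      for i j a b
    proof (rule adj_sq_sym, rule Q_bridge)
      show "\<forall>k\<in>J. \<not> (- j < k \<and> k < - i)" using ij(4) by force
      show "\<forall>c\<in>Q. idx c = - j \<longrightarrow> dir (- j) * X c \<le> dir (- j) * X b" using b(3) idx by (simp add: mirror_dir flip)
      show "\<forall>c\<in>Q. idx c = - i \<longrightarrow> dir (- i) * X a \<le> dir (- i) * X c" using a(3) idx by (simp add: mirror_dir flip)
    qed (use ij a b idx in auto)
  qed (fact partition)+
qed

interpretation mirror: stranding V SP adj sp "\<lambda>s. 1 - \<tau> s" "(\<lambda>e. 1 - e) ` E"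
  "uminus ` J" "\<lambda>i. ext (- i)" "\<lambda>i. ent (- i)" "\<lambda>z. 1 - X z" A Q
  by (rule mirror_stranding)

lemma mirror_idx: "q \<in> Q \<Longrightarrow> mirror.idx q = - idx q"
  using Q_V Q_section mirror_visited(2)[of q] unfolding in_section_def by blast

lemma mirror_precedes:
  assumes "a \<in> Q" "b \<in> Q"
  shows "mirror.precedes a b \<longleftrightarrow> precedes b a"
proof -
  have "d * (1 - x) < d * (1 - y) \<longleftrightarrow> d * y < d * x" for d x y :: real by (simp add: right_diff_distrib)
  then show ?thesis
    unfolding mirror.precedes_def precedes_def mirror_dir by (auto simp: mirror_idx assms)
qed

lemma Q_adj_sq_in_section:
  assumes xy: "x \<in> Q" "y \<in> Q" "idx x = idx y" "X x < X y"
    and next_to: "\<forall>c\<in>Q. idx c = idx x \<longrightarrow> \<not> (X x < X c \<and> X c < X y)"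
  shows "adj_sq x y"
proof -
  define B where "B = {q \<in> Q. idx q = idx x}"
  have sec: "in_section x" "in_section y" using xy Q_section by simp_all
  show ?thesis
  proof (rule alternating_adj_sq[of B])
    show "end_cut x = end_cut y" by (rule in_section_same_cut[OF sec xy(3)])
    show "alternates_at B s u" if su: "consecutive s u" "pos x \<le> \<tau> s" "\<tau> u \<le> pos y" for s u
    proof -
      have p: "pos x \<le> pos s" "pos s \<le> pos y" "pos x \<le> pos u" "pos u \<le> pos y"
        using consecutiveD[OF su(1)] su(2,3) pos_SP by auto
      have "in_section s" "idx s = idx x" "in_section u" "idx u = idx x"
        using in_section_between[OF sec xy(3) p(1,2)] in_section_between[OF sec xy(3) p(3,4)] by simp_all
      then show ?thesis using Q_alternates[OF su(1)] unfolding alternates_at_def B_def by auto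
    qed
  qed (use xy next_to Q_V B_def in auto)
qed

lemma Q_adj_sq:
  assumes ab: "a \<in> Q" "b \<in> Q" "precedes a b" "\<forall>c\<in>Q. \<not> (precedes a c \<and> precedes c b)"
  shows "adj_sq a b"
proof (cases "idx a = idx b")
  case True
  have less: "dir (idx a) * X a < dir (idx a) * X b" using ab(3) True unfolding precedes_def by simp
  have none: "\<not> (dir (idx a) * X a < dir (idx a) * X c \<and> dir (idx a) * X c < dir (idx a) * X b)"
    if "c \<in> Q" "idx c = idx a" for c
    using bspec[OF ab(4), of c] that True unfolding precedes_def by simp
  show ?thesis using dir_cases[of "idx a"]
  proof
    assume "dir (idx a) = 1"
    then show ?thesis using Q_adj_sq_in_section[OF ab(1,2) True] less none by simp
  next
    assume "dir (idx a) = - 1"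
    then have "adj_sq b a" using Q_adj_sq_in_section[OF ab(2,1) True[symmetric]] less none True by auto
    then show ?thesis by (rule adj_sq_sym)
  qed
next
  case False
  show ?thesis
  proof (rule Q_bridge)
    show less: "idx a < idx b" using ab(3) False unfolding precedes_def by auto
    show "\<forall>k\<in>J. \<not> (idx a < k \<and> k < idx b)" using Q_spine ab(4) unfolding precedes_def by blast
    show "\<forall>c\<in>Q. idx c = idx a \<longrightarrow> dir (idx a) * X c \<le> dir (idx a) * X a"
      and "\<forall>c\<in>Q. idx c = idx b \<longrightarrow> dir (idx b) * X b \<le> dir (idx b) * X c"
      using ab(4) less unfolding precedes_def by (auto simp: not_less[symmetric])
  qed (use ab Q_idx in auto)
qed

lemma section_lower_bound:
  assumes q: "q \<in> Q" and i: "i \<in> J" "idx q \<le> i"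
  shows "\<exists>l\<in>V. end_cut l = end_cut (ent i) \<and>
    (\<forall>c\<in>Q. idx c = i \<longrightarrow> precedes q c \<longrightarrow> dir i * pos l \<le> dir i * pos c)"
proof (cases "has_pred i")
  case True
  then show ?thesis using ent_V[OF i(1)] ent_section[OF i(1)] in_section_dir(1) Q_section by metis
next
  case False
  then have "idx q = i" using Q_idx[OF q] i(2) unfolding has_pred_def by force
  moreover from this have "end_cut q = end_cut (ent i)" using in_section_idx[OF Q_section[OF q]] by simp
  moreover have "dir i * pos q \<le> dir i * pos c" if "c \<in> Q" "idx c = i" "precedes q c" for c
    using precedes_pos[OF subsetD[OF Q_V q] subsetD[OF Q_V that(1)]] that calculation(1) by simp
  ultimately show ?thesis using q Q_V by blast
qed

end

context stranding
begin

interpretation mirror: stranding V SP adj sp "\<lambda>s. 1 - \<tau> s" "(\<lambda>e. 1 - e) ` E"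
  "uminus ` J" "\<lambda>i. ext (- i)" "\<lambda>i. ent (- i)" "\<lambda>z. 1 - X z" A Q
  by (rule mirror_stranding)

lemma section_upper_bound:
  assumes q: "q \<in> Q" and i: "i \<in> J" "i \<le> idx q"
  shows "\<exists>u\<in>V. end_cut u = end_cut (ent i) \<and>
    (\<forall>c\<in>Q. idx c = i \<longrightarrow> precedes c q \<longrightarrow> dir i * pos c \<le> dir i * pos u)"
proof -
  obtain u where u: "u \<in> V" "mirror.end_cut u = mirror.end_cut (ext i)"
    "\<forall>c\<in>Q. mirror.idx c = - i \<longrightarrow> mirror.precedes q c \<longrightarrow> mirror.dir (- i) * mirror.pos u \<le> mirror.dir (- i) * mirror.pos c"
    using mirror.section_lower_bound[OF q, of "- i"] i mirror_idx[OF q] by auto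
  have "end_cut u = end_cut (ent i)" using u(1,2) mirror_cut_eq_iff ext_V ext_cut i(1) by simp
  moreover have "dir i * pos c \<le> dir i * pos u" if "c \<in> Q" "idx c = i" "precedes c q" for c
    using u(3) that mirror_idx mirror_precedes[OF q that(1)] by (simp add: mirror_dir mirror_pos right_diff_distrib)
  ultimately show ?thesis using u(1) by blast
qed

lemma finite_Q_between:
  assumes q: "q \<in> Q" "q' \<in> Q"
  shows "finite {c \<in> Q. precedes q c \<and> precedes c q'}"
proof -
  have "finite {c \<in> Q. idx c = i \<and> precedes q c \<and> precedes c q'}" if i: "i \<in> J" "idx q \<le> i" "i \<le> idx q'" for i
  proof -
    obtain l where l: "l \<in> V" "end_cut l = end_cut (ent i)"
      "\<forall>c\<in>Q. idx c = i \<longrightarrow> precedes q c \<longrightarrow> dir i * pos l \<le> dir i * pos c"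
      using section_lower_bound[OF q(1) i(1,2)] by blast
    obtain u where u: "u \<in> V" "end_cut u = end_cut (ent i)"
      "\<forall>c\<in>Q. idx c = i \<longrightarrow> precedes c q' \<longrightarrow> dir i * pos c \<le> dir i * pos u"
      using section_upper_bound[OF q(2) i(1,3)] by blast
    have "{c \<in> Q. idx c = i \<and> precedes q c \<and> precedes c q'} \<subseteq>
        {z \<in> V. pos l \<le> pos z \<and> pos z \<le> pos u} \<union> {z \<in> V. pos u \<le> pos z \<and> pos z \<le> pos l}"
      using l(3) u(3) Q_V dir_cases[of i] by auto
    then show ?thesis by (rule finite_subset) (use finite_between l u in simp)
  qed
  then have "finite (\<Union>i\<in>J \<inter> {idx q..idx q'}. {c \<in> Q. idx c = i \<and> precedes q c \<and> precedes c q'})" by auto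
  then show ?thesis by (rule rev_finite_subset) (use Q_idx precedes_idx in auto)
qed

lemma first_section_initial:
  assumes i: "i \<in> J" "\<not> has_pred i" and q: "in_section q" "idx q = i" and w: "w \<in> V" "pos w \<le> pos q"
  shows "in_section w" "idx w = i"
proof -
  have cut: "end_cut (ent i) = end_cut q" using in_section_idx q by blast
  have "end_cut w = end_cut q"
  proof (rule cut_eqI[OF w(2)])
    fix e assume e: "e \<in> E"
    show "\<not> (pos w \<le> e \<and> e < pos q)"
    proof
      assume we: "pos w \<le> e \<and> e < pos q"
      then have "e < pos (ent i)" using cut e unfolding cut_eq_iff by blast
      then have "e = 0" using first_gap[OF i(1) _ e] i(2) E_range[OF e] unfolding has_pred_def by force
      then show False using we pos_unit[OF w(1)] pos_not_E[OF w(1)] e by auto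
    qed
  qed
  then have "visited w = visited q" "idx w = idx q" using visited_cong by blast+
  then show "in_section w" "idx w = i"
    using q w pos_unit[OF w(1)] first_section[OF i] in_section_dir(2)[OF q(1)]
    by (auto simp: in_section_def closed_segment_eq_real_ivl)
qed

lemma Q_near_start:
  assumes i: "i \<in> J" "\<not> has_pred i" and E: "0 \<in> E" and \<delta>: "0 < \<delta>"
  shows "\<exists>q\<in>Q. idx q = i \<and> pos q < \<delta>"
proof -
  obtain p where p: "p \<in> Q" "idx p = i" using Q_spine[OF i(1)] by blast
  have sec: "in_section w" "idx w = i" if "w \<in> SP" "\<tau> w \<le> pos p" for w
    using first_section_initial[OF i Q_section[OF p(1)] p(2) SP_V[OF that(1)]] that pos_SP by auto
  have "pos p \<noteq> 0" "0 \<le> pos p" using pos_unit[of p] pos_not_E[of p] p Q_V E by auto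
  then have t: "0 < min \<delta> (pos p)" using \<delta> by auto
  have "\<not> (0 < e \<and> e < pos p)" if "e \<in> E" for e
  proof -
    have "end_cut (ent i) = end_cut p" using in_section_idx[OF Q_section] p by blast
    then show ?thesis using first_gap[OF i(1) _ that] i(2) that unfolding has_pred_def cut_eq_iff by force
  qed
  moreover have "alternates_at Q s u" if "consecutive s u" "\<tau> u < min \<delta> (pos p)" for s u
    using Q_alternates[OF that(1)] sec consecutiveD[OF that(1)] that(2) by auto
  ultimately obtain q where "q \<in> Q" "q \<in> SP" "\<tau> q < min \<delta> (pos p)"
    using alternating_near_end[OF E t, of Q] by force
  then show ?thesis using sec(2)[of q] pos_SP[of q] by auto
qed

lemma Q_starts_at_end:
  assumes E: "0 \<in> E" and \<delta>: "0 < \<delta>"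
  shows "\<exists>q\<in>Q. \<forall>c\<in>Q. \<not> precedes q c \<longrightarrow> pos c < \<delta>"
proof (cases "\<forall>i\<in>J. has_pred i")
  case True
  then have unb: "\<forall>i\<in>J. \<exists>j\<in>J. j < i" unfolding has_pred_def by blast
  then obtain N where N: "\<And>i. i \<in> J \<Longrightarrow> i < N \<Longrightarrow> pos (ent i) < \<delta> \<and> pos (ext i) < \<delta>" using below_limit \<delta> by blast
  obtain k where k: "k \<in> J" using J_nonempty by blast
  obtain j where j: "j \<in> J" "j < min N k" using int_set_unbounded_below[OF J_nonempty unb] by blast
  obtain q where q: "q \<in> Q" "idx q = j" using Q_spine[OF j(1)] by blast
  have "pos c < \<delta>" if c: "c \<in> Q" "\<not> precedes q c" for c
  proof -
    have i: "idx c \<in> J" "idx c < N" "has_pred (idx c)" "has_succ (idx c)"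
      using c q j k True Q_idx unfolding precedes_def has_succ_def by force+
    then have "pos c \<in> closed_segment (pos (ent (idx c))) (pos (ext (idx c)))"
      using Q_section[OF c(1)] unfolding in_section_def entry_def exit_def by simp
    then show ?thesis using N[OF i(1,2)] by (auto simp: closed_segment_eq_real_ivl split: if_splits)
  qed
  then show ?thesis using q by blast
next
  case False
  then obtain i where i: "i \<in> J" "\<not> has_pred i" by blast
  obtain q where q: "q \<in> Q" "idx q = i" "pos q < \<delta>" using Q_near_start[OF i E \<delta>] by blast
  have "pos c < \<delta>" if c: "c \<in> Q" "\<not> precedes q c" for c
  proof -
    have "i \<le> idx c" using Q_idx[OF c(1)] i(2) unfolding has_pred_def by force
    then have "idx c = i" "X c \<le> X q" using c(2) q(2) first_section[OF i] unfolding precedes_def by auto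
    then have "pos c \<le> pos q" using X_less_imp_pos c q Q_V by blast
    then show ?thesis using q(3) by simp
  qed
  then show ?thesis using q by blast
qed

lemma strands_start_adjacent:
  assumes E: "0 \<notin> E"
  shows "\<exists>a\<in>A. \<exists>q\<in>Q. adj_sq a q \<and> (\<forall>c\<in>A. X a \<le> X c) \<and> (\<forall>c\<in>Q. \<not> precedes c q)"
proof -
  obtain i where i: "i \<in> J" "\<not> has_pred i" using first_section_exists E by blast
  obtain x u where x: "consecutive x u" "\<tau> x = 0" using spine_start[OF E] by blast
  have S: "x \<in> SP" "u \<in> SP" "x \<in> V" "u \<in> V" "sp x = x" using consecutiveD[OF x(1)] sp_id by auto
  have least: "\<tau> x \<le> \<tau> s" if "s \<in> SP" for s using x(2) \<tau>_unit[OF that] by auto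
  obtain p where p: "p \<in> Q" "p \<in> SP" "idx p = i" using Q_spine[OF i(1)] by blast
  have sec: "in_section w" "idx w = i" if "w \<in> V" "pos w \<le> pos p" for w
    using first_section_initial[OF i Q_section[OF p(1)] p(3)] that by auto
  define B where "B = {q \<in> Q. idx q = i}"
  have "\<exists>a\<in>A. \<exists>q\<in>B. adj_sq a q \<and> (\<forall>c\<in>A. X a \<le> X c) \<and> (\<forall>c\<in>B. X q \<le> X c)"
  proof (rule alternating_start[OF x(1) least])
    show "{z \<in> V. sp z = x} \<subseteq> A \<union> B"
      using sec(2) partition(1) pos_unit[of p] p(1) Q_V x(2) unfolding B_def pos_def by auto
    show "u \<in> A \<and> (\<forall>b\<in>A. sp b = u \<longrightarrow> X u \<le> X b)" if "{b \<in> A. sp b = x} = {}"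
      using A_alternates[OF x(1)] that S(5) unfolding alternates_at_def by blast
    show "u \<in> B \<and> (\<forall>b\<in>B. sp b = u \<longrightarrow> X u \<le> X b)" if none: "{b \<in> B. sp b = x} = {}"
    proof -
      have "p \<noteq> x" using p S(5) none unfolding B_def by blast
      then have "\<tau> p \<noteq> \<tau> x" using inj_onD[OF \<tau>_inj _ p(2) S(1)] by blast
      then have "pos u \<le> pos p" using not_between_consecutive[OF x(1) p(2)] least[OF p(2)] pos_SP S(2) p(2) by auto
      moreover from this have "pos x \<le> pos p" using consecutiveD[OF x(1)] pos_SP S by auto
      ultimately have u: "in_section u" "idx u = i" "in_section x" "idx x = i" using sec S by auto
      have "x \<notin> Q" using none u(4) S(5) unfolding B_def by blast
      then show ?thesis using Q_alternates[OF x(1) u(3,1)] u(2) unfolding alternates_at_def B_def by blast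
    qed
  qed (use partition B_def in auto)
  then obtain a q where q: "a \<in> A" "q \<in> B" "adj_sq a q" "\<forall>c\<in>A. X a \<le> X c" "\<forall>c\<in>B. X q \<le> X c" by blast
  have "\<not> precedes c q" if c: "c \<in> Q" for c
  proof -
    have "i \<le> idx c" using Q_idx[OF c] i(2) unfolding has_pred_def by force
    then show ?thesis using q(2,5) c first_section[OF i] unfolding B_def precedes_def by force
  qed
  then show ?thesis using q unfolding B_def by blast
qed

end

context stranding
begin

interpretation mirror: stranding V SP adj sp "\<lambda>s. 1 - \<tau> s" "(\<lambda>e. 1 - e) ` E"
  "uminus ` J" "\<lambda>i. ext (- i)" "\<lambda>i. ent (- i)" "\<lambda>z. 1 - X z" A Q
  by (rule mirror_stranding)

lemma Q_finishes_at_end: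
  assumes "1 \<in> E" "0 < \<delta>"
  shows "\<exists>q\<in>Q. \<forall>c\<in>Q. \<not> precedes c q \<longrightarrow> 1 - pos c < \<delta>"
proof -
  have "0 \<in> (\<lambda>e. 1 - e) ` E" using assms(1) by force
  from mirror.Q_starts_at_end[OF this assms(2)] show ?thesis
    using mirror_precedes by (auto simp: mirror_pos)
qed

lemma strands_finish_adjacent:
  assumes "1 \<notin> E"
  shows "\<exists>a\<in>A. \<exists>q\<in>Q. adj_sq a q \<and> (\<forall>c\<in>A. X c \<le> X a) \<and> (\<forall>c\<in>Q. \<not> precedes q c)"
proof -
  have "0 \<notin> (\<lambda>e. 1 - e) ` E" using assms by force
  from mirror.strands_start_adjacent[OF this] show ?thesis using mirror_precedes by auto
qed

lemma strands_start_together: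
  assumes g: "\<And>q. 0 < g q" "\<And>q. g q < 1" "\<And>a b. a \<in> Q \<Longrightarrow> b \<in> Q \<Longrightarrow> \<not> precedes b a \<Longrightarrow> g a \<le> g b"
  shows "\<exists>a\<^sub>1\<in>X ` A \<union> E. \<exists>a\<^sub>2\<in>g ` Q \<union> E \<inter> {0, 1}.
    (\<forall>z\<in>X ` A \<union> E. a\<^sub>1 \<le> z) \<and> (\<forall>z\<in>g ` Q \<union> E \<inter> {0, 1}. a\<^sub>2 \<le> z) \<and>
    (if 0 \<in> E then a\<^sub>1 = 0 \<and> a\<^sub>2 = 0 else \<exists>a\<in>A. \<exists>q\<in>Q. a\<^sub>1 = X a \<and> a\<^sub>2 = g q \<and> adj_sq a q)"
proof (cases "0 \<in> E")
  case True
  have "0 \<le> X a" if "a \<in> A" for a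
  proof -
    have a: "a \<in> V" using that A_V by blast
    then have "0 < pos a" using pos_unit[OF a] pos_not_E[OF a] True by (auto simp: order_le_less)
    then show ?thesis using X_end(1)[OF a True] by simp
  qed
  then show ?thesis using True g(1) E_range by (intro bexI[of _ 0]) (auto intro: less_imp_le)
next
  case False
  then obtain a q where aq: "a \<in> A" "q \<in> Q" "adj_sq a q" "\<forall>c\<in>A. X a \<le> X c" "\<forall>c\<in>Q. \<not> precedes c q"
    using strands_start_adjacent by blast
  have "X a \<le> e" if "e \<in> E" for e
    using alternating_before_first_end[OF A_V A_alternates False that] aq(4) by force
  then show ?thesis
    using aq False g by (intro bexI[of _ "X a"] bexI[of _ "g q"]) (auto intro: less_imp_le)
qed

lemma strands_finish_together:
  assumes g: "\<And>q. 0 < g q" "\<And>q. g q < 1" "\<And>a b. a \<in> Q \<Longrightarrow> b \<in> Q \<Longrightarrow> \<not> precedes b a \<Longrightarrow> g a \<le> g b"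
  shows "\<exists>b\<^sub>1\<in>X ` A \<union> E. \<exists>b\<^sub>2\<in>g ` Q \<union> E \<inter> {0, 1}.
    (\<forall>z\<in>X ` A \<union> E. z \<le> b\<^sub>1) \<and> (\<forall>z\<in>g ` Q \<union> E \<inter> {0, 1}. z \<le> b\<^sub>2) \<and>
    (if 1 \<in> E then b\<^sub>1 = 1 \<and> b\<^sub>2 = 1 else \<exists>a\<in>A. \<exists>q\<in>Q. b\<^sub>1 = X a \<and> b\<^sub>2 = g q \<and> adj_sq a q)"
proof (cases "1 \<in> E")
  case True
  have "X a \<le> 1" if "a \<in> A" for a
  proof -
    have a: "a \<in> V" using that A_V by blast
    then have "pos a < 1" using pos_unit[OF a] pos_not_E[OF a] True by (auto simp: order_le_less)
    then show ?thesis using X_end(1)[OF a True] by simp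
  qed
  then show ?thesis using True g(2) E_range by (intro bexI[of _ 1]) (auto intro: less_imp_le)
next
  case False
  then obtain a q where aq: "a \<in> A" "q \<in> Q" "adj_sq a q" "\<forall>c\<in>A. X c \<le> X a" "\<forall>c\<in>Q. \<not> precedes q c"
    using strands_finish_adjacent by blast
  have "e \<le> X a" if "e \<in> E" for e
    using alternating_after_last_end[OF A_V A_alternates False that] aq(4) by force
  then show ?thesis
    using aq False g by (intro bexI[of _ "X a"] bexI[of _ "g q"]) (auto intro: less_imp_le)
qed

theorem strand_pair_of_stranding:
  "\<exists>g a\<^sub>1 b\<^sub>1 a\<^sub>2 b\<^sub>2. strand_pair V SP adj sp \<tau> E A X Q g a\<^sub>1 b\<^sub>1 a\<^sub>2 b\<^sub>2"
proof -
  have "\<exists>\<nu> :: 'v \<Rightarrow> int. \<forall>a\<in>Q. \<forall>b\<in>Q. precedes a b \<longleftrightarrow> \<nu> a < \<nu> b"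
    by (rule int_index_exists) (fact precedes_irrefl precedes_trans precedes_total finite_Q_between)+
  then obtain \<nu> :: "'v \<Rightarrow> int" where \<nu>: "\<And>a b. a \<in> Q \<Longrightarrow> b \<in> Q \<Longrightarrow> precedes a b \<longleftrightarrow> \<nu> a < \<nu> b" by blast
  interpret A: strand V SP adj sp \<tau> E A X E
    by (rule alternating_strand[OF A_V A_alternates])
  interpret Q: int_indexed V SP adj sp \<tau> E Q \<nu>
  proof
    show "inj_on \<nu> Q" using precedes_total \<nu> by (intro inj_onI) force
    show "adj_sq a b" if "a \<in> Q" "b \<in> Q" "\<nu> a < \<nu> b" "\<forall>c\<in>Q. \<not> (\<nu> a < \<nu> c \<and> \<nu> c < \<nu> b)" for a b
      using Q_adj_sq that \<nu> by blast
    show "\<exists>q\<in>Q. \<forall>c\<in>Q. \<nu> c \<le> \<nu> q \<longrightarrow> pos c < \<delta>" if "0 \<in> E" "0 < \<delta>" for \<delta>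
      using Q_starts_at_end[OF that] \<nu> by (meson not_le)
    show "\<exists>q\<in>Q. \<forall>c\<in>Q. \<nu> q \<le> \<nu> c \<longrightarrow> 1 - pos c < \<delta>" if "1 \<in> E" "0 < \<delta>" for \<delta>
      using Q_finishes_at_end[OF that] \<nu> by (meson not_le)
    show "\<exists>q\<in>Q. \<forall>c\<in>Q. \<nu> q \<le> \<nu> c" if "0 \<notin> E" using strands_start_adjacent[OF that] \<nu> by (meson not_le)
    show "\<exists>q\<in>Q. \<forall>c\<in>Q. \<nu> c \<le> \<nu> q" if "1 \<notin> E" using strands_finish_adjacent[OF that] \<nu> by (meson not_le)
  qed (rule Q_V)
  interpret Q: strand V SP adj sp \<tau> E Q Q.place "E \<inter> {0, 1}" by (rule Q.strand)
  have place_le: "Q.place a \<le> Q.place b" if "a \<in> Q" "b \<in> Q" "\<not> precedes b a" for a b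
    using \<nu>[OF that(2,1)] that(3) by (simp add: Q.place_le_iff)
  obtain a\<^sub>1 a\<^sub>2 where start: "a\<^sub>1 \<in> X ` A \<union> E" "a\<^sub>2 \<in> Q.place ` Q \<union> E \<inter> {0, 1}"
    "\<forall>z\<in>X ` A \<union> E. a\<^sub>1 \<le> z" "\<forall>z\<in>Q.place ` Q \<union> E \<inter> {0, 1}. a\<^sub>2 \<le> z"
    "if 0 \<in> E then a\<^sub>1 = 0 \<and> a\<^sub>2 = 0 else \<exists>a\<in>A. \<exists>q\<in>Q. a\<^sub>1 = X a \<and> a\<^sub>2 = Q.place q \<and> adj_sq a q"
    using strands_start_together[of Q.place, OF Q.place_range place_le] by blast
  obtain b\<^sub>1 b\<^sub>2 where finish: "b\<^sub>1 \<in> X ` A \<union> E" "b\<^sub>2 \<in> Q.place ` Q \<union> E \<inter> {0, 1}"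
    "\<forall>z\<in>X ` A \<union> E. z \<le> b\<^sub>1" "\<forall>z\<in>Q.place ` Q \<union> E \<inter> {0, 1}. z \<le> b\<^sub>2"
    "if 1 \<in> E then b\<^sub>1 = 1 \<and> b\<^sub>2 = 1 else \<exists>a\<in>A. \<exists>q\<in>Q. b\<^sub>1 = X a \<and> b\<^sub>2 = Q.place q \<and> adj_sq a q"
    using strands_finish_together[of Q.place, OF Q.place_range place_le] by blast
  have "strand_pair V SP adj sp \<tau> E A X Q Q.place a\<^sub>1 b\<^sub>1 a\<^sub>2 b\<^sub>2"
    by unfold_locales (use partition start finish in \<open>auto simp: subset_iff\<close>)
  then show ?thesis by blast
qed

end

subsection \<open>Colouring the blocks of a section\<close>

text \<open>In the blocks of a section that have the parity of its anchor, the second strand takes the spine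
  vertex and the first strand takes the leaves; in the other blocks of the section it is the other way
  round. If the route enters the section at a leaf, then the second strand takes this leaf as well, just
  before the anchor. Outside the sections the first strand takes everything. The leaves are placed before
  their spine vertex to the left of a section and after it to the right, so that the first strand meets
  the section at spine vertices. The exit leaf is the last one of its block in the direction of travel.\<close>

locale coloured = routed V SP adj sp \<tau> E J ent ext
  for V SP :: "'v set" and adj sp \<tau> E J ent ext +
  fixes parity :: "'v \<Rightarrow> bool" and width spread :: "'v \<Rightarrow> real"
  assumes parity: "consecutive s u \<Longrightarrow> parity s \<noteq> parity u"
    and width_pos: "s \<in> SP \<Longrightarrow> 0 < width s" and width_le: "s \<in> SP \<Longrightarrow> width s \<le> 1/4"
    and width_SP: "s \<in> SP \<Longrightarrow> s' \<in> SP \<Longrightarrow> s' \<noteq> s \<Longrightarrow> 3 * width s \<le> \<bar>\<tau> s - \<tau> s'\<bar>"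
    and width_E: "s \<in> SP \<Longrightarrow> e \<in> E \<Longrightarrow> 3 * width s \<le> \<bar>\<tau> s - e\<bar>"
    and spread: "0 < spread z" "spread z < 1/2"
    and spread_inj: "s \<in> SP \<Longrightarrow> inj_on spread {z \<in> V. sp z = s}"
begin

definition anchor :: "int \<Rightarrow> 'v" where
  "anchor i = sp (if has_pred i then ent i else ext i)"

definition anchored :: "'v \<Rightarrow> bool" where
  "anchored z \<longleftrightarrow> parity (sp z) = parity (anchor (idx z))"

definition entry_leaf :: "'v \<Rightarrow> bool" where
  "entry_leaf z \<longleftrightarrow> visited z \<and> z \<notin> SP \<and> has_pred (idx z) \<and> z = ent (idx z)"

definition exit_leaf :: "'v \<Rightarrow> bool" where
  "exit_leaf z \<longleftrightarrow> visited z \<and> z \<notin> SP \<and> has_succ (idx z) \<and> z = ext (idx z)"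

definition left_of_section :: "'v \<Rightarrow> bool" where
  "left_of_section z \<longleftrightarrow> visited z \<and> pos z < min (entry (idx z)) (exit (idx z))"

definition A :: "'v set" where
  "A = {z \<in> V. \<not> in_section z \<or> (if anchored z then z \<notin> SP \<and> \<not> entry_leaf z else z \<in> SP)}"

definition Q :: "'v set" where
  "Q = {z \<in> V. in_section z \<and> (if anchored z then z \<in> SP \<or> entry_leaf z else z \<notin> SP)}"

definition side :: "'v \<Rightarrow> real" where
  "side z = (if entry_leaf z then - dir (idx z) else if in_section z then dir (idx z)
     else if left_of_section z then - 1 else 1)"

definition offset :: "'v \<Rightarrow> real" where
  "offset z = (if z \<in> SP then 0 else side z * (if exit_leaf z then 3/4 else spread z))"

definition X :: "'v \<Rightarrow> real" where "X z = pos z + width (sp z) * offset z"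

lemma A_V: "A \<subseteq> V" and Q_V: "Q \<subseteq> V"
  unfolding A_def Q_def by auto

lemma side_cases: "side z = 1 \<or> side z = - 1"
  using dir_cases[of "idx z"] unfolding side_def by auto

lemma offset_SP [simp]: "s \<in> SP \<Longrightarrow> offset s = 0"
  unfolding offset_def by simp

lemma offset_leaf: "z \<notin> SP \<Longrightarrow> 0 < side z * offset z \<and> \<bar>offset z\<bar> < 1"
  using side_cases[of z] spread[of z] unfolding offset_def by auto

lemma offset_less_1: "\<bar>offset z\<bar> < 1"
  using offset_leaf[of z] by (cases "z \<in> SP") auto

lemma offset_inj:
  assumes z: "z \<in> V" "z' \<in> V" "sp z = sp z'" "offset z = offset z'"
  shows "z = z'"
proof -
  have size: "\<bar>offset z\<bar> = (if z \<in> SP then 0 else if exit_leaf z then 3/4 else spread z)" for z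
    unfolding offset_def using side_cases[of z] spread[of z] by auto
  have idx: "idx z = idx z'" using idx_sp z(1-3) by metis
  consider "z \<in> SP \<or> z' \<in> SP" | "z \<notin> SP" "z' \<notin> SP" "exit_leaf z \<or> exit_leaf z'"
    | "z \<notin> SP" "z' \<notin> SP" "\<not> exit_leaf z" "\<not> exit_leaf z'" by blast
  then show ?thesis
  proof cases
    case 1
    then have "z \<in> SP \<and> z' \<in> SP"
      using size[of z] size[of z'] z(4) spread(1)[of z] spread(1)[of z'] by (auto split: if_splits)
    then show ?thesis using z(3) sp_id by simp
  next
    case 2
    then have "exit_leaf z \<and> exit_leaf z'"
      using size[of z] size[of z'] z(4) spread(2)[of z] spread(2)[of z'] by (auto split: if_splits)
    then show ?thesis using idx unfolding exit_leaf_def by metis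
  next
    case 3
    then have "spread z = spread z'" using size[of z] size[of z'] z(4) by simp
    then show ?thesis using inj_onD[OF spread_inj[OF sp_SP[OF z(1)]], of z z'] z(1-3) by simp
  qed
qed

lemma X_near_pos: "z \<in> V \<Longrightarrow> \<bar>X z - pos z\<bar> \<le> width (sp z)"
  unfolding X_def using offset_less_1[of z] width_pos[OF sp_SP, of z] by (simp add: abs_mult mult_left_le)

lemma X_less_pos:
  assumes z: "z \<in> V" "z' \<in> V" "pos z < pos z'"
  shows "X z < X z'"
proof -
  have s: "sp z \<in> SP" "sp z' \<in> SP" "sp z \<noteq> sp z'" using z sp_SP unfolding pos_def by auto
  have "3 * width (sp z) \<le> pos z' - pos z" "3 * width (sp z') \<le> pos z' - pos z"
    using width_SP[OF s(1,2)] width_SP[OF s(2,1)] s(3) z(3) unfolding pos_def by auto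
  then show ?thesis using X_near_pos[OF z(1)] X_near_pos[OF z(2)] width_pos[OF s(1)] width_pos[OF s(2)] by linarith
qed

lemma X_less_offset: "z \<in> V \<Longrightarrow> sp z = sp z' \<Longrightarrow> X z < X z' \<longleftrightarrow> offset z < offset z'"
  using width_pos[OF sp_SP, of z] unfolding X_def pos_def by simp

sublocale layout V SP adj sp \<tau> E X
proof
  show "inj_on X V"
  proof (rule inj_onI)
    fix z z' assume z: "z \<in> V" "z' \<in> V" "X z = X z'"
    then have "pos z = pos z'" using X_less_pos[of z z'] X_less_pos[of z' z] by linarith
    then have s: "sp z = sp z'" using pos_eq_iff z by blast
    then have "offset z = offset z'" using X_less_offset[of z z'] X_less_offset[of z' z] z by simp
    then show "z = z'" using offset_inj z s by blast
  qed
  show "\<bar>X z - pos z\<bar> \<le> 1/4" if "z \<in> V" for z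
    using X_near_pos[OF that] width_le[OF sp_SP[OF that]] by linarith
  show "3 * \<bar>X z - pos z\<bar> \<le> \<bar>pos z - e\<bar>" if "z \<in> V" "e \<in> E" for z e
    using X_near_pos[OF that(1)] width_E[OF sp_SP[OF that(1)] that(2)] unfolding pos_def by argo
qed (rule X_less_pos)

lemma anchored_sp: "z \<in> V \<Longrightarrow> anchored (sp z) = anchored z"
  unfolding anchored_def using idx_sp sp_sp by simp

lemma anchored_consecutive:
  assumes "consecutive s u"
  shows "anchored s \<noteq> anchored u"
proof -
  have "idx s = idx u" "sp s = s" "sp u = u" using visited_cong consecutiveD[OF assms] sp_id by blast+
  then show ?thesis using parity[OF assms] unfolding anchored_def by auto
qed

lemma anchor_section:
  assumes i: "i \<in> J"
  shows "anchor i \<in> SP" "in_section (anchor i)" "idx (anchor i) = i" "anchored (anchor i)"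
proof -
  define z where "z = (if has_pred i then ent i else ext i)"
  have z: "z \<in> V" "end_cut (ent i) = end_cut z" using ent_V ext_V ext_cut i unfolding z_def by auto
  have idx: "idx z = i" "visited z" using idx_eq[OF i z(2)] by auto
  have "in_section z"
  proof (cases "has_pred i \<or> has_succ i")
    case True
    then show ?thesis using ent_section[OF i] ext_section[OF i] unfolding z_def by auto
  next
    case False
    then have "entry i = 0" "exit i = 1" by (simp_all add: entry_def exit_def)
    then show ?thesis using idx pos_unit[OF z(1)] by (simp add: in_section_def closed_segment_eq_real_ivl)
  qed
  moreover have "anchor i = sp z" unfolding anchor_def z_def by simp
  ultimately show "anchor i \<in> SP" "in_section (anchor i)" and i: "idx (anchor i) = i"
    using z(1) idx sp_SP in_section_sp idx_sp by auto
  then show "anchored (anchor i)" unfolding anchored_def by (simp add: sp_id)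
qed

lemma entry_leafD:
  assumes "entry_leaf z"
  shows "z \<in> V" "z \<notin> SP" "in_section z" "pos z = entry (idx z)" "anchored z" "z \<in> Q" "side z = - dir (idx z)"
proof -
  have z: "idx z \<in> J" "has_pred (idx z)" "ent (idx z) = z" "z \<notin> SP"
    using assms visited_idx unfolding entry_leaf_def by auto
  show "z \<in> V" "z \<notin> SP" "in_section z" "pos z = entry (idx z)" "side z = - dir (idx z)"
    using ent_V[OF z(1)] ent_section[OF z(1,2)] z(3,4) assms unfolding side_def by auto
  moreover show "anchored z" using z(2,3) unfolding anchored_def anchor_def by simp
  ultimately show "z \<in> Q" using assms unfolding Q_def by simp
qed

lemma SP_in_A: "s \<in> SP \<Longrightarrow> s \<in> A \<longleftrightarrow> \<not> in_section s \<or> \<not> anchored s"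
  unfolding A_def using SP_V by auto

lemma SP_in_Q: "s \<in> SP \<Longrightarrow> s \<in> Q \<longleftrightarrow> in_section s \<and> anchored s"
  unfolding Q_def using SP_V entry_leafD(2) by auto

lemma Q_anchored_iff: "z \<in> Q \<Longrightarrow> \<not> entry_leaf z \<Longrightarrow> anchored z \<longleftrightarrow> z \<in> SP"
  unfolding Q_def by (auto split: if_splits)

lemma
  assumes "s \<in> SP" "z \<in> V" "sp z = s"
  shows spine_last_in_block: "z = s \<or> side z = - 1 \<Longrightarrow> X z \<le> X s"
    and spine_first_in_block: "z = s \<or> side z = 1 \<Longrightarrow> X s \<le> X z"
proof -
  have "z \<noteq> s \<Longrightarrow> 0 < side z * offset z" using offset_leaf[of z] sp_id[of z] assms(3) by auto
  moreover have "X z < X s \<longleftrightarrow> offset z < 0" "X s < X z \<longleftrightarrow> 0 < offset z"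
    using X_less_offset[of z s] X_less_offset[of s z] assms SP_V[of s] sp_id[of s] by auto
  ultimately show "z = s \<or> side z = - 1 \<Longrightarrow> X z \<le> X s" "z = s \<or> side z = 1 \<Longrightarrow> X s \<le> X z"
    by (cases "z = s"; force simp: order_le_less)+
qed

lemma left_of_section_sp: "z \<in> V \<Longrightarrow> left_of_section (sp z) = left_of_section z"
  unfolding left_of_section_def using visited_cong[OF cut_sp] pos_sp by simp

lemma side_outside: "\<not> in_section z \<Longrightarrow> side z = (if left_of_section z then - 1 else 1)"
  using entry_leafD(3)[of z] unfolding side_def by auto

lemma A_not_anchored:
  assumes z: "z \<in> A" "in_section (sp z)" "\<not> anchored (sp z)"
  shows "z = sp z"
proof -
  have "z \<in> V" using z(1) A_V by blast
  then have "in_section z" "\<not> anchored z" using z(2,3) in_section_sp anchored_sp by auto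
  then show ?thesis using z(1) sp_id unfolding A_def by simp
qed

lemma A_alternates:
  assumes su: "consecutive s u"
  shows "alternates_at A s u"
proof -
  have S: "s \<in> SP" "u \<in> SP" "pos s < pos u" "end_cut s = end_cut u"
    using consecutiveD[OF su] pos_SP by auto
  have "visited u = visited s" "idx u = idx s" using visited_cong[OF S(4)] by auto
  then have "in_section u \<and> anchored u \<or> left_of_section u \<Longrightarrow>
      in_section s \<and> \<not> anchored s \<or> \<not> in_section s \<and> left_of_section s"
    using anchored_consecutive[OF su] S(3)
    by (auto simp: in_section_def left_of_section_def closed_segment_eq_real_ivl min_def split: if_splits)
  then consider "\<not> in_section s" "left_of_section s" | "in_section s" "\<not> anchored s"
    | "\<not> in_section u" "\<not> left_of_section u" | "in_section u" "\<not> anchored u" by blast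
  then show ?thesis
  proof cases
    case 1
    have "X b \<le> X s" if b: "b \<in> A" "sp b = s" for b
    proof -
      have bV: "b \<in> V" using b(1) A_V by blast
      then have "side b = - 1" using side_outside[of b] in_section_sp left_of_section_sp 1 b(2) by auto
      then show ?thesis using spine_last_in_block[OF S(1) bV b(2)] by simp
    qed
    then show ?thesis unfolding alternates_at_def using 1 SP_in_A[OF S(1)] by blast
  next
    case 2
    then show ?thesis unfolding alternates_at_def using A_not_anchored SP_in_A[OF S(1)] by (metis order_refl)
  next
    case 3
    have "X u \<le> X b" if b: "b \<in> A" "sp b = u" for b
    proof -
      have bV: "b \<in> V" using b(1) A_V by blast
      then have "side b = 1" using side_outside[of b] in_section_sp left_of_section_sp 3 b(2) by auto
      then show ?thesis using spine_first_in_block[OF S(2) bV b(2)] by simp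
    qed
    then show ?thesis unfolding alternates_at_def using 3 SP_in_A[OF S(2)] by blast
  next
    case 4
    then show ?thesis unfolding alternates_at_def using A_not_anchored SP_in_A[OF S(2)] by (metis order_refl)
  qed
qed

lemma Q_alternates:
  assumes su: "consecutive s u" and sec: "in_section s" "in_section u"
  shows "alternates_at Q s u"
proof -
  have S: "s \<in> SP" "u \<in> SP" "pos s < pos u" "end_cut s = end_cut u"
    using consecutiveD[OF su] pos_SP by auto
  have idx: "idx u = idx s" using visited_cong[OF S(4)] by auto
  have entry: "pos z = entry (idx s) \<and> side z = - dir (idx s)" if "entry_leaf z" "sp z = s \<or> sp z = u" for z
    using entry_leafD(1,4,7)[OF that(1)] idx_sp[of z] idx that(2) by auto
  have in_Q: "z = sp z \<or> entry_leaf z" if "z \<in> Q" "anchored (sp z)" for z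
    using Q_anchored_iff[OF that(1)] anchored_sp[of z] that sp_id Q_V by auto
  consider "anchored s" | "anchored u" using anchored_consecutive[OF su] by blast
  then show ?thesis
  proof cases
    case 1
    have "X b \<le> X s" if b: "b \<in> Q" "sp b = s" for b
    proof (rule spine_last_in_block[OF S(1) subsetD[OF Q_V b(1)] b(2)])
      have "side b = - 1" if "entry_leaf b"
      proof -
        have "entry (idx s) = pos s" using entry[OF that] b pos_sp[of b] Q_V by auto
        then have "dir (idx s) = 1" using in_section_dir(1)[OF sec(2)] S(3) idx dir_cases[of "idx s"] by auto
        then show ?thesis using entry[OF that] b(2) by simp
      qed
      then show "b = s \<or> side b = - 1" using in_Q[OF b(1)] 1 b(2) by auto
    qed
    then show ?thesis unfolding alternates_at_def using 1 SP_in_Q[OF S(1)] sec(1) by blast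
  next
    case 2
    have "X u \<le> X b" if b: "b \<in> Q" "sp b = u" for b
    proof (rule spine_first_in_block[OF S(2) subsetD[OF Q_V b(1)] b(2)])
      have "side b = 1" if "entry_leaf b"
      proof -
        have "entry (idx s) = pos u" using entry[OF that] b pos_sp[of b] Q_V by auto
        then have "dir (idx s) = - 1" using in_section_dir(1)[OF sec(1)] S(3) dir_cases[of "idx s"] by auto
        then show ?thesis using entry[OF that] b(2) by simp
      qed
      then show "b = u \<or> side b = 1" using in_Q[OF b(1)] 2 b(2) by auto
    qed
    then show ?thesis unfolding alternates_at_def using 2 SP_in_Q[OF S(2)] sec(2) by blast
  qed
qed

lemma dir_X_less_pos:
  assumes "z \<in> V" "z' \<in> V" "dir i * pos z < dir i * pos z'"
  shows "dir i * X z < dir i * X z'"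
  using dir_cases[of i] X_less[of z z'] X_less[of z' z] assms by auto

lemma dir_X_less_offset:
  assumes "z \<in> V" "z' \<in> V" "sp z = sp z'"
  shows "dir i * X z < dir i * X z' \<longleftrightarrow> dir i * offset z < dir i * offset z'"
  using dir_cases[of i] X_less_offset[of z z'] X_less_offset[of z' z] assms by auto

lemma entry_leaf_offset: "entry_leaf z \<Longrightarrow> dir (idx z) * offset z < 0"
  using offset_leaf[of z] entry_leafD(2,7)[of z] by simp

lemma
  assumes i: "i \<in> J" "has_pred i"
  shows ent_in_Q: "ent i \<in> Q" and ent_first_in_section: "c \<in> Q \<Longrightarrow> idx c = i \<Longrightarrow> c \<noteq> ent i \<Longrightarrow> dir i * X (ent i) < dir i * X c"
proof -
  have e: "in_section (ent i)" "idx (ent i) = i" "pos (ent i) = entry i" "ent i \<in> V" "sp (ent i) = anchor i"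
    using ent_section[OF i] ent_V[OF i(1)] i(2) by (auto simp: anchor_def)
  have leaf: "entry_leaf (ent i)" if "ent i \<notin> SP"
    using e(1,2) i(2) that unfolding entry_leaf_def in_section_def by simp
  show "ent i \<in> Q"
  proof (cases "ent i \<in> SP")
    case True
    then have "ent i = anchor i" using sp_id e(5) by simp
    then show ?thesis using SP_in_Q anchor_section[OF i(1)] by simp
  qed (use leaf entry_leafD(6) in blast)
  assume c: "c \<in> Q" "idx c = i" "c \<noteq> ent i"
  have cV: "c \<in> V" "in_section c" using c(1) unfolding Q_def by auto
  show "dir i * X (ent i) < dir i * X c"
  proof (cases "sp c = anchor i")
    case True
    then have "anchored c" using anchored_sp[OF cV(1)] anchor_section(4)[OF i(1)] by simp
    moreover have "\<not> entry_leaf c" using c(2,3) unfolding entry_leaf_def by auto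
    ultimately have "c \<in> SP" using Q_anchored_iff[OF c(1)] by simp
    moreover from this have "ent i \<notin> SP" using True c(3) e(5) sp_id by metis
    ultimately show ?thesis using dir_X_less_offset[OF e(4) cV(1)] entry_leaf_offset[OF leaf] e(2,5) True by simp
  next
    case False
    then have "dir i * pos (ent i) \<noteq> dir i * pos c" using pos_eq_iff[OF e(4) cV(1)] e(5) dir_cases[of i] by auto
    moreover have "dir i * pos (ent i) \<le> dir i * pos c" using in_section_dir(1)[OF cV(2)] c(2) e(3) by simp
    ultimately have "dir i * pos (ent i) < dir i * pos c" by linarith
    then show ?thesis by (rule dir_X_less_pos[OF e(4) cV(1)])
  qed
qed

lemma neighbour_towards:
  assumes d: "d = 1 \<or> d = (- 1 :: real)" and s: "s \<in> SP" "s' \<in> SP" "end_cut s = end_cut s'" "d * \<tau> s < d * \<tau> s'"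
  obtains u where "u \<in> SP" "consecutive u s' \<or> consecutive s' u" "d * \<tau> s \<le> d * \<tau> u" "d * \<tau> u < d * \<tau> s'"
    "\<And>w. w \<in> SP \<Longrightarrow> d * \<tau> w < d * \<tau> s' \<Longrightarrow> d * \<tau> w \<le> d * \<tau> u"
  using d
proof
  assume d: "d = 1"
  obtain u where u: "consecutive u s'" "\<tau> s \<le> \<tau> u" using predecessor_exists[OF s(1-3)] s(4) d by auto
  have "\<tau> w \<le> \<tau> u" if "w \<in> SP" "\<tau> w < \<tau> s'" for w using not_between_consecutive[OF u(1) that(1)] that(2) by simp
  then show thesis using u consecutiveD[OF u(1)] d by (intro that[of u]) auto
next
  assume d: "d = - 1"
  obtain u where u: "consecutive s' u" "\<tau> u \<le> \<tau> s" using successor_exists[OF s(2,1) s(3)[symmetric]] s(4) d by auto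
  have "\<tau> u \<le> \<tau> w" if "w \<in> SP" "\<tau> s' < \<tau> w" for w using not_between_consecutive[OF u(1) that(1)] that(2) by simp
  then show thesis using u consecutiveD[OF u(1)] d by (intro that[of u]) auto
qed

lemma before_exit:
  assumes i: "i \<in> J" "has_succ i" and c: "c \<in> V" "in_section c" "idx c = i" "sp c \<noteq> sp (ext i)"
  shows "dir i * pos c < dir i * pos (ext i)"
proof -
  have "dir i * pos c \<noteq> dir i * pos (ext i)" using pos_eq_iff[OF c(1) ext_V[OF i(1)]] c(4) dir_cases[of i] by auto
  moreover have "dir i * pos c \<le> dir i * pos (ext i)" using in_section_dir(2)[OF c(2)] c(3) ext_section[OF i] by simp
  ultimately show ?thesis by linarith
qed

definition last_in_section :: "'v \<Rightarrow> bool" where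
  "last_in_section a \<longleftrightarrow> a \<in> Q \<and> (\<forall>c\<in>Q. idx c = idx a \<longrightarrow> dir (idx a) * X c \<le> dir (idx a) * X a)"

lemma last_in_sectionD:
  assumes "last_in_section a"
  shows "a \<in> Q" "a \<in> V" "in_section a" "idx a \<in> J"
    and "c \<in> Q \<Longrightarrow> idx c = idx a \<Longrightarrow> \<not> dir (idx a) * X a < dir (idx a) * X c"
proof -
  show "a \<in> Q" and aV: "a \<in> V" "in_section a" using assms unfolding last_in_section_def Q_def by blast+
  show "idx a \<in> J" using in_section_idx[OF aV(2)] by blast
  show "\<not> dir (idx a) * X a < dir (idx a) * X c" if "c \<in> Q" "idx c = idx a"
    using assms that unfolding last_in_section_def by force
qed

lemma last_is_anchored_spine:
  assumes a: "last_in_section a"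
    and c: "c \<in> SP" "in_section c" "anchored c" "idx c = idx a" "dir (idx a) * pos a \<le> dir (idx a) * \<tau> c"
  shows "a = c"
proof -
  have V: "a \<in> V" "c \<in> V" and cQ: "c \<in> Q" using last_in_sectionD[OF a] c SP_V SP_in_Q by auto
  have last: "\<not> dir (idx a) * X a < dir (idx a) * X c" by (rule last_in_sectionD(5)[OF a cQ c(4)])
  then have "dir (idx a) * pos a = dir (idx a) * pos c"
    using dir_X_less_pos[OF V, of "idx a"] c(5) pos_SP[OF c(1)] by force
  then have sp: "sp a = c" using pos_eq_iff[OF V] dir_cases[of "idx a"] sp_id[OF c(1)] by auto
  then have "\<not> entry_leaf a"
    using entry_leaf_offset[of a] dir_X_less_offset[OF V, of "idx a"] last c(1) sp_id by auto
  moreover have "anchored a" using anchored_sp[OF V(1)] sp c(3) by simp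
  ultimately have "a \<in> SP" using Q_anchored_iff[OF last_in_sectionD(1)[OF a]] by blast
  then show ?thesis using sp sp_id by simp
qed

lemma last_is_exit_leaf:
  assumes a: "last_in_section a" and x: "has_succ (idx a)" "ext (idx a) \<notin> SP" "\<not> anchored (ext (idx a))"
  shows "a = ext (idx a)"
proof -
  define i where "i = idx a"
  note aD = last_in_sectionD[OF a, folded i_def]
  have x': "ext i \<in> V" "in_section (ext i)" "idx (ext i) = i" "ext i \<notin> SP" "\<not> anchored (ext i)"
    using ext_V ext_section aD(4) x unfolding i_def by auto
  then have exit: "ext i \<in> Q" "exit_leaf (ext i)"
    using x(1) unfolding Q_def exit_leaf_def in_section_def i_def by auto
  then have last: "\<not> dir i * X a < dir i * X (ext i)" using aD(5) x'(3) by blast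
  then have sp: "sp a = sp (ext i)"
    using before_exit[OF aD(4) _ aD(2,3)] dir_X_less_pos[OF aD(2) x'(1), of i] x(1) unfolding i_def by blast
  then have offset: "\<not> dir i * offset a < dir i * offset (ext i)"
    using last dir_X_less_offset[OF aD(2) x'(1)] by blast
  have "\<not> anchored a" using anchored_sp[OF aD(2)] anchored_sp[OF x'(1)] sp x'(5) by simp
  then have "side a = dir i" "side (ext i) = dir i" "a \<notin> SP"
    using aD(1,3) x' entry_leafD(5) Q_anchored_iff[OF aD(1)] unfolding side_def i_def by auto
  then have "exit_leaf a"
    using offset x'(4) exit(2) spread(2)[of a] dir_cases[of i] unfolding offset_def by (auto split: if_splits)
  then show ?thesis unfolding exit_leaf_def by simp
qed

lemma last_adj_exit_spine:
  assumes a: "last_in_section a" and x: "has_succ (idx a)" "ext (idx a) \<in> SP" "\<not> anchored (ext (idx a))"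
    and sp: "sp a \<noteq> ext (idx a)"
  shows "adj a (ext (idx a))"
proof -
  define i where "i = idx a"
  note aD = last_in_sectionD[OF a, folded i_def]
  let ?x = "ext i"
  have x': "in_section ?x" "idx ?x = i" "?x \<in> SP" "sp ?x = ?x" "\<not> anchored ?x"
    using ext_section[OF aD(4)] x sp_id unfolding i_def by auto
  note anchor = anchor_section[OF aD(4)]
  have before: "dir i * pos z < dir i * \<tau> ?x" if "z \<in> V" "in_section z" "idx z = i" "sp z \<noteq> ?x" for z
    using before_exit[OF aD(4) _ that(1-3)] that(4) x(1) x'(3,4) pos_SP unfolding i_def by simp
  have "dir i * \<tau> (anchor i) < dir i * \<tau> ?x"
    using before[OF SP_V[OF anchor(1)] anchor(2,3)] anchor(1,4) x'(5) sp_id pos_SP by fastforce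
  moreover have "end_cut (anchor i) = end_cut ?x"
    using in_section_same_cut[OF anchor(2) x'(1)] anchor(3) x'(2) by simp
  ultimately obtain u where u: "u \<in> SP" "consecutive u ?x \<or> consecutive ?x u"
      "dir i * \<tau> (anchor i) \<le> dir i * \<tau> u" "dir i * \<tau> u < dir i * \<tau> ?x"
      "\<And>w. w \<in> SP \<Longrightarrow> dir i * \<tau> w < dir i * \<tau> ?x \<Longrightarrow> dir i * \<tau> w \<le> dir i * \<tau> u"
    using neighbour_towards[OF dir_cases anchor(1) x'(3)] by blast
  have "pos (anchor i) \<le> pos u \<and> pos u \<le> pos ?x \<or> pos ?x \<le> pos u \<and> pos u \<le> pos (anchor i)"
    using u(3,4) dir_cases[of i] pos_SP[OF anchor(1)] pos_SP[OF u(1)] pos_SP[OF x'(3)] by auto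
  then have "in_section u \<and> idx u = i"
    using in_section_between[OF anchor(2) x'(1)] in_section_between[OF x'(1) anchor(2)] anchor(3) x'(2) by auto
  moreover have "anchored u" using anchored_consecutive[of u ?x] anchored_consecutive[of ?x u] u(2) x'(5) by blast
  moreover have "dir i * pos a \<le> dir i * \<tau> u"
    using u(5)[OF sp_SP[OF aD(2)]] before[OF aD(2,3)] sp \<tau>_sp unfolding i_def by simp
  ultimately have "a = u" using last_is_anchored_spine[OF a u(1)] unfolding i_def by blast
  then show ?thesis using u(2) consecutive_adj adj_sym unfolding i_def by blast
qed

lemma last_next_to_exit:
  assumes a: "last_in_section a" and i: "has_succ (idx a)"
  shows "a = ext (idx a) \<or> adj a (ext (idx a))"
proof -
  define x where "x = ext (idx a)"
  note aD = last_in_sectionD[OF a]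
  have x: "x \<in> V" "in_section x" "idx x = idx a" "pos x = exit (idx a)"
    using ext_V ext_section aD(4) i unfolding x_def by auto
  consider "anchored x" | "\<not> anchored x" "x \<notin> SP" | "\<not> anchored x" "x \<in> SP" "sp a = x"
    | "\<not> anchored x" "x \<in> SP" "sp a \<noteq> x" by blast
  then have "a = x \<or> adj a x"
  proof cases
    case 1
    have "dir (idx a) * pos a \<le> dir (idx a) * \<tau> (sp x)"
      using in_section_dir(2)[OF aD(3)] x(4) \<tau>_sp by simp
    then have "a = sp x"
      using last_is_anchored_spine[OF a sp_SP[OF x(1)]] in_section_sp anchored_sp idx_sp x 1 by simp
    then show ?thesis using sp_adj[OF x(1)] adj_sym sp_id[of x] by metis
  next
    case 2
    then show ?thesis using last_is_exit_leaf[OF a i] unfolding x_def by blast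
  next
    case 3
    have "a \<noteq> x" using SP_in_Q[OF 3(2)] 3(1) aD(1) by auto
    then show ?thesis using sp_adj[OF aD(2)] 3 sp_id by metis
  next
    case 4
    then show ?thesis using last_adj_exit_spine[OF a i] unfolding x_def by blast
  qed
  then show ?thesis unfolding x_def .
qed

lemma stranding: "stranding V SP adj sp \<tau> E J ent ext X A Q"
proof
  show "A \<union> Q = V" "A \<inter> Q = {}" unfolding A_def Q_def by auto
  show "in_section q" if "q \<in> Q" for q using that unfolding Q_def by blast
  show "\<exists>q\<in>Q. q \<in> SP \<and> idx q = i" if "i \<in> J" for i
    using anchor_section[OF that] SP_in_Q by (intro bexI[of _ "anchor i"]) auto
  show "adj_sq a b"
    if ij: "i \<in> J" "j \<in> J" "i < j" "\<forall>k\<in>J. \<not> (i < k \<and> k < j)"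
      and a: "a \<in> Q" "idx a = i" "\<forall>c\<in>Q. idx c = i \<longrightarrow> dir i * X c \<le> dir i * X a"
      and b: "b \<in> Q" "idx b = j" "\<forall>c\<in>Q. idx c = j \<longrightarrow> dir j * X b \<le> dir j * X c" for i j a b
  proof -
    have j: "has_pred j" and i: "has_succ i" using ij unfolding has_pred_def has_succ_def by auto
    have "\<not> dir j * X (ent j) < dir j * X b" using b(3) ent_in_Q[OF ij(2) j] ent_section[OF ij(2) j] by force
    then have "b = ent j" using ent_first_in_section[OF ij(2) j b(1,2)] by blast
    moreover have "last_in_section a" using a unfolding last_in_section_def by blast
    then have "a = ext i \<or> adj a (ext i)" using last_next_to_exit i a(2) by blast
    moreover have "a \<noteq> b" using a(2) b(2) ij(3) by auto
    ultimately show ?thesis using bridge[OF ij] unfolding adj_sq_def by blast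
  qed
qed (fact A_alternates Q_alternates)+

end

theorem (in spine) strand_pair_exists:
  "\<exists>A f Q g a\<^sub>1 b\<^sub>1 a\<^sub>2 b\<^sub>2. strand_pair V SP adj sp \<tau> E A f Q g a\<^sub>1 b\<^sub>1 a\<^sub>2 b\<^sub>2"
proof -
  obtain J ent ext where "routed V SP adj sp \<tau> E J ent ext" using route_exists by blast
  moreover obtain parity :: "'v \<Rightarrow> bool" where "\<forall>s u. consecutive s u \<longrightarrow> parity s \<noteq> parity u" using parity_exists by blast
  moreover obtain width where "\<And>s. s \<in> SP \<Longrightarrow> 0 < width s \<and> width s \<le> 1/4 \<and>
      (\<forall>s'\<in>SP. s' \<noteq> s \<longrightarrow> 3 * width s \<le> \<bar>\<tau> s - \<tau> s'\<bar>) \<and> (\<forall>e\<in>E. 3 * width s \<le> \<bar>\<tau> s - e\<bar>)"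
    using width_exists by metis
  moreover obtain spread :: "'v \<Rightarrow> real" where "\<forall>z. 0 < spread z \<and> spread z < 1/2"
      "\<forall>s\<in>SP. inj_on spread {z \<in> V. sp z = s}"
    using spread_exists by blast
  ultimately have "coloured V SP adj sp \<tau> E J ent ext parity width spread"
    by (simp add: coloured_def coloured_axioms_def)
  then interpret coloured V SP adj sp \<tau> E J ent ext parity width spread .
  interpret stranding V SP adj sp \<tau> E J ent ext X A Q by (rule stranding)
  show ?thesis using strand_pair_of_stranding by blast
qed

subsection \<open>Closing up the two strands\<close>

lemma islimpt_discrete_Un:
  fixes f :: "'b \<Rightarrow> real"
  assumes "closed L" "t \<notin> L" "\<epsilon> > 0" "finite {x \<in> S. \<bar>f x - t\<bar> < \<epsilon>}"
  shows "\<not> t islimpt (f ` S \<union> L)"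
proof -
  have "f ` S \<inter> ball t \<epsilon> = f ` {x \<in> S. \<bar>f x - t\<bar> < \<epsilon>}" by (auto simp: dist_real_def abs_minus_commute)
  then have "finite (f ` S \<inter> ball t \<epsilon>)" using assms(4) by simp
  then have "\<not> t islimpt f ` S" using assms(3) unfolding islimpt_eq_infinite_ball by blast
  moreover have "\<not> t islimpt L" using assms(1,2) closed_limpt by blast
  ultimately show ?thesis by (simp add: islimpt_Un)
qed

text \<open>The square of the graph is abstracted to a graph \<open>H\<close> that contains its edges and has an end
  \<open>w e\<close> for every \<open>e\<close> in \<open>E\<close>.\<close>

locale realised = spine V SP adj sp \<tau> E + H: lf_graph H
  for V SP :: "'v set" and adj sp \<tau> E and H :: "'v graph" +
  fixes w :: "real \<Rightarrow> (nat \<Rightarrow> 'v) set"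
  assumes vertices: "fst H = V" and edges: "adj_sq u v \<Longrightarrow> {u, v} \<in> snd H"
    and ends: "e \<in> E \<Longrightarrow> w e \<in> ends H" and ends_inj: "inj_on w E"
    and ends_near: "e \<in> E \<Longrightarrow> finite S \<Longrightarrow> S \<subseteq> V \<Longrightarrow> C \<in> comps H S \<Longrightarrow> lives_in (w e) C \<Longrightarrow>
      \<exists>\<delta>>0. (\<forall>z\<in>V. \<bar>pos z - e\<bar> < \<delta> \<longrightarrow> z \<in> C) \<and> (\<forall>e'\<in>E. \<bar>e' - e\<bar> < \<delta> \<longrightarrow> lives_in (w e') C)"

locale realised_strand = realised V SP adj sp \<tau> E H w + strand V SP adj sp \<tau> E B f L
  for V SP :: "'v set" and adj sp \<tau> E and H :: "'v graph" and w B f L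
begin

definition label :: "real \<Rightarrow> 'v fpoint" where
  "label t = (if t \<in> f ` B then Gp (vertex_pt (inv_into B f t)) else Ep (w t))"

lemma label_vertex: "b \<in> B \<Longrightarrow> label (f b) = Gp (vertex_pt b)"
  using strand_inj by (simp add: label_def)

lemma label_end: "e \<in> L \<Longrightarrow> label e = Ep (w e)"
  using strand_not_L by (auto simp: label_def)

lemma label_inj: "inj_on label (f ` B \<union> L)"
proof (rule inj_onI)
  fix x y assume xy: "x \<in> f ` B \<union> L" "y \<in> f ` B \<union> L" "label x = label y"
  show "x = y"
  proof (cases "x \<in> L \<and> y \<in> L")
    case True
    then show ?thesis using xy(3) label_end[of x] label_end[of y] inj_onD[OF ends_inj, of x y] strand_L(1) by auto
  next
    case False
    then show ?thesis using xy label_vertex label_end by auto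
  qed
qed

lemma label_cases:
  "z \<in> f ` B \<union> L \<Longrightarrow> (\<exists>v\<in>fst H. label z = Gp (vertex_pt v)) \<or> (\<exists>\<omega>\<in>ends H. label z = Ep \<omega>)"
  using label_vertex label_end vertices strand_V strand_L(1) ends by blast

lemma not_islimpt_strand: "t \<notin> L \<Longrightarrow> \<not> t islimpt (f ` B \<union> L)"
  using islimpt_discrete_Un[OF strand_L(2)] strand_discrete by blast

lemma label_near_end:
  assumes e: "e \<in> L" and N: "basic_nbhd H (Ep (w e)) N"
  shows "\<exists>\<delta>>0. \<forall>x\<in>f ` B \<union> L. \<bar>x - e\<bar> < \<delta> \<longrightarrow> label x \<in> N"
proof -
  obtain S C where S: "finite S" "S \<subseteq> V" "C \<in> comps H S" "lives_in (w e) C" "N = end_nbhd H S C"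
    using N unfolding basic_nbhd_def vertices by blast
  have eE: "e \<in> E" using e strand_L(1) by blast
  obtain \<delta> where \<delta>: "\<delta> > 0" "\<And>z. z \<in> V \<Longrightarrow> \<bar>pos z - e\<bar> < \<delta> \<Longrightarrow> z \<in> C"
    "\<And>e'. e' \<in> E \<Longrightarrow> \<bar>e' - e\<bar> < \<delta> \<Longrightarrow> lives_in (w e') C"
    using ends_near[OF eE S(1-4)] by blast
  obtain \<eta> where \<eta>: "\<eta> > 0" "\<And>b. b \<in> B \<Longrightarrow> \<bar>f b - e\<bar> < \<eta> \<Longrightarrow> \<bar>pos b - e\<bar> < \<delta>"
    using strand_limit[OF e \<delta>(1)] by blast
  have "label x \<in> N" if x: "x \<in> f ` B \<union> L" "\<bar>x - e\<bar> < min \<delta> \<eta>" for x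
    using x(1)
  proof
    assume "x \<in> f ` B"
    then obtain b where b: "b \<in> B" "x = f b" by blast
    then have "b \<in> C" using \<delta>(2) \<eta>(2) x(2) strand_V by auto
    then show ?thesis unfolding b(2) label_vertex[OF b(1)] S(5) H.vertex_in_end_nbhd[OF S(3)] .
  next
    assume "x \<in> L"
    then show ?thesis using label_end \<delta>(3) x(2) strand_L(1) ends unfolding S(5) by (auto simp: H.end_in_end_nbhd)
  qed
  then show ?thesis using \<delta>(1) \<eta>(1) by (intro exI[of _ "min \<delta> \<eta>"]) auto
qed

lemma continuous_label: "continuous_map (top_of_set (f ` B \<union> L)) H.FT label"
  unfolding continuous_map_top_of_set_iff limitin_def
proof (intro ballI conjI allI impI)
  fix t assume t: "t \<in> f ` B \<union> L"
  then show "label t \<in> topspace H.FT" using label_cases[OF t] H.vertex_gpt by (auto simp: fpoints_def)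
  fix U assume U: "openin H.FT U \<and> label t \<in> U"
  show "\<forall>\<^sub>F x in at t within f ` B \<union> L. label x \<in> U"
  proof (cases "t \<in> L")
    case False
    then have "at t within f ` B \<union> L = bot" using not_islimpt_strand by (simp add: trivial_limit_within)
    then show ?thesis by simp
  next
    case True
    then obtain N where N: "basic_nbhd H (Ep (w t)) N" "N \<subseteq> U" using U label_end unfolding H.openin_FT by auto
    then show ?thesis using label_near_end[OF True N(1)] unfolding eventually_at dist_real_def by blast
  qed
qed

lemma strand_trace: "curve_trace H (f ` B \<union> L) label"
proof
  have "bounded L" using E_unit strand_L(1) bounded_closed_interval by (metis bounded_subset)
  moreover have "closed (f ` B \<union> L)" using not_islimpt_strand unfolding closed_limpt by blast
  ultimately show "compact (f ` B \<union> L)" using strand_bounded by (simp add: compact_eq_bounded_closed)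
next
  fix z v assume "z \<in> f ` B \<union> L" "label z = Gp (vertex_pt v)"
  then have "z \<notin> L" using label_end[of z] by auto
  then show "\<not> z islimpt (f ` B \<union> L)" by (rule not_islimpt_strand)
next
  fix s t assume "s \<in> f ` B \<union> L" "t \<in> f ` B \<union> L" "s < t" "{s<..<t} \<inter> (f ` B \<union> L) = {}"
  then obtain a b where "a \<in> B" "b \<in> B" "s = f a" "t = f b" "adj_sq a b" using strand_consecutive by blast
  then show "\<exists>u v. label s = Gp (vertex_pt u) \<and> label t = Gp (vertex_pt v) \<and> {u, v} \<in> snd H"
    using label_vertex edges by blast
qed (fact label_cases continuous_label)+

end

theorem (in realised) hamiltonian:
  assumes three: "\<exists>a\<in>V. \<exists>b\<in>V. \<exists>c\<in>V. a \<noteq> b \<and> a \<noteq> c \<and> b \<noteq> c"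
  shows "hamiltonian H"
proof -
  obtain A f Q g a\<^sub>1 b\<^sub>1 a\<^sub>2 b\<^sub>2 where "strand_pair V SP adj sp \<tau> E A f Q g a\<^sub>1 b\<^sub>1 a\<^sub>2 b\<^sub>2"
    using strand_pair_exists by blast
  then interpret strand_pair V SP adj sp \<tau> E A f Q g a\<^sub>1 b\<^sub>1 a\<^sub>2 b\<^sub>2 .
  interpret A: realised_strand V SP adj sp \<tau> E H w A f E ..
  interpret Q: realised_strand V SP adj sp \<tau> E H w Q g "E \<inter> {0, 1}" ..
  have linked: "H.linked (Gp (vertex_pt a)) (Gp (vertex_pt q))" "H.linked (Gp (vertex_pt q)) (Gp (vertex_pt a))"
    if "adj_sq a q" for a q
    using edges[OF that] edges[OF adj_sq_sym[OF that]] unfolding H.linked_def by blast+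
  show ?thesis
  proof (rule H.hamiltonian_of_two_traces)
    show "A.label a\<^sub>1 = Q.label a\<^sub>2 \<or> H.linked (A.label a\<^sub>1) (Q.label a\<^sub>2)"
      using start A.label_vertex A.label_end Q.label_vertex Q.label_end linked by (auto split: if_splits)
    show "A.label b\<^sub>1 = Q.label b\<^sub>2 \<or> H.linked (Q.label b\<^sub>2) (A.label b\<^sub>1)"
      using finish A.label_vertex A.label_end Q.label_vertex Q.label_end linked by (auto split: if_splits)
    show "x = a\<^sub>1 \<and> y = a\<^sub>2 \<or> x = b\<^sub>1 \<and> y = b\<^sub>2"
      if xy: "x \<in> f ` A \<union> E" "y \<in> g ` Q \<union> E \<inter> {0, 1}" "A.label x = Q.label y" for x y
    proof -
      have "x \<in> E \<and> y \<in> E \<inter> {0, 1} \<and> w x = w y"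
        using xy A.label_vertex A.label_end Q.label_vertex Q.label_end partition(2) by auto
      then have "x = y" "y \<in> E \<inter> {0, 1}" using inj_onD[OF ends_inj] by auto
      then show ?thesis using start finish by auto
    qed
    show "Gp (vertex_pt v) \<in> A.label ` (f ` A \<union> E) \<union> Q.label ` (g ` Q \<union> E \<inter> {0, 1})" if "v \<in> fst H" for v
      using that partition(1) A.label_vertex Q.label_vertex unfolding vertices by (metis Un_iff imageI)
  qed (use A.strand_trace Q.strand_trace A.label_inj Q.label_inj ends_in within three vertices in auto)
qed

subsection \<open>Ends of the square\<close>

lemma fst_square [simp]: "fst (graph_square G) = fst G"
  unfolding graph_square_def by simp

lemma square_edge: "{u, w} \<in> snd (graph_square G) \<longleftrightarrow>
    {u, w} \<in> snd G \<or> u \<noteq> w \<and> (\<exists>v. {u, v} \<in> snd G \<and> {v, w} \<in> snd G)"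
proof
  assume "{u, w} \<in> snd (graph_square G)"
  then consider "{u, w} \<in> snd G" | a v b where "{u, w} = {a, b}" "a \<noteq> b" "{a, v} \<in> snd G" "{v, b} \<in> snd G"
    unfolding graph_square_def by auto
  then show "{u, w} \<in> snd G \<or> u \<noteq> w \<and> (\<exists>v. {u, v} \<in> snd G \<and> {v, w} \<in> snd G)"
  proof cases
    case (2 a v b)
    then show ?thesis by (auto simp: doubleton_eq_iff insert_commute)
  qed blast
qed (auto simp: graph_square_def)

lemma subset_square: "snd G \<subseteq> snd (graph_square G)"
  unfolding graph_square_def by auto

lemma ray_square: "is_ray G r \<Longrightarrow> is_ray (graph_square G) r"
  unfolding is_ray_def using subset_square by blast

context lf_graph
begin

lemma simple_square: "simple_graph (graph_square G)"
  unfolding simple_graph_def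
proof
  fix e assume "e \<in> snd (graph_square G)"
  then consider "e \<in> snd G" | a v b where "e = {a, b}" "a \<noteq> b" "{a, v} \<in> snd G" "{v, b} \<in> snd G"
    unfolding graph_square_def by auto
  then show "\<exists>u v. e = {u, v} \<and> u \<noteq> v \<and> u \<in> fst (graph_square G) \<and> v \<in> fst (graph_square G)"
  proof cases
    case 1
    then show ?thesis using simple unfolding simple_graph_def by simp
  next
    case (2 a v b)
    then show ?thesis using edge_vertices[of a v] edge_vertices[of v b] by auto
  qed
qed

lemma square_neighbour: "{v, u} \<in> snd (graph_square G) \<Longrightarrow> u \<in> closed_nbhd (closed_nbhd {v})"
  unfolding square_edge by (auto simp: closed_nbhd_def)

lemma lf_graph_square: "lf_graph (graph_square G)"
proof
  show "locally_finite (graph_square G)"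
    unfolding locally_finite_def
  proof
    fix v assume "v \<in> fst (graph_square G)"
    then have "finite (closed_nbhd (closed_nbhd {v}))"
      by (intro finite_closed_nbhd closed_nbhd_subset) auto
    moreover have "{e \<in> snd (graph_square G). v \<in> e} \<subseteq> (\<lambda>u. {v, u}) ` closed_nbhd (closed_nbhd {v})"
    proof
      fix e assume e: "e \<in> {e \<in> snd (graph_square G). v \<in> e}"
      then obtain a b where "e = {a, b}" "v \<in> {a, b}"
        using simple_square unfolding simple_graph_def by blast
      then obtain u where "e = {v, u}" by (auto simp: insert_commute)
      then show "e \<in> (\<lambda>u. {v, u}) ` closed_nbhd (closed_nbhd {v})" using e square_neighbour by blast
    qed
    ultimately show "finite {e \<in> snd (graph_square G). v \<in> e}" by (meson finite_imageI finite_subset)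
  qed
qed (rule simple_square)

lemma reach_of_square:
  assumes "reach (graph_square G) (fst G - closed_nbhd S) x y"
  shows "reach G (fst G - S) x y"
  using assms unfolding reach_def[of "graph_square G"]
proof (induction rule: rtranclp_induct)
  case base
  show ?case by (simp add: reach_def)
next
  case (step y z)
  have yz: "y \<in> fst G - S" "z \<in> fst G - S" using step(2) subset_closed_nbhd by blast+
  have "{y, z} \<in> snd G \<or> (\<exists>v. {y, v} \<in> snd G \<and> {v, z} \<in> snd G)" using step(2) unfolding square_edge by blast
  then have "reach G (fst G - S) y z"
  proof
    assume "{y, z} \<in> snd G"
    then show ?thesis by (rule reach_edge[OF _ yz])
  next
    assume "\<exists>v. {y, v} \<in> snd G \<and> {v, z} \<in> snd G"
    then obtain v where v: "{y, v} \<in> snd G" "{v, z} \<in> snd G" by blast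
    have "v \<notin> S" using step(2) v(1) closed_nbhd_edge[of v S y] by (auto simp: insert_commute)
    then have vS: "v \<in> fst G - S" using edge_vertices v by blast
    show ?thesis by (rule reach_trans[OF reach_edge[OF v(1) yz(1) vS] reach_edge[OF v(2) vS yz(2)]])
  qed
  then show ?case by (rule reach_trans[OF step(3)])
qed

lemma ray_equiv_square:
  assumes "ray_equiv G r s" "is_ray G r"
  shows "ray_equiv (graph_square G) r s"
  unfolding ray_equiv_def
proof (intro allI impI)
  interpret sq: lf_graph "graph_square G" by (rule lf_graph_square)
  fix S assume S: "finite S \<and> S \<subseteq> fst (graph_square G)"
  then obtain C where C: "C \<in> comps G S" "tail_in r C" "tail_in s C"
    using assms(1) unfolding ray_equiv_def by auto
  obtain D where D: "D \<in> comps (graph_square G) S" "tail_in r D"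
    using sq.ray_comp[OF ray_square[OF assms(2)]] S by blast
  obtain x where "x \<in> C" "x \<in> D" using tail_in_common[OF C(2) D(2)] by blast
  then have "C \<subseteq> D" using comp_mono[OF C(1) D(1) subset_square] by simp
  then show "\<exists>C\<in>comps (graph_square G) S. tail_in r C \<and> tail_in s C" using C(3) D tail_in_mono by blast
qed

lemma ray_equiv_of_square:
  assumes "ray_equiv (graph_square G) r s" "is_ray G r"
  shows "ray_equiv G r s"
  unfolding ray_equiv_def
proof (intro allI impI)
  fix S assume S: "finite S \<and> S \<subseteq> fst G"
  then have "finite (closed_nbhd S) \<and> closed_nbhd S \<subseteq> fst (graph_square G)"
    using finite_closed_nbhd closed_nbhd_subset by simp
  then obtain C where C: "C \<in> comps (graph_square G) (closed_nbhd S)" "tail_in r C" "tail_in s C"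
    using assms(1) unfolding ray_equiv_def by blast
  obtain D where D: "D \<in> comps G S" "tail_in r D" using ray_comp[OF assms(2)] S by blast
  obtain x where x: "x \<in> C" "x \<in> D" using tail_in_common[OF C(2) D(2)] by blast
  have "C \<subseteq> D"
  proof
    fix y assume "y \<in> C"
    then have "reach (graph_square G) (fst G - closed_nbhd S) x y" using comp_reach[OF C(1) x(1)] by simp
    then show "y \<in> D" using comp_closed[OF D(1) x(2)] reach_of_square by blast
  qed
  then show "\<exists>C\<in>comps G S. tail_in r C \<and> tail_in s C" using D C tail_in_mono by blast
qed

definition square_end :: "(nat \<Rightarrow> 'v) set \<Rightarrow> (nat \<Rightarrow> 'v) set" where
  "square_end \<omega> = {s. is_ray (graph_square G) s \<and> (\<exists>r\<in>\<omega>. ray_equiv (graph_square G) r s)}"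

lemma square_end_eq:
  assumes "\<omega> \<in> ends G" "r \<in> \<omega>"
  shows "square_end \<omega> = {s. is_ray (graph_square G) s \<and> ray_equiv (graph_square G) r s}"
proof -
  have "ray_equiv (graph_square G) r r'" if "r' \<in> \<omega>" for r'
    using end_eq[OF assms] that ray_equiv_square end_ray[OF assms] by blast
  then show ?thesis unfolding square_end_def using assms(2) ray_equiv_trans by blast
qed

lemma square_end_in_ends:
  assumes "\<omega> \<in> ends G"
  shows "square_end \<omega> \<in> ends (graph_square G)"
proof -
  obtain r where r: "r \<in> \<omega>" using end_nonempty assms by blast
  then have "is_ray (graph_square G) r" using end_ray[OF assms] ray_square by blast
  then show ?thesis unfolding square_end_eq[OF assms r] ends_def by blast
qed

lemma subset_square_end:
  assumes "\<omega> \<in> ends G"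
  shows "\<omega> \<subseteq> square_end \<omega>"
proof
  fix r assume r: "r \<in> \<omega>"
  then have "is_ray G r" by (rule end_ray[OF assms])
  then have "is_ray (graph_square G) r" "ray_equiv (graph_square G) r r"
    using ray_square ray_equiv_square ray_equiv_refl by blast+
  then show "r \<in> square_end \<omega>" unfolding square_end_def using r by blast
qed

lemma square_end_inj: "inj_on square_end (ends G)"
proof (rule inj_onI)
  fix \<omega> \<omega>' assume \<omega>: "\<omega> \<in> ends G" "\<omega>' \<in> ends G" "square_end \<omega> = square_end \<omega>'"
  obtain r r' where r: "r \<in> \<omega>" "r' \<in> \<omega>'" using end_nonempty \<omega> by blast
  have "r' \<in> square_end \<omega>" using subset_square_end[OF \<omega>(2)] r(2) \<omega>(3) by blast
  then have "ray_equiv (graph_square G) r r'" unfolding square_end_eq[OF \<omega>(1) r(1)] by blast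
  then have "ray_equiv G r r'" by (rule ray_equiv_of_square[OF _ end_ray[OF \<omega>(1) r(1)]])
  then show "\<omega> = \<omega>'" by (rule ends_disjoint[OF \<omega>(1,2) r])
qed

lemma square_end_lives_in:
  assumes \<omega>: "\<omega> \<in> ends G" "lives_in \<omega> C" and C: "finite S" "S \<subseteq> fst G" "C \<in> comps (graph_square G) S"
  shows "lives_in (square_end \<omega>) C"
proof -
  obtain r where r: "r \<in> \<omega>" using end_nonempty \<omega>(1) by blast
  show ?thesis
  proof (rule end_lives_inI[OF square_end_in_ends[OF \<omega>(1)] _ C(1) _ C(3)])
    show "r \<in> square_end \<omega>" using subset_square_end[OF \<omega>(1)] r by blast
  qed (use \<omega>(2) r C(2) in simp_all)
qed

subsection \<open>Standard subspaces\<close>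

lemma graph_pts_subset: "graph_pts G F \<subseteq> std_closure G F"
  unfolding std_closure_def by (rule closure_of_subset) (auto simp: graph_pts_def fpoints_def)

lemma std_closure_subset: "std_closure G F \<subseteq> fpoints G"
  unfolding std_closure_def using closure_of_subset_topspace[of FT] by simp

lemma std_closure_gpt: "Gp p \<in> std_closure G F \<Longrightarrow> is_gpt G p"
  using subsetD[OF std_closure_subset, of "Gp p" F] by (auto simp: fpoints_def)

lemma std_closure_support:
  assumes "Gp p \<in> std_closure G F"
  shows "\<exists>q. Gp q \<in> graph_pts G F \<and> {w. p w \<noteq> 0} \<subseteq> {w. q w \<noteq> 0}"
proof -
  have p: "is_gpt G p" by (rule std_closure_gpt[OF assms])
  then obtain S where S: "finite S" "S \<subseteq> fst G" "S = {w. p w \<noteq> 0}" using gpt_support_sum by blast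
  let ?U = "(\<Inter>w\<in>S. {x \<in> topspace FT. coord w x \<in> - {0}}) \<inter> topspace FT"
  have "openin FT ?U"
    using S(2) by (intro openin_INT openin_continuous_map_preimage[OF continuous_coord] S(1)) auto
  moreover have "Gp p \<in> ?U" using p S(3) by (auto simp: fpoints_def)
  ultimately obtain x where x: "x \<in> graph_pts G F" "x \<in> ?U"
    using assms unfolding std_closure_def in_closure_of by blast
  then obtain q where "x = Gp q" unfolding graph_pts_def by blast
  then show ?thesis using x S(3) by auto
qed

lemma vertex_in_std_closure:
  assumes "subgraph F G" "Gp (vertex_pt v) \<in> std_closure G F"
  shows "v \<in> fst F"
proof -
  obtain q where q: "Gp q \<in> graph_pts G F" "{w. vertex_pt v w \<noteq> 0} \<subseteq> {w. q w \<noteq> 0}"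
    using std_closure_support[OF assms(2)] by blast
  then have v: "v \<in> {w. q w \<noteq> 0}" by simp
  consider "{w. q w \<noteq> 0} \<in> snd F" | x where "x \<in> fst F" "{w. q w \<noteq> 0} = {x}"
    using q(1) unfolding graph_pts_def by blast
  then show ?thesis
  proof cases
    case 1
    then have "{w. q w \<noteq> 0} \<subseteq> fst F" using assms(1) unfolding subgraph_def by simp
    then show ?thesis using v by (rule subsetD)
  next
    case 2
    then show ?thesis using v by simp
  qed
qed

lemma edge_in_std_closure:
  assumes "Gp p \<in> std_closure G F" "{w. p w \<noteq> 0} = {u, v}" "u \<noteq> v"
  shows "{u, v} \<in> snd F"
proof -
  obtain q where q: "Gp q \<in> graph_pts G F" "{u, v} \<subseteq> {w. q w \<noteq> 0}"
    using std_closure_support[OF assms(1)] assms(2) by auto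
  then have "is_gpt G q" unfolding graph_pts_def by blast
  then have "{w. q w \<noteq> 0} = {u, v}"
  proof (cases rule: gpt_cases)
    case (vertex x)
    then show ?thesis using q(2) assms(3) by (auto simp: vertex_pt_def split: if_splits)
  next
    case (edge x y)
    then show ?thesis using q(2) assms(3) by auto
  qed
  then show ?thesis using q(1) assms(3) unfolding graph_pts_def by auto
qed

lemma openin_gpts: "openin FT (Gp ` {p. is_gpt G p})"
  unfolding openin_FT
proof (intro conjI ballI)
  fix x assume "x \<in> Gp ` {p. is_gpt G p}"
  then obtain p where "x = Gp p" "is_gpt G p" by blast
  then show "\<exists>N. basic_nbhd G x N \<and> N \<subseteq> Gp ` {p. is_gpt G p}"
    using basic_nbhd_Gp[of p 1] by (intro exI[of _ "vball G p 1"]) (auto simp: vball_def)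
qed (auto simp: fpoints_def)

end

lemma arc_connected_in_IVT:
  assumes S: "arc_connected_in X S" "x \<in> S" "y \<in> S" and f: "continuous_map X euclideanreal f" "f x < c" "c < f y"
  shows "\<exists>z\<in>S. f z = c"
proof -
  have "x \<noteq> y" using f(2,3) by auto
  then obtain A g where g: "A \<subseteq> S" "homeomorphic_map (top_of_set {0..1::real}) (subtopology X A) g" "g 0 = x" "g 1 = y"
    using S unfolding arc_connected_in_def by blast
  have cont: "continuous_map (top_of_set {0..1}) (subtopology X A) g" using g(2) homeomorphic_imp_continuous_map by blast
  have "continuous_map (top_of_set {0..1}) euclideanreal (f \<circ> g)"
    using continuous_map_into_fulltopology[OF cont] f(1) by (rule continuous_map_compose)
  then have "continuous_on {0..1} (f \<circ> g)" by simp
  then obtain t where t: "0 \<le> t" "t \<le> 1" "f (g t) = c" using IVT'[of "f \<circ> g" 0 c 1] f(2,3) g(3,4) by auto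
  then have "g t \<in> A" using continuous_map_image_subset_topspace[OF cont] by auto
  then show ?thesis using g(1) t(3) by blast
qed

subsection \<open>The spine of a topological caterpillar\<close>

locale caterpillar = lf_graph +
  fixes T :: "'a graph" and h :: "real \<Rightarrow> 'a fpoint"
  assumes graph_connected: "connected_graph G"
    and three: "\<exists>a\<in>fst G. \<exists>b\<in>fst G. \<exists>c\<in>fst G. a \<noteq> b \<and> a \<noteq> c \<and> b \<noteq> c"
    and subgraph_T: "subgraph T G" and arc_connected: "arc_connected_in FT (std_closure G T)"
    and spanning_T: "spanning G T"
    and homeomorphic: "homeomorphic_map (top_of_set {0..1}) (subtopology FT (std_closure G (del_vertices T (leaves T)))) h"
begin

abbreviation "P \<equiv> del_vertices T (leaves T)"
abbreviation "Arc \<equiv> std_closure G P"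
abbreviation "SP \<equiv> fst P"

definition h_inv :: "'a fpoint \<Rightarrow> real" where
  "h_inv = (SOME g. homeomorphic_maps (top_of_set {0..1}) (subtopology FT Arc) h g)"

definition \<tau> :: "'a \<Rightarrow> real" where "\<tau> s = h_inv (Gp (vertex_pt s))"

definition E :: "real set" where "E = {t \<in> {0..1}. \<exists>\<omega>. h t = Ep \<omega>}"

definition end_at :: "real \<Rightarrow> (nat \<Rightarrow> 'a) set" where
  "end_at t = (case h t of Gp _ \<Rightarrow> {} | Ep \<omega> \<Rightarrow> \<omega>)"

definition sp :: "'a \<Rightarrow> 'a" where "sp z = (if z \<in> SP then z else SOME u. {z, u} \<in> snd T)"

lemma fst_T: "fst T = fst G"
  using subgraph_T spanning_T vertex_in_std_closure unfolding subgraph_def spanning_def by blast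

lemma SP_eq: "SP = fst G - leaves T"
  unfolding del_vertices_def fst_T by simp

lemma subgraph_P: "subgraph P G"
  using subgraph_T unfolding subgraph_def del_vertices_def by auto

lemma P_edge: "{u, v} \<in> snd P \<Longrightarrow> {u, v} \<in> snd G \<and> u \<in> SP \<and> v \<in> SP \<and> u \<noteq> v"
  using subgraph_P edge_vertices unfolding subgraph_def by blast

lemma T_edge: "{u, v} \<in> snd T \<Longrightarrow> {u, v} \<in> snd G"
  using subgraph_T unfolding subgraph_def by blast

lemma leaf_edge:
  assumes "z \<in> leaves T"
  shows "\<exists>e. {e \<in> snd T. z \<in> e} = {e}"
  using assms unfolding leaves_def degree_def by (simp add: card_1_singleton_iff)

lemma leaf_neighbour_exists:
  assumes "z \<in> leaves T"
  shows "\<exists>u. {z, u} \<in> snd T"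
proof -
  obtain e where "{e \<in> snd T. z \<in> e} = {e}" using leaf_edge[OF assms] by blast
  then have e: "e \<in> snd T" "z \<in> e" by blast+
  then have "e \<in> snd G" using subgraph_T unfolding subgraph_def by blast
  then obtain x y where "e = {x, y}" using simple unfolding simple_graph_def by blast
  then show ?thesis using e by (auto simp: insert_commute)
qed

lemma leaf_edge_unique:
  assumes "z \<in> leaves T" "e \<in> snd T" "z \<in> e" "e' \<in> snd T" "z \<in> e'"
  shows "e = e'"
proof -
  obtain d where d: "{e \<in> snd T. z \<in> e} = {d}" using leaf_edge[OF assms(1)] by blast
  have "e \<in> {e \<in> snd T. z \<in> e}" "e' \<in> {e \<in> snd T. z \<in> e}" using assms(2-5) by simp_all
  then show ?thesis unfolding d by simp
qed

text \<open>The edge between two adjacent leaves would be isolated in \<open>T\<close>.\<close>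

lemma adjacent_leaves_coord:
  assumes leaves: "u \<in> leaves T" "v \<in> leaves T" and e: "{u, v} \<in> snd T" and x: "x \<in> std_closure G T"
  shows "coord u x + coord v x \<in> {0, 1}"
proof -
  have uv: "u \<in> fst G" "v \<in> fst G" "u \<noteq> v" using edge_vertices[OF T_edge[OF e]] by auto
  let ?f = "\<lambda>x. coord u x + coord v x"
  have "graph_pts G T \<subseteq> {x \<in> topspace FT. ?f x \<in> {0, 1}}"
  proof
    fix x assume "x \<in> graph_pts G T"
    then obtain p where p: "x = Gp p" "is_gpt G p" "{w. p w \<noteq> 0} \<in> snd T \<or> (\<exists>v\<in>fst T. {w. p w \<noteq> 0} = {v})"
      unfolding graph_pts_def by blast
    from p(2) have "p u + p v \<in> {0, 1}"
    proof (cases rule: gpt_cases)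
      case (vertex x)
      then show ?thesis using uv by (auto simp: vertex_pt_def)
    next
      case (edge a b)
      then have "{a, b} \<in> snd T" using p(3) by auto
      then have "{a, b} = {u, v}" if "p u \<noteq> 0 \<or> p v \<noteq> 0"
        using that leaf_edge_unique[OF leaves(1) _ _ e] leaf_edge_unique[OF leaves(2) _ _ e] edge(3) by auto
      then have "p u + p v = 1" if "p u \<noteq> 0 \<or> p v \<noteq> 0"
        using that edge(4) by (fastforce simp: doubleton_eq_iff)
      then show ?thesis by (cases "p u = 0 \<and> p v = 0") auto
    qed
    then show "x \<in> {x \<in> topspace FT. ?f x \<in> {0, 1}}" using p by (simp add: fpoints_def)
  qed
  moreover have "closedin FT {x \<in> topspace FT. ?f x \<in> {0, 1}}"
    using continuous_coord uv by (intro closedin_continuous_map_preimage[of _ euclideanreal] continuous_map_add) auto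
  ultimately have "std_closure G T \<subseteq> {x \<in> topspace FT. ?f x \<in> {0, 1}}"
    unfolding std_closure_def by (rule closure_of_minimal)
  then show ?thesis using x by blast
qed

lemma leaf_neighbour:
  assumes z: "z \<in> leaves T" and e: "{z, u} \<in> snd T"
  shows "u \<in> SP"
proof (rule ccontr)
  assume "u \<notin> SP"
  moreover have zu: "z \<in> fst G" "u \<in> fst G" "z \<noteq> u" using edge_vertices[OF T_edge[OF e]] by auto
  ultimately have u: "u \<in> leaves T" unfolding SP_eq by blast
  obtain w where w: "w \<in> fst G" "w \<noteq> z" "w \<noteq> u" using three by metis
  let ?f = "\<lambda>x. coord z x + coord u x"
  have "continuous_map FT euclideanreal ?f" using continuous_coord zu by (intro continuous_map_add) auto
  moreover have "Gp (vertex_pt z) \<in> std_closure G T" "Gp (vertex_pt w) \<in> std_closure G T"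
    using spanning_T zu w unfolding spanning_def by auto
  moreover have "?f (Gp (vertex_pt w)) < 1/2" "1/2 < ?f (Gp (vertex_pt z))"
    using w zu by (auto simp: vertex_pt_def)
  ultimately obtain x where "x \<in> std_closure G T" "?f x = 1/2" using arc_connected_in_IVT[OF arc_connected] by blast
  then show False using adjacent_leaves_coord[OF z u e] by force
qed

lemma sp_SP: "z \<in> fst G \<Longrightarrow> sp z \<in> SP" and sp_adj: "z \<in> fst G \<Longrightarrow> z \<notin> SP \<Longrightarrow> {z, sp z} \<in> snd G"
proof -
  assume z: "z \<in> fst G"
  have leaf: "z \<in> leaves T" "{z, sp z} \<in> snd T" if "z \<notin> SP"
  proof -
    show "z \<in> leaves T" using that z unfolding SP_eq by blast
    then show "{z, sp z} \<in> snd T" using someI_ex[OF leaf_neighbour_exists] that unfolding sp_def by simp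
  qed
  show "sp z \<in> SP" using leaf_neighbour leaf by (cases "z \<in> SP") (auto simp: sp_def)
  show "z \<notin> SP \<Longrightarrow> {z, sp z} \<in> snd G" using leaf T_edge by blast
qed

lemma finite_sp_block:
  assumes "s \<in> SP"
  shows "finite {z \<in> fst G. sp z = s}"
proof (rule finite_subset)
  show "{z \<in> fst G. sp z = s} \<subseteq> insert s {u. {s, u} \<in> snd G}"
  proof
    fix z assume "z \<in> {z \<in> fst G. sp z = s}"
    then show "z \<in> insert s {u. {s, u} \<in> snd G}"
      using sp_adj[of z] by (cases "z \<in> SP") (auto simp: sp_def insert_commute)
  qed
  show "finite (insert s {u. {s, u} \<in> snd G})" using finite_neighbours assms unfolding SP_eq by blast
qed

lemma h_inv: "homeomorphic_maps (top_of_set {0..1}) (subtopology FT Arc) h h_inv"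
proof -
  have "\<exists>g. homeomorphic_maps (top_of_set {0..1}) (subtopology FT Arc) h g"
    using homeomorphic homeomorphic_map_maps by blast
  then show ?thesis unfolding h_inv_def by (rule someI_ex)
qed

lemma continuous_h: "continuous_map (top_of_set {0..1}) FT h"
  using h_inv continuous_map_into_fulltopology unfolding homeomorphic_maps_def by blast

lemma continuous_h_inv: "continuous_map (subtopology FT Arc) (top_of_set {0..1}) h_inv"
  using h_inv unfolding homeomorphic_maps_def by blast

lemma topspace_arc: "topspace (subtopology FT Arc) = Arc"
  by (simp add: Int_absorb1 std_closure_subset)

lemma h_inv_h: "t \<in> {0..1} \<Longrightarrow> h_inv (h t) = t"
  using h_inv unfolding homeomorphic_maps_def by auto

lemma h_h_inv: "x \<in> Arc \<Longrightarrow> h (h_inv x) = x"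
  using h_inv topspace_arc unfolding homeomorphic_maps_def by auto

lemma h_inv_unit: "x \<in> Arc \<Longrightarrow> h_inv x \<in> {0..1}"
  using continuous_map_image_subset_topspace[OF continuous_h_inv] topspace_arc by fastforce

lemma h_in_arc: "t \<in> {0..1} \<Longrightarrow> h t \<in> Arc"
  using homeomorphic_imp_surjective_map[OF homeomorphic] topspace_arc by auto

lemma SP_in_arc:
  assumes "s \<in> SP"
  shows "Gp (vertex_pt s) \<in> Arc"
proof -
  have "s \<in> fst G" using assms unfolding SP_eq by blast
  then have "Gp (vertex_pt s) \<in> graph_pts G P"
    using assms vertex_gpt unfolding graph_pts_def by (intro imageI CollectI) simp
  then show ?thesis using graph_pts_subset by blast
qed

lemma \<tau>_in_unit: "s \<in> SP \<Longrightarrow> \<tau> s \<in> {0..1}"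
  unfolding \<tau>_def using h_inv_unit SP_in_arc by blast

lemma h_\<tau>: "s \<in> SP \<Longrightarrow> h (\<tau> s) = Gp (vertex_pt s)"
  unfolding \<tau>_def using h_h_inv SP_in_arc by blast

lemma inj_on_\<tau>: "inj_on \<tau> SP"
  by (rule inj_onI) (metis h_\<tau> fpoint.inject(1) vertex_pt_inject)

lemma \<tau>_not_in_E: "s \<in> SP \<Longrightarrow> \<tau> s \<notin> E"
  unfolding E_def using h_\<tau> by auto

lemma h_end_at:
  assumes "e \<in> E"
  shows "e \<in> {0..1}" "h e = Ep (end_at e)" "end_at e \<in> ends G"
proof -
  show e: "e \<in> {0..1}" "h e = Ep (end_at e)" using assms unfolding E_def end_at_def by auto
  then show "end_at e \<in> ends G" using subsetD[OF std_closure_subset h_in_arc[OF e(1)]] by (auto simp: fpoints_def)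
qed

lemma end_at_inj: "inj_on end_at E"
  using h_end_at h_inv_h by (intro inj_onI) metis

lemma closed_E: "closed E"
proof -
  have "openin (top_of_set {0..1}) {t \<in> topspace (top_of_set {0..1}). h t \<in> Gp ` {p. is_gpt G p}}"
    by (rule openin_continuous_map_preimage[OF continuous_h openin_gpts])
  from closedin_diff[OF closedin_topspace this]
  have "closedin (top_of_set {0..1}) ({0..1} - {t \<in> {0..1}. h t \<in> Gp ` {p. is_gpt G p}})" by simp
  moreover have "{0..1} - {t \<in> {0..1}. h t \<in> Gp ` {p. is_gpt G p}} = E"
  proof -
    have "h t \<in> Gp ` {p. is_gpt G p} \<longleftrightarrow> \<not> (\<exists>\<omega>. h t = Ep \<omega>)" if "t \<in> {0..1}" for t
      using subsetD[OF std_closure_subset h_in_arc[OF that]] by (cases "h t") (auto simp: fpoints_def)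
    then show ?thesis unfolding E_def by auto
  qed
  ultimately show ?thesis using closedin_closed_trans closed_atLeastAtMost by metis
qed

lemma h_near_end:
  assumes e: "e \<in> E" and S: "finite S" "S \<subseteq> fst G" "C \<in> comps G S" "lives_in (end_at e) C"
  shows "\<exists>\<delta>>0. \<forall>t\<in>{0..1}. \<bar>t - e\<bar> < \<delta> \<longrightarrow> h t \<in> end_nbhd G S C"
proof -
  have "openin (top_of_set {0..1}) {t \<in> topspace (top_of_set {0..1}). h t \<in> end_nbhd G S C}"
    by (rule openin_continuous_map_preimage[OF continuous_h openin_end_nbhd[OF S(1-3)]])
  moreover have "e \<in> {t \<in> topspace (top_of_set {0..1}). h t \<in> end_nbhd G S C}"
    using h_end_at[OF e] S(4) by (simp add: end_in_end_nbhd)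
  ultimately show ?thesis unfolding openin_euclidean_subtopology_iff by (auto simp: dist_real_def)
qed

lemma ray_sp_tail:
  assumes r: "is_ray G r" "tail_in r C" and S: "finite S" "S \<subseteq> fst G" "C \<in> comps G S"
  shows "\<exists>n. \<forall>m\<ge>n. sp (r m) \<in> C"
proof -
  obtain k where k: "\<forall>m\<ge>k. r m \<in> C" using r(2) unfolding tail_in_def by blast
  obtain l where l: "\<forall>m\<ge>l. r m \<notin> closed_nbhd S"
    using ray_avoids_finite[OF r(1) finite_closed_nbhd[OF S(1,2)]] by blast
  have "sp (r m) \<in> C" if m: "max k l \<le> m" for m
  proof (cases "r m \<in> SP")
    case True
    then show ?thesis using k m unfolding sp_def by simp
  next
    case False
    then have edge: "{r m, sp (r m)} \<in> snd G" using sp_adj ray_vertex[OF r(1)] by blast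
    then have "sp (r m) \<notin> S" using l m closed_nbhd_edge[of "sp (r m)" S "r m"] by (auto simp: insert_commute)
    then show ?thesis using comp_edge[OF S(3) _ edge] k m by simp
  qed
  then show ?thesis by blast
qed

lemma ray_limit:
  assumes e: "e \<in> E" and r: "r \<in> end_at e"
  shows "(\<lambda>n. \<tau> (sp (r n))) \<longlonglongrightarrow> e"
proof -
  note he = h_end_at[OF e]
  have ray: "is_ray G r" by (rule end_ray[OF he(3) r])
  have sp: "sp (r n) \<in> SP" for n using sp_SP ray_vertex[OF ray] by blast
  have "limitin FT (\<lambda>n. Gp (vertex_pt (sp (r n)))) (Ep (end_at e)) sequentially"
    unfolding limitin_def
  proof (intro conjI allI impI)
    show "Ep (end_at e) \<in> topspace FT" using he(3) by (simp add: fpoints_def)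
    fix U assume "openin FT U \<and> Ep (end_at e) \<in> U"
    then obtain N where N: "basic_nbhd G (Ep (end_at e)) N" "N \<subseteq> U" unfolding openin_FT by blast
    then obtain S C where S: "finite S" "S \<subseteq> fst G" "C \<in> comps G S" "lives_in (end_at e) C" "N = end_nbhd G S C"
      unfolding basic_nbhd_def by auto
    then obtain n where "\<forall>m\<ge>n. sp (r m) \<in> C" using ray_sp_tail[OF ray _ S(1-3)] r by blast
    then have "\<forall>m\<ge>n. Gp (vertex_pt (sp (r m))) \<in> U"
      using N(2) vertex_in_end_nbhd[OF S(3)] unfolding S(5) by blast
    then show "\<forall>\<^sub>F n in sequentially. Gp (vertex_pt (sp (r n))) \<in> U"
      unfolding eventually_sequentially by blast
  qed
  moreover have "Ep (end_at e) \<in> Arc" using h_in_arc[OF he(1)] he(2) by simp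
  ultimately have "limitin (subtopology FT Arc) (\<lambda>n. Gp (vertex_pt (sp (r n)))) (Ep (end_at e)) sequentially"
    using SP_in_arc sp by (simp add: limitin_subtopology)
  from continuous_map_limit[OF continuous_h_inv this]
  have "limitin (top_of_set {0..1}) (\<lambda>n. \<tau> (sp (r n))) (h_inv (Ep (end_at e))) sequentially"
    by (simp add: comp_def \<tau>_def)
  then show ?thesis using h_inv_h[OF he(1)] he(2) by (simp add: limitin_subtopology)
qed

end

context caterpillar
begin

lemma edge_curve:
  assumes e: "{u, v} \<in> snd P"
  shows "\<exists>k. continuous_on {0..1} k \<and> inj_on k {0..1} \<and> k 0 = \<tau> u \<and> k 1 = \<tau> v \<and>
    (\<forall>c\<in>{0..1}. k c \<in> {0..1} \<and> h (k c) = Gp (edge_pt u v c))"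
proof -
  have uv: "{u, v} \<in> snd G" "u \<in> SP" "v \<in> SP" "u \<noteq> v" using P_edge[OF e] by auto
  let ?g = "\<lambda>c. Gp (edge_pt u v c)"
  have g: "?g c \<in> Arc" if c: "c \<in> {0..1}" for c
  proof -
    consider "c = 0" | "c = 1" | "0 < c" "c < 1" using c by fastforce
    then show ?thesis
    proof cases
      case 3
      then have "?g c \<in> graph_pts G P"
        using edge_pt_gpt[OF uv(1), of c] edge_pt_support[OF uv(4), of c] e unfolding graph_pts_def by simp
      then show ?thesis using graph_pts_subset by blast
    qed (use SP_in_arc uv in auto)
  qed
  have "continuous_map (top_of_set {0..1}) (subtopology FT Arc) ?g"
    using continuous_edge_pt[OF uv(1)] g by (auto simp: continuous_map_in_subtopology)
  then have "continuous_map (top_of_set {0..1}) (top_of_set {0..1}) (h_inv \<circ> ?g)"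
    using continuous_h_inv by (rule continuous_map_compose)
  then have "continuous_on {0..1} (h_inv \<circ> ?g)" by (simp add: continuous_map_in_subtopology)
  moreover have h_curve: "h ((h_inv \<circ> ?g) c) = ?g c" "(h_inv \<circ> ?g) c \<in> {0..1}" if "c \<in> {0..1}" for c
    using h_h_inv h_inv_unit g[OF that] by simp_all
  moreover have "inj_on (h_inv \<circ> ?g) {0..1}"
  proof (rule inj_onI)
    fix c d :: real assume "c \<in> {0..1}" "d \<in> {0..1}" "(h_inv \<circ> ?g) c = (h_inv \<circ> ?g) d"
    then have "edge_pt u v c = edge_pt u v d" using h_curve(1)[of c] h_curve(1)[of d] by simp
    then show "c = d" using edge_pt_target[OF uv(4)] by metis
  qed
  ultimately show ?thesis by (intro exI[of _ "h_inv \<circ> ?g"]) (simp add: \<tau>_def)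
qed

lemma edge_interval_empty:
  assumes e: "{u, v} \<in> snd P" and t: "\<tau> u < t" "t < \<tau> v"
  shows "t \<notin> E" "t \<notin> \<tau> ` SP"
proof -
  obtain k where k: "continuous_on {0..1} k" "k 0 = \<tau> u" "k 1 = \<tau> v" "\<forall>c\<in>{0..1}. k c \<in> {0..1} \<and> h (k c) = Gp (edge_pt u v c)"
    using edge_curve[OF e] by blast
  obtain c where c: "0 \<le> c" "c \<le> 1" "k c = t" using IVT'[of k 0 t 1] k(1-3) t by auto
  then have "c \<noteq> 0" "c \<noteq> 1" using k(2,3) t by auto
  then have supp: "{w. edge_pt u v c w \<noteq> 0} = {u, v}" "u \<noteq> v"
    using edge_pt_support[of u v c] c P_edge[OF e] by auto
  have ht: "h t = Gp (edge_pt u v c)" using k(4) c by auto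
  then show "t \<notin> E" unfolding E_def by simp
  show "t \<notin> \<tau> ` SP"
  proof
    assume "t \<in> \<tau> ` SP"
    then obtain s where "vertex_pt s = edge_pt u v c" using h_\<tau> ht by auto
    then show False using supp vertex_pt_support[of s] by auto
  qed
qed

lemma edge_pt_between:
  assumes e: "{u, v} \<in> snd P" and t: "t \<in> {0..1}" "h t = Gp (edge_pt u v c)" and c: "0 < c" "c < 1"
  shows "\<tau> u < t \<and> t < \<tau> v \<or> \<tau> v < t \<and> t < \<tau> u"
proof -
  obtain k where k: "continuous_on {0..1} k" "inj_on k {0..1}" "k 0 = \<tau> u" "k 1 = \<tau> v"
    "\<forall>c\<in>{0..1}. k c \<in> {0..1} \<and> h (k c) = Gp (edge_pt u v c)"
    using edge_curve[OF e] by blast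
  have "h (k c) = h t" "k c \<in> {0..1}" using k(5) c t(2) by auto
  then have "k c = t" using h_inv_h t(1) by metis
  then show ?thesis using continuous_inj_imp_mono[OF c k(1,2)] k(3,4) by auto
qed

lemma edge_around:
  assumes t: "t \<in> {0..1}" "t \<notin> E" "t \<notin> \<tau> ` SP"
  shows "\<exists>u v. {u, v} \<in> snd P \<and> \<tau> u < t \<and> t < \<tau> v"
proof -
  obtain p where p: "h t = Gp p" using t unfolding E_def by (cases "h t") auto
  then have Arc: "Gp p \<in> Arc" using h_in_arc[OF t(1)] by simp
  then have gpt: "is_gpt G p" by (rule std_closure_gpt)
  then show ?thesis
  proof (cases rule: gpt_cases)
    case (vertex s)
    then have "s \<in> SP" using vertex_in_std_closure[OF subgraph_P] Arc by simp
    moreover have "\<tau> s = t" using h_inv_h[OF t(1)] p vertex unfolding \<tau>_def by simp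
    ultimately show ?thesis using t(3) by blast
  next
    case (edge u v)
    then have e: "{u, v} \<in> snd P" using edge_in_std_closure[OF Arc] by blast
    have "p = edge_pt u v (p v)" "0 < p v" "p v < 1" using gpt_eq_edge_pt[OF gpt edge(3,2)] by blast+
    then have "\<tau> u < t \<and> t < \<tau> v \<or> \<tau> v < t \<and> t < \<tau> u" using edge_pt_between[OF e t(1)] p by metis
    then show ?thesis using e by (metis insert_commute)
  qed
qed

lemma SP_discrete:
  assumes t: "t \<in> {0..1}" "t \<notin> E"
  shows "\<exists>\<epsilon>>0. finite {s \<in> SP. \<bar>\<tau> s - t\<bar> < \<epsilon>}"
proof -
  obtain p where p: "h t = Gp p" using t unfolding E_def by (cases "h t") auto
  then have "is_gpt G p" using std_closure_gpt h_in_arc[OF t(1)] by metis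
  then obtain S where S: "finite S" "S \<subseteq> fst G" "sum p S = 1" using gpt_support_sum by blast
  define f where "f x = (\<Sum>w\<in>S. coord w x)" for x
  have "continuous_map FT euclideanreal f"
    unfolding f_def using S continuous_coord by (intro continuous_map_sum) auto
  then have "continuous_on {0..1} (f \<circ> h)" using continuous_map_compose[OF continuous_h] by fastforce
  moreover have "(f \<circ> h) t = 1" using p S(3) by (simp add: f_def)
  ultimately obtain \<epsilon> where \<epsilon>: "\<epsilon> > 0" "\<forall>t'\<in>{0..1}. dist t' t < \<epsilon> \<longrightarrow> dist ((f \<circ> h) t') 1 < 1"
    using t(1) unfolding continuous_on_iff by (metis zero_less_one)
  have "s \<in> S" if s: "s \<in> SP" "\<bar>\<tau> s - t\<bar> < \<epsilon>" for s
  proof (rule ccontr)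
    assume "s \<notin> S"
    then have "f (h (\<tau> s)) = 0" using h_\<tau>[OF s(1)] by (auto simp: f_def vertex_pt_def intro: sum.neutral)
    moreover have "dist (f (h (\<tau> s))) 1 < 1" using \<epsilon>(2) \<tau>_in_unit[OF s(1)] s(2) by (auto simp: dist_real_def)
    ultimately show False by (simp add: dist_real_def)
  qed
  then have "{s \<in> SP. \<bar>\<tau> s - t\<bar> < \<epsilon>} \<subseteq> S" by blast
  then show ?thesis using \<epsilon>(1) S(1) finite_subset by blast
qed

lemma SP_neighbours_adjacent:
  assumes s: "s \<in> SP" "s' \<in> SP" "\<tau> s < \<tau> s'"
    and none: "\<forall>u\<in>SP. \<not> (\<tau> s < \<tau> u \<and> \<tau> u < \<tau> s')" "\<forall>e\<in>E. \<not> (\<tau> s < e \<and> e < \<tau> s')"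
  shows "{s, s'} \<in> snd G"
proof -
  define t where "t = (\<tau> s + \<tau> s') / 2"
  have t: "\<tau> s < t" "t < \<tau> s'" unfolding t_def using s by auto
  have "t \<in> {0..1}" using \<tau>_in_unit[OF s(1)] \<tau>_in_unit[OF s(2)] t by auto
  moreover have "t \<notin> E" "t \<notin> \<tau> ` SP" using none t by blast+
  ultimately obtain u v where uv: "{u, v} \<in> snd P" "\<tau> u < t" "t < \<tau> v" using edge_around by blast
  have S: "u \<in> SP" "v \<in> SP" using P_edge[OF uv(1)] by auto
  have inner: "\<not> (\<tau> u < \<tau> w \<and> \<tau> w < \<tau> v)" if "w \<in> SP" for w
    using edge_interval_empty(2)[OF uv(1)] that by blast
  have "\<tau> u = \<tau> s" using bspec[OF none(1) S(1)] inner[OF s(1)] uv t by linarith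
  moreover have "\<tau> v = \<tau> s'" using bspec[OF none(1) S(2)] inner[OF s(2)] uv t by linarith
  ultimately show ?thesis using inj_onD[OF inj_on_\<tau>] s S P_edge[OF uv(1)] by blast
qed

lemma SP_around:
  assumes t: "t \<in> {0..1}" "t \<notin> E"
  shows "\<exists>s\<in>SP. \<exists>s'\<in>SP. \<tau> s \<le> t \<and> t \<le> \<tau> s' \<and> (\<forall>e\<in>E. \<not> (\<tau> s \<le> e \<and> e \<le> \<tau> s'))"
proof (cases "t \<in> \<tau> ` SP")
  case True
  then show ?thesis using \<tau>_not_in_E by (force dest: order_antisym)
next
  case False
  then obtain u v where uv: "{u, v} \<in> snd P" "\<tau> u < t" "t < \<tau> v" using edge_around t by blast
  have S: "u \<in> SP" "v \<in> SP" using P_edge[OF uv(1)] by auto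
  have "\<not> (\<tau> u \<le> e \<and> e \<le> \<tau> v)" if e: "e \<in> E" for e
  proof -
    have "e \<noteq> \<tau> u" "e \<noteq> \<tau> v" "\<not> (\<tau> u < e \<and> e < \<tau> v)"
      using \<tau>_not_in_E S e edge_interval_empty(1)[OF uv(1)] by blast+
    then show ?thesis by linarith
  qed
  then show ?thesis using uv S by (intro bexI[of _ u] bexI[of _ v]) auto
qed

sublocale spine "fst G" SP "\<lambda>u v. {u, v} \<in> snd G" sp \<tau> E
proof
  show "{v, u} \<in> snd G" if "{u, v} \<in> snd G" for u v using that by (simp add: insert_commute)
  show "(\<lambda>u v. {u, v} \<in> snd G)\<^sup>*\<^sup>* u v" if "u \<in> fst G" "v \<in> fst G" for u v
  proof -
    have "reach G (fst G) u v" using graph_connected that unfolding connected_graph_def by blast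
    then show ?thesis unfolding reach_def by (rule rtranclp_mono[THEN predicate2D, rotated]) auto
  qed
  show "\<exists>r. (\<forall>n. {r n, r (Suc n)} \<in> snd G) \<and> (\<lambda>n. \<tau> (sp (r n))) \<longlonglongrightarrow> e" if e: "e \<in> E" for e
  proof -
    obtain r where r: "r \<in> end_at e" using end_nonempty h_end_at(3)[OF e] by blast
    then show ?thesis using ray_limit[OF e r] end_ray[OF h_end_at(3)[OF e]] unfolding is_ray_def by blast
  qed
  show "SP \<subseteq> fst G" unfolding SP_eq by blast
  show "E \<subseteq> {0..1}" unfolding E_def by blast
  show "sp s = s" if "s \<in> SP" for s using that unfolding sp_def by simp
qed (fact edge_vertices sp_SP sp_adj finite_sp_block closed_E \<tau>_in_unit inj_on_\<tau> \<tau>_not_in_E SP_discrete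
    SP_neighbours_adjacent SP_around)+

lemma sp_in_square_comp:
  assumes C: "C \<in> comps (graph_square G) S" and D: "D \<in> comps G (closed_nbhd S)" "D \<subseteq> C"
    and z: "z \<in> fst G" "sp z \<in> D"
  shows "z \<in> C"
proof (cases "z \<in> SP")
  case True
  then show ?thesis using z(2) D(2) sp_id by auto
next
  case False
  interpret sq: lf_graph "graph_square G" by (rule lf_graph_square)
  have edge: "{sp z, z} \<in> snd G" using sp_adj[OF z(1) False] by (simp add: insert_commute)
  moreover have "sp z \<notin> closed_nbhd S" using comp_subset[OF D(1)] z(2) by blast
  ultimately have "z \<notin> S" using closed_nbhd_edge[of z S "sp z"] by (auto simp: insert_commute)
  then show ?thesis
    using sq.comp_edge[OF C subsetD[OF D(2) z(2)] subsetD[OF subset_square edge]] by blast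
qed

lemma square_near_end:
  assumes e: "e \<in> E" and S: "finite S" "S \<subseteq> fst G" "C \<in> comps (graph_square G) S"
    and C: "lives_in (square_end (end_at e)) C"
  shows "\<exists>\<delta>>0. (\<forall>z\<in>fst G. \<bar>pos z - e\<bar> < \<delta> \<longrightarrow> z \<in> C) \<and>
    (\<forall>e'\<in>E. \<bar>e' - e\<bar> < \<delta> \<longrightarrow> lives_in (square_end (end_at e')) C)"
proof -
  note \<omega> = h_end_at(3)[OF e]
  have N: "finite (closed_nbhd S)" "closed_nbhd S \<subseteq> fst G"
    using finite_closed_nbhd[OF S(1,2)] closed_nbhd_subset[OF S(2)] by auto
  obtain D where D: "D \<in> comps G (closed_nbhd S)" "lives_in (end_at e) D" using end_comp[OF \<omega> N] by blast
  obtain r where r: "r \<in> end_at e" using end_nonempty[OF \<omega>] by blast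
  then have "tail_in r D" "tail_in r C" using D(2) C subset_square_end[OF \<omega>] by blast+
  then obtain x where x: "x \<in> D" "x \<in> C" using tail_in_common by blast
  have DC: "D \<subseteq> C"
    using comp_mono[OF D(1) S(3) subset_square _ x] subset_closed_nbhd[of S] by auto
  obtain \<delta> where \<delta>: "\<delta> > 0" "\<And>t. t \<in> {0..1} \<Longrightarrow> \<bar>t - e\<bar> < \<delta> \<Longrightarrow> h t \<in> end_nbhd G (closed_nbhd S) D"
    using h_near_end[OF e N D] by blast
  have "z \<in> C" if z: "z \<in> fst G" "\<bar>pos z - e\<bar> < \<delta>" for z
  proof -
    have "h (\<tau> (sp z)) \<in> end_nbhd G (closed_nbhd S) D"
      using \<delta>(2) z \<tau>_in_unit[OF sp_SP[OF z(1)]] by (simp add: pos_def)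
    then have "sp z \<in> D" unfolding h_\<tau>[OF sp_SP[OF z(1)]] vertex_in_end_nbhd[OF D(1)] .
    then show ?thesis by (rule sp_in_square_comp[OF S(3) D(1) DC z(1)])
  qed
  moreover have "lives_in (square_end (end_at e')) C" if e': "e' \<in> E" "\<bar>e' - e\<bar> < \<delta>" for e'
  proof (rule square_end_lives_in[OF h_end_at(3)[OF e'(1)] _ S])
    have "lives_in (end_at e') D"
      using \<delta>(2)[OF h_end_at(1)[OF e'(1)] e'(2)] unfolding h_end_at(2)[OF e'(1)] end_in_end_nbhd by blast
    then show "lives_in (end_at e') C" using DC tail_in_mono by blast
  qed
  ultimately show ?thesis using \<delta>(1) by blast
qed

theorem hamiltonian_square: "hamiltonian (graph_square G)"
proof -
  interpret sq: lf_graph "graph_square G" by (rule lf_graph_square)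
  interpret realised "fst G" SP "\<lambda>u v. {u, v} \<in> snd G" sp \<tau> E "graph_square G" "square_end \<circ> end_at"
  proof
    show "{u, v} \<in> snd (graph_square G)" if "adj_sq u v" for u v
      using that unfolding adj_sq_def square_edge .
    show "(square_end \<circ> end_at) e \<in> ends (graph_square G)" if "e \<in> E" for e
      using square_end_in_ends h_end_at(3)[OF that] by simp
    have "inj_on square_end (end_at ` E)"
      using square_end_inj by (rule inj_on_subset) (use h_end_at(3) in blast)
    then show "inj_on (square_end \<circ> end_at) E" by (rule comp_inj_on[OF end_at_inj])
  qed (use square_near_end in simp_all)
  show ?thesis using hamiltonian three by blast
qed

end

theorem theorem1p5:
  fixes G :: "'v graph"
  assumes "simple_graph G"
    and "locally_finite G"
    and "connected_graph G"
    and "\<exists>a\<in>fst G. \<exists>b\<in>fst G. \<exists>c\<in>fst G. a \<noteq> b \<and> a \<noteq> c \<and> b \<noteq> c"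
    and "\<exists>T. topological_caterpillar G T \<and> spanning G T"
  shows "hamiltonian (graph_square G)"
proof -
  obtain T where T: "topological_caterpillar G T" "spanning G T" using assms(5) by blast
  then obtain h where h: "homeomorphic_map (top_of_set {0..1::real})
      (subtopology (freudenthal G) (std_closure G (del_vertices T (leaves T)))) h"
    unfolding topological_caterpillar_def is_arc_def by blast
  interpret caterpillar G T h
    by unfold_locales (use assms T h in \<open>auto simp: topological_caterpillar_def topological_tree_def\<close>)
  show ?thesis by (rule hamiltonian_square)
qed

end
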